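(* Let $G$ and $H$ be two connected graphs. Let $r_1\in\{0,1,2,3\}$ with $r_1\equiv \kappa(G) \pmod 4$ and $r_2\in\{0,1,2,3\}$ with $r_2\equiv \kappa(H)\pmod 4$. Then $$\kappa_3(G\Box H)\leq \min\Big\{\Big\lfloor \tfrac{4}{3}\kappa_3(G)+r_1-\tfrac{4}{3}\lceil\tfrac{r_1}{2}\rceil\Big\rfloor|V(H)|,\ \Big\lfloor\tfrac{4}{3}\kappa_3(H)+r_2-\tfrac{4}{3}\lceil\tfrac{r_2}{2}\rceil\Big\rfloor |V(G)|,\ \delta(G)+\delta(H)\Big\}.$$ Moreover, the bound is sharp, i.e., there exist connected graphs $G,H$ for which equality holds.
   Context: All graphs are finite, simple and undirected. $\kappa(G)$ denotes the (vertex-)connectivity of $G$ and $\delta(G)$ its minimum degree. For $S\subseteq V(G)$ with $|S|\ge 2$, an $S$-tree is a subgraph of $G$ that is a tree containing $S$; two $S$-trees $T,T'$ are internally disjoint if $E(T)\cap E(T')=\varnothing$ and $V(T)\cap V(T')=S$. $\kappa(S)$ is the maximum number of pairwise internally disjoint $S$-trees in $G$. For $2\le k\le |V(G)|$, the generalized $k$-connectivity is $\kappa_k(G)=\min\{\kappa(S): S\subseteq V(G),\ |S|=k\}$; by convention $\kappa_k(G)=1$ if $G$ is connected with fewer than $k$ vertices, and $\kappa_k(G)=0$ if $G$ is disconnected. $G\Box H$ is the Cartesian product: vertex set $V(G)\times V(H)$, with $(u,v)$ adjacent to $(u',v')$ iff either $u=u'$ and $vv'\in E(H)$, or $v=v'$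 and $uu'\in E(G)$.
   Formalization: The case where both G and H are the one-vertex graph is excluded: there κ₃(G□H)=1 by convention while δ(G)+δ(H)=0, so the stated bound fails. *)

theory Defs
  imports
    Complex_Main
    "HOL-Number_Theory.Cong"
    "Graph_Theory.Graph_Theory"
begin

text \<open>
  A finite simple undirected graph is a \<^const>\<open>pair_graph\<close>: an undirected edge \<open>uv\<close> is represented
  by the two arcs \<open>(u, v)\<close> and \<open>(v, u)\<close>. For such graphs, disjointness of arc sets is the same as
  disjointness of edge sets, and the degree of a vertex is its out-degree.
  The library notion of connectedness excludes the graph without vertices.
\<close>

definition connected_graph :: "'a pair_pre_digraph \<Rightarrow> bool" where
  "connected_graph G \<longleftrightarrow> pair_graph G \<and> Digraph_Component.connected (with_proj G)"

definition min_degree :: "'a pair_pre_digraph \<Rightarrow> nat" where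
  "min_degree G = Min (out_degree (with_proj G) ` pverts G)"

text \<open>
  The connectivity is the least number of vertices whose removal leaves a disconnected graph or a
  single vertex; thus the complete graph on \<open>n\<close> vertices has connectivity \<open>n - 1\<close>.
\<close>

definition vertex_connectivity :: "'a pair_pre_digraph \<Rightarrow> nat" where
  "vertex_connectivity G =
     Min {card X | X. X \<subseteq> pverts G \<and>
       (\<not> Digraph_Component.connected (with_proj G \<restriction> (pverts G - X)) \<or> card (pverts G - X) = 1)}"

text \<open>
  \<^const>\<open>Digraph_Component.tree\<close> cannot be used here: in a symmetric digraph every edge gives the
  directed cycle \<open>(u, v), (v, u)\<close> of length two. The cycles of the undirected graph are exactly the
  directed cycles of length at least three.
\<close>

definition undirected_tree :: "'a pair_pre_digraph \<Rightarrow> bool" where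
  "undirected_tree T \<longleftrightarrow> connected_graph T \<and>
     \<not> (\<exists>p. pre_digraph.cycle (with_proj T) p \<and> 3 \<le> length p)"

definition S_tree :: "'a pair_pre_digraph \<Rightarrow> 'a set \<Rightarrow> 'a pair_pre_digraph \<Rightarrow> bool" where
  "S_tree G S T \<longleftrightarrow> undirected_tree T \<and> subgraph (with_proj T) (with_proj G) \<and> S \<subseteq> pverts T"

definition internally_disjoint ::
    "'a set \<Rightarrow> 'a pair_pre_digraph \<Rightarrow> 'a pair_pre_digraph \<Rightarrow> bool" where
  "internally_disjoint S T T' \<longleftrightarrow> parcs T \<inter> parcs T' = {} \<and> pverts T \<inter> pverts T' = S"

definition set_connectivity :: "'a pair_pre_digraph \<Rightarrow> 'a set \<Rightarrow> nat" where
  "set_connectivity G S =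
     Max {card F | F. (\<forall>T\<in>F. S_tree G S T) \<and> pairwise (internally_disjoint S) F}"

definition gen_connectivity :: "nat \<Rightarrow> 'a pair_pre_digraph \<Rightarrow> nat" where
  "gen_connectivity k G =
     (if \<not> Digraph_Component.connected (with_proj G) then 0
      else if card (pverts G) < k then 1
      else Min {set_connectivity G S | S. S \<subseteq> pverts G \<and> card S = k})"

definition cartesian_product ::
    "'a pair_pre_digraph \<Rightarrow> 'b pair_pre_digraph \<Rightarrow> ('a \<times> 'b) pair_pre_digraph" (infixr \<open>\<box>\<close> 70) where
  "G \<box> H = \<lparr> pverts = pverts G \<times> pverts H,
     parcs = {((u, v), (u', v')) | u v u' v'.
       (u = u' \<and> u \<in> pverts G \<and> (v, v') \<in> parcs H) \<or>
       (v = v' \<and> v \<in> pverts H \<and> (u, u') \<in> parcs G)} \<rparr>"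

text \<open>
  If both graphs have a single vertex, so has their product: its generalized 3-connectivity is \<open>1\<close> by
  convention while the minimum degrees add up to \<open>0\<close>. The bound therefore presupposes that one of the
  graphs has at least two vertices.
\<close>

definition product_bound ::
    "'a pair_pre_digraph \<Rightarrow> 'b pair_pre_digraph \<Rightarrow> nat \<Rightarrow> nat \<Rightarrow> int" where
  "product_bound G H r1 r2 = Min
     {\<lfloor>4 / 3 * real (gen_connectivity 3 G) + real r1 - 4 / 3 * real_of_int \<lceil>real r1 / 2\<rceil>\<rfloor>
        * int (card (pverts H)),
      \<lfloor>4 / 3 * real (gen_connectivity 3 H) + real r2 - 4 / 3 * real_of_int \<lceil>real r2 / 2\<rceil>\<rfloor>
        * int (card (pverts G)),
      int (min_degree G + min_degree H)}"

end

theory Submission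
  imports Defs
begin

text \<open>
  A vertex cut \<open>X\<close> of \<open>G\<close> lifts to the cut \<open>X \<times> V(H)\<close> of the product, and each of several internally
  disjoint trees through a suitable triple of vertices uses a vertex of that cut; hence the
  generalized 3-connectivity of the product is at most \<open>\<kappa>(G) |V(H)|\<close>. It is at most the degree of any
  vertex as well. It remains to bound \<open>\<kappa>(G)\<close> by the first factor of the claimed product, which is
  the inequality of Li, Li and Zhou: if \<open>\<kappa>(G) = 4s + r\<close> then \<open>\<kappa>\<^sub>3(G) \<ge> 3s + \<lceil>r/2\<rceil>\<close>.

  For the latter take \<open>k = \<kappa>(G)\<close> internally disjoint paths from \<open>x\<close> to \<open>y\<close> and a fan from \<open>z\<close> to them.
  A path that is hit at least twice is cut open between its first and its last hit, and the vertices
  in between are released. Augmenting the fan by Menger's theorem, with its ends kept, adds a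
  hit or releases more vertices; so there is a fan of size \<open>k\<close> that hits every path at most twice.
  A path hit once gives a tree through \<open>x\<close>, \<open>y\<close>, \<open>z\<close>; a path hit twice gives an \<open>x\<close>--\<open>z\<close> and a
  \<open>y\<close>--\<open>z\<close> path; a path not hit is an \<open>x\<close>--\<open>y\<close> path; two of these paths of different kinds form a
  tree. If \<open>m\<close> paths are hit twice, this yields \<open>k - \<lceil>m/2\<rceil>\<close> trees, and \<open>2m \<le> k\<close>.
\<close>

section \<open>Augmenting disjoint paths\<close>

text \<open>The first two entries of the minimum invert that inequality, so they dominate the two
  lifted cuts.

  Why ceil(m/2) trees are lost: paths and hits both number k. If hx and hy count the fan paths that
  end in x and y on no path of the system, then there are m + hx + hy links xy, m + hx links xz and
  m + hy links yz.

  Two obstacles shape the details. The terminal z may itself lie on one of the x--y paths. It has to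
  be hidden before any augmentation, so its two neighbours on that path are the first hits; as these
  may be x or y, the two ends count as points of that path. On the product side, the cut argument
  needs three vertices outside the lifted cut, in at least two components. It fails if the cut
  leaves one vertex of G, or only two vertices of the product; there a degree bound takes
  over.\<close>

definition path_in :: "'a rel \<Rightarrow> 'a set \<Rightarrow> 'a list \<Rightarrow> bool" where
  "path_in E W p \<longleftrightarrow> p \<noteq> [] \<and> distinct p \<and> successively (\<lambda>u v. (u, v) \<in> E) p \<and> set p \<subseteq> W"

text \<open>Disjoint paths from A to B, normalised at the B end only. With \<open>A = nbrs z\<close>
  and \<open>W = V - {z}\<close> this is a fan from z whose centre has been removed, so that its
  members are disjoint as sets.\<close>

definition linkage :: "'a rel \<Rightarrow> 'a set \<Rightarrow> 'a set \<Rightarrow> 'a set \<Rightarrow> 'a list set \<Rightarrow> bool" where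
  "linkage E W A B Ps \<longleftrightarrow> finite Ps \<and>
     (\<forall>p\<in>Ps. path_in E W p \<and> hd p \<in> A \<and> set p \<inter> B = {last p}) \<and>
     (\<forall>p\<in>Ps. \<forall>q\<in>Ps. p \<noteq> q \<longrightarrow> set p \<inter> set q = {})"

lemma path_in_append:
  "path_in E W (p @ q) \<longleftrightarrow>
     (p = [] \<and> path_in E W q) \<or> (q = [] \<and> path_in E W p) \<or>
     (path_in E W p \<and> path_in E W q \<and> (last p, hd q) \<in> E \<and> set p \<inter> set q = {})"
  by (cases "p = []"; cases "q = []") (auto simp: path_in_def successively_append_iff)

lemma path_in_Cons:
  "path_in E W (v # p) \<longleftrightarrow> v \<in> W \<and> (p = [] \<or> (path_in E W p \<and> (v, hd p) \<in> E \<and> v \<notin> set p))"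
  by (cases p) (auto simp: path_in_def)

lemma path_in_prefix: "path_in E W (p @ q) \<Longrightarrow> p \<noteq> [] \<Longrightarrow> path_in E W p"
  by (auto simp: path_in_append)

lemma path_in_mono: "path_in E W p \<Longrightarrow> W \<subseteq> W' \<Longrightarrow> path_in E W' p"
  by (auto simp: path_in_def)

lemma path_in_not_Nil: "path_in E W p \<Longrightarrow> p \<noteq> []"
  by (simp add: path_in_def)

lemma path_in_rev: "sym E \<Longrightarrow> path_in E W p \<Longrightarrow> path_in E W (rev p)"
  unfolding path_in_def by (auto simp: successively_rev elim!: successively_mono dest: symD)

lemma rtrancl_imp_path_in:
  assumes "(u, v) \<in> (E \<inter> W \<times> W)\<^sup>*" "u \<in> W"
  shows "\<exists>p. path_in E W p \<and> hd p = u \<and> last p = v"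
  using assms
proof (induction rule: converse_rtrancl_induct)
  case base
  then show ?case by (intro exI[of _ "[v]"]) (simp add: path_in_def)
next
  case (step t u)
  then obtain p where p: "path_in E W p" "hd p = u" "last p = v" by auto
  show ?case
  proof (cases "t \<in> set p")
    case True
    then obtain l r where "p = l @ t # r" by (meson split_list)
    with p show ?thesis
      by (intro exI[of _ "t # r"]) (auto simp: path_in_append path_in_Cons)
  next
    case False
    with p step show ?thesis
      by (intro exI[of _ "t # p"]) (auto simp: path_in_Cons path_in_not_Nil)
  qed
qed

lemma linkageD:
  assumes "linkage E W A B Ps"
  shows "finite Ps"
    and "p \<in> Ps \<Longrightarrow> path_in E W p"
    and "p \<in> Ps \<Longrightarrow> hd p \<in> A"
    and "p \<in> Ps \<Longrightarrow> set p \<inter> B = {last p}"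
    and "p \<in> Ps \<Longrightarrow> q \<in> Ps \<Longrightarrow> p \<noteq> q \<Longrightarrow> set p \<inter> set q = {}"
    and "p \<in> Ps \<Longrightarrow> p \<noteq> []"
    and "p \<in> Ps \<Longrightarrow> v \<in> set p \<Longrightarrow> v \<in> B \<Longrightarrow> v = last p"
    and "p \<in> Ps \<Longrightarrow> last p \<in> B"
  using assms by (auto simp: linkage_def path_in_def)

lemma linkage_mono:
  assumes "linkage E W A B Ps" "B' \<subseteq> B" "last ` Ps \<subseteq> B'"
  shows "linkage E W A B' Ps"
  using assms unfolding linkage_def by blast

lemma linkage_subset: "linkage E W A B Ps \<Longrightarrow> Qs \<subseteq> Ps \<Longrightarrow> linkage E W A B Qs"
  unfolding linkage_def by (meson finite_subset subset_iff)

lemma linkage_inj_last: "linkage E W A B Ps \<Longrightarrow> inj_on last Ps"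
  unfolding linkage_def inj_on_def path_in_def by (metis disjoint_iff last_in_set)

lemma path_meeting_set_once:
  assumes "path_in E W p" "last p \<in> B"
  obtains q where "path_in E W q" "hd q = hd p" "set q \<inter> B = {last q}"
proof -
  from assms have "\<exists>v\<in>set p. v \<in> B" by (auto simp: path_in_def)
  from split_list_first_prop[OF this]
  obtain l v r where p: "p = l @ v # r" "v \<in> B" "\<forall>u\<in>set l. u \<notin> B"
    by blast
  with assms have "path_in E W (l @ [v])"
    by (auto simp: path_in_append path_in_Cons)
  moreover have "set (l @ [v]) \<inter> B = {last (l @ [v])}" using p by auto
  moreover have "hd (l @ [v]) = hd p" using p by (cases l) auto
  ultimately show thesis using that by blast
qed

lemma Int_eq_singleton_imp_disjoint: "A \<inter> B = {c} \<Longrightarrow> c \<notin> C \<Longrightarrow> C \<subseteq> B \<Longrightarrow> A \<inter> C = {}"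
  by (auto simp: set_eq_iff)

text \<open>Paths linked to the larger target \<open>B'\<close> meet it only in their ends. A tail
  inside \<open>B'\<close> that avoids these ends is therefore disjoint from every path, and two
  paths can be prolonged along disjoint tails until they reach B.\<close>

lemma linkage_extend_two:
  assumes L: "linkage E W A B' Qs" and B: "B \<subseteq> B'"
    and Q: "Q \<in> Qs" "Q' \<in> Qs" "Q \<noteq> Q'"
    and pQ: "path_in E W (Q @ C)" and pQ': "path_in E W (Q' @ D)"
    and sub: "set C \<subseteq> B'" "set D \<subseteq> B'" and CD: "set C \<inter> set D = {}"
    and ends: "set C \<inter> last ` Qs = {}" "set D \<inter> last ` Qs = {}"
    and hits: "insert (last Q) (set C) \<inter> B = {last (Q @ C)}"
      "insert (last Q') (set D) \<inter> B = {last (Q' @ D)}"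
    and others: "\<And>q. q \<in> Qs \<Longrightarrow> q \<noteq> Q \<Longrightarrow> q \<noteq> Q' \<Longrightarrow> last q \<in> B"
  shows "\<exists>Rs. linkage E W A B Rs \<and> card Rs = card Qs \<and>
    last ` Rs = last ` (Qs - {Q, Q'}) \<union> {last (Q @ C), last (Q' @ D)}"
proof -
  note dis = linkageD(5)[OF L] and ne = linkageD(6)[OF L] and sb = linkageD(4)[OF L]
    and hA = linkageD(3)[OF L] and pq = linkageD(2)[OF L]
  have disjB: "set q \<inter> set C = {}" "set q \<inter> set D = {}" if "q \<in> Qs" for q
  proof -
    have "last q \<notin> set C" "last q \<notin> set D" using that ends by auto
    with sub show "set q \<inter> set C = {}" "set q \<inter> set D = {}"
      by (simp_all add: Int_eq_singleton_imp_disjoint[OF sb[OF that]])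
  qed
  define Rs where "Rs = (Qs - {Q, Q'}) \<union> {Q @ C, Q' @ D}"
  have fin: "finite Qs" using L by (simp add: linkage_def)
  have new: "set (Q @ C) \<inter> set (Q' @ D) = {}"
    using dis[OF Q] disjB(1)[OF Q(2)] disjB(2)[OF Q(1)] CD
    by (simp add: Int_Un_distrib Int_Un_distrib2 Int_commute)
  have disR: "set q \<inter> set q' = {}" if "q \<in> Rs" "q' \<in> Rs" "q \<noteq> q'" for q q'
  proof -
    have sepC: "set r \<inter> set (Q @ C) = {}" if "r \<in> Qs - {Q, Q'}" for r
      using dis[of r Q] disjB(1)[of r] that Q(1) by (simp add: Int_Un_distrib)
    have sepD: "set r \<inter> set (Q' @ D) = {}" if "r \<in> Qs - {Q, Q'}" for r
      using dis[of r Q'] disjB(2)[of r] that Q(2) by (simp add: Int_Un_distrib)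
    show ?thesis
      using that new dis[of q q'] sepC[of q] sepC[of q'] sepD[of q] sepD[of q']
      unfolding Rs_def by (elim UnE insertE emptyE) (simp_all add: Int_commute)
  qed
  have neR: "Q @ C \<noteq> []" "Q' @ D \<noteq> []" using ne Q by auto
  have "Q @ C \<noteq> Q' @ D" using new neR by (metis Int_absorb set_empty)
  moreover have "Q @ C \<notin> Qs - {Q, Q'}"
    using dis[of Q "Q @ C"] Q(1) ne[OF Q(1)] by fastforce
  moreover have "Q' @ D \<notin> Qs - {Q, Q'}"
    using dis[of Q' "Q' @ D"] Q(2) ne[OF Q(2)] by fastforce
  moreover have "card (Qs - {Q, Q'}) + 2 = card Qs"
    using Q fin card_mono[OF fin, of "{Q, Q'}"] by (simp add: card_Diff_subset)
  ultimately have "card Rs = card Qs"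
    using fin unfolding Rs_def by (simp add: card_insert_if)
  moreover have "last ` Rs = last ` (Qs - {Q, Q'}) \<union> {last (Q @ C), last (Q' @ D)}"
    by (auto simp: Rs_def)
  moreover have "linkage E W A B Rs"
    unfolding linkage_def
  proof (intro conjI ballI impI)
    show "finite Rs" using fin by (simp add: Rs_def)
  next
    fix p assume p: "p \<in> Rs"
    consider "p \<in> Qs" "p \<noteq> Q" "p \<noteq> Q'" | "p = Q @ C" | "p = Q' @ D"
      using p by (auto simp: Rs_def)
    note cs = this
    show "path_in E W p" by (cases rule: cs) (use pq pQ pQ' in auto)
    show "hd p \<in> A" by (cases rule: cs) (use hA ne Q in auto)
    show "set p \<inter> B = {last p}"
    proof (cases rule: cs)
      case 1 then show ?thesis using sb[of p] others[of p] B by blast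
    next
      case 2
      have "set p \<inter> B = insert (last Q) (set C) \<inter> B"
        using 2 sb[OF Q(1)] B by auto
      then show ?thesis using 2 hits by simp
    next
      case 3
      have "set p \<inter> B = insert (last Q') (set D) \<inter> B"
        using 3 sb[OF Q(2)] B by auto
      then show ?thesis using 3 hits by simp
    qed
  next
    fix p q assume "p \<in> Rs" "q \<in> Rs" "p \<noteq> q"
    then show "set p \<inter> set q = {}" by (rule disR)
  qed
  ultimately show ?thesis by blast
qed

text \<open>
  Menger's theorem in augmenting form (the ends of the given paths are kept), by induction on the
  number of vertices outside \<open>B\<close>: the tail of an avoiding path \<open>R\<close> and the tail of the path \<open>P\<close> it last
  meets are added to \<open>B\<close>.
\<close>

lemma linkage_augment:
  assumes "linkage E W A B Ps" "finite W" "card Ps < k"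
    and "\<And>X. X \<subseteq> W \<Longrightarrow> card X < k \<Longrightarrow> \<exists>p. path_in E (W - X) p \<and> hd p \<in> A \<and> last p \<in> B"
  shows "\<exists>Qs. linkage E W A B Qs \<and> card Qs = Suc (card Ps) \<and> last ` Ps \<subseteq> last ` Qs"
  using assms
proof (induction "card (W - B)" arbitrary: B Ps rule: less_induct)
  case less
  note L = less.prems(1) and nosep = less.prems(4)
  let ?X = "last ` Ps"
  note dis = linkageD(5)[OF L] and ne = linkageD(6)[OF L] and sb = linkageD(4)[OF L]
    and hA = linkageD(3)[OF L] and pq = linkageD(2)[OF L]
  have cX: "card ?X = card Ps" using linkage_inj_last[OF L] by (rule card_image)
  have XW: "?X \<subseteq> W" using pq ne by (force simp: path_in_def)
  have XB: "?X \<subseteq> B" using linkageD(8)[OF L] by blast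
  obtain R0 where R0: "path_in E (W - ?X) R0" "hd R0 \<in> A" "last R0 \<in> B"
    using nosep[OF XW] cX less.prems(3) by auto
  obtain R where R: "path_in E (W - ?X) R" "hd R \<in> A" "set R \<inter> B = {last R}"
    using path_meeting_set_once[OF R0(1,3)] R0(2) by metis
  have RW: "path_in E W R" using R(1) by (rule path_in_mono) auto
  have RX: "set R \<inter> ?X = {}" using R(1) by (auto simp: path_in_def)
  show ?case
  proof (cases "set R \<inter> \<Union> (set ` Ps) = {}")
    case True
    have "R \<noteq> []" using RW by (rule path_in_not_Nil)
    then have "R \<notin> Ps" using True by (metis Int_absorb UN_I disjoint_iff last_in_set)
    have "linkage E W A B (insert R Ps)"
      using L RW R True unfolding linkage_def by (auto simp: Int_commute)
    then show ?thesis
      using \<open>R \<notin> Ps\<close> linkageD(1)[OF L] by (intro exI[of _ "insert R Ps"]) auto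
  next
    case False
    then have "\<exists>v\<in>set R. v \<in> \<Union> (set ` Ps)" by blast
    from split_list_last_prop[OF this] obtain R1 v R2 where
      Rs: "R = R1 @ v # R2" "v \<in> \<Union> (set ` Ps)" "\<forall>u\<in>set R2. u \<notin> \<Union> (set ` Ps)" by blast
    then obtain P where P: "P \<in> Ps" "v \<in> set P" by blast
    then obtain P1 P2 where Ps: "P = P1 @ v # P2" by (meson split_list)
    \<comment> \<open>In B, the vertex v could only be the end of P, and R avoids these ends. So the
      target really grows and the induction proceeds.\<close>
    have vnB: "v \<notin> B"
    proof
      assume "v \<in> B"
      then have "v = last P" using linkageD(7)[OF L] P by blast
      then show False using P(1) RX Rs(1) by auto
    qed
    have "last P \<in> B" "last R \<in> B" using sb[OF P(1)] R(3) by auto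
    then have P2: "P2 \<noteq> []" and R2: "R2 \<noteq> []" using vnB Ps Rs by auto
    have lP: "last P = last P2" and lR: "last R = last R2" using P2 R2 Ps Rs by auto
    have pP: "path_in E W P" "distinct P" using pq[OF P(1)] by (auto simp: path_in_def)
    have dR: "distinct R" using RW by (simp add: path_in_def)
    have R2Ps: "set R2 \<inter> set p = {}" if "p \<in> Ps" for p using that Rs(3) by blast
    define B' where "B' = B \<union> {v} \<union> set P2 \<union> set R2"
    define P' where "P' = P1 @ [v]"
    define Ps' where "Ps' = insert P' (Ps - {P})"
    have pP': "path_in E W P'"
      using pP(1) unfolding P'_def Ps by (auto simp: path_in_append path_in_Cons)
    have hP': "hd P' \<in> A" using hA[OF P(1)] unfolding P'_def Ps by (cases P1) auto
    have sP': "set P' \<subseteq> set P" by (auto simp: P'_def Ps)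
    have "set P1 \<inter> B = {}"
    proof -
      have "last P \<notin> set P1" using pP(2) P2 lP Ps by auto
      moreover have "set P1 \<subseteq> set P" by (auto simp: Ps)
      ultimately show ?thesis using linkageD(7)[OF L P(1)] by blast
    qed
    moreover have "set P1 \<inter> set R2 = {}" using R2Ps[OF P(1)] Ps by auto
    moreover have "set P1 \<inter> insert v (set P2) = {}" using pP(2) Ps by auto
    ultimately have hitP': "set P' \<inter> B' = {last P'}" unfolding P'_def B'_def by auto
    have hit: "set p \<inter> B' = {last p}" if "p \<in> Ps" "p \<noteq> P" for p
    proof -
      have "set p \<inter> set P = {}" using dis that P by blast
      then have "set p \<inter> ({v} \<union> set P2) = {}" unfolding Ps by auto
      then have "set p \<inter> B' = set p \<inter> B" using R2Ps[OF that(1)] unfolding B'_def by blast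
      then show ?thesis using sb[OF that(1)] by simp
    qed
    have L': "linkage E W A B' Ps'"
      unfolding linkage_def
    proof (intro conjI ballI impI)
      show "finite Ps'" using linkageD(1)[OF L] by (simp add: Ps'_def)
    next
      fix p assume "p \<in> Ps'"
      then consider "p = P'" | "p \<in> Ps" "p \<noteq> P" by (auto simp: Ps'_def)
      note cs = this
      show "path_in E W p" "hd p \<in> A" "set p \<inter> B' = {last p}"
        using cs pP' pq hP' hA hitP' hit by metis+
    next
      fix p q assume "p \<in> Ps'" "q \<in> Ps'" "p \<noteq> q"
      then show "set p \<inter> set q = {}"
        using dis sP' P(1) unfolding Ps'_def by blast
    qed
    have P'n: "P' \<notin> Ps - {P}"
      using dis[of P P'] P(1) sP' by (auto simp: P'_def)
    then have card': "card Ps' = card Ps"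
      using linkageD(1)[OF L] P(1) unfolding Ps'_def
      by (metis card.remove card_insert_disjoint finite_Diff)
    have "v \<in> W - B" using vnB P pP by (auto simp: path_in_def)
    then have "W - B' \<subset> W - B" unfolding B'_def by blast
    then have less': "card (W - B') < card (W - B)"
      using less.prems(2) by (simp add: psubset_card_mono)
    obtain Qs where Qs: "linkage E W A B' Qs" "card Qs = Suc (card Ps')" "last ` Ps' \<subseteq> last ` Qs"
    proof -
      have "\<exists>p. path_in E (W - X) p \<and> hd p \<in> A \<and> last p \<in> B'" if "X \<subseteq> W" "card X < k" for X
        using nosep[OF that] unfolding B'_def by blast
      then show thesis
        using less.hyps[OF less' L' less.prems(2)] card' less.prems(3) that by auto
    qed
    have X': "last ` Ps' = insert v (?X - {last P})"
    proof -
      have "last ` (Ps - {P}) = ?X - {last P}"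
        using linkage_inj_last[OF L] P(1) by (auto simp: inj_on_def)
      then show ?thesis by (simp add: Ps'_def P'_def)
    qed
    have "card (last ` Qs) = Suc (card (last ` Ps'))"
      using card_image[OF linkage_inj_last[OF Qs(1)]] card_image[OF linkage_inj_last[OF L']] Qs(2)
      by simp
    then have "card (last ` Qs - last ` Ps') = 1"
      using Qs(3) linkageD(1)[OF L'] by (simp add: card_Diff_subset)
    then obtain y where y: "last ` Qs - last ` Ps' = {y}" by (meson card_1_singletonE)
    then have lastQs: "last ` Qs = insert y (insert v (?X - {last P}))"
      using Qs(3) X' by auto
    have yn: "y \<noteq> v" "y \<notin> ?X - {last P}" using y X' by auto
    obtain Q where Q: "Q \<in> Qs" "last Q = v" using lastQs by (metis imageE insertI1 insertI2)
    obtain Q' where Q': "Q' \<in> Qs" "last Q' = y" using lastQs by (metis imageE insertI1)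
    have QQ: "Q \<noteq> Q'" using Q Q' yn by auto
    note pQs = linkageD(2)[OF Qs(1)] and bQs = linkageD(4)[OF Qs(1)]
    have yW: "y \<in> W" using pQs[OF Q'(1)] linkageD(6)[OF Qs(1) Q'(1)] Q'(2) by (auto simp: path_in_def)
    have yB': "y \<in> B'" using bQs[OF Q'(1)] Q'(2) by auto
    have rest: "last ` (Qs - {Q, Q'}) = ?X - {last P}"
    proof -
      have "last ` (Qs - {Q, Q'}) = last ` Qs - {v, y}"
        using linkage_inj_last[OF Qs(1)] Q Q' by (auto simp: inj_on_def)
      moreover have "v \<notin> ?X" using XB vnB by auto
      ultimately show ?thesis using lastQs yn by auto
    qed
    have others: "last q \<in> B" if "q \<in> Qs" "q \<noteq> Q" "q \<noteq> Q'" for q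
      using rest XB that by blast
    have P2P: "set P2 \<subseteq> set P" "last P \<in> set P2" using lP P2 by (auto simp: Ps)
    have P2B: "set P2 \<inter> B = {last P}"
      using linkageD(7)[OF L P(1)] linkageD(8)[OF L P(1)] P2P by blast
    have P2X: "set P2 \<inter> ?X = {last P}"
      using linkageD(7)[OF L P(1)] XB P(1) P2P by blast
    have R2X: "set R2 \<inter> ?X = {}" using RX Rs by auto
    have vP2: "v \<notin> set P2" "v \<notin> set R2" using pP(2) dR Ps Rs by auto
    have P2R2: "set P2 \<inter> set R2 = {}" using R2Ps[OF P(1)] Ps by auto
    have R2R: "set R2 \<subseteq> set R" "last R \<in> set R2" using lR R2 by (auto simp: Rs)
    have R2B: "set R2 \<inter> B = {last R}" using R(3) R2R by blast
    have pP2: "path_in E W P2" "(v, hd P2) \<in> E" and pR2: "path_in E W R2" "(v, hd R2) \<in> E"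
      using pP(1) RW P2 R2 unfolding Ps Rs by (auto simp: path_in_append path_in_Cons)
    have suffix: "path_in E W (q @ S2)"
      if q: "q \<in> Qs" "last q = u" and S: "path_in E W (S1 @ u # S2)" "set S2 \<inter> last ` Qs = {}"
        "set S2 \<subseteq> B'" for q u S1 S2
    proof (cases "S2 = []")
      case True
      then show ?thesis using pQs q by simp
    next
      case False
      then have "path_in E W S2" "(u, hd S2) \<in> E"
        using S(1) by (auto simp: path_in_append path_in_Cons)
      moreover have "last q \<notin> set S2" using S(2) q(1) by blast
      then have "set q \<inter> set S2 = {}"
        using Int_eq_singleton_imp_disjoint[OF bQs[OF q(1)]] S(3) by blast
      ultimately show ?thesis using q pQs by (simp add: path_in_append)
    qed
    have vR: "path_in E W ([] @ v # R2)" "path_in E W ([] @ v # P2)"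
      using RW pP(1) unfolding Rs Ps by (auto simp: path_in_append)
    have sBP: "set P2 \<subseteq> B'" "set R2 \<subseteq> B'" "B \<subseteq> B'" by (auto simp: B'_def)
    \<comment> \<open>The paths ending in v and y are brought back to B along the two tails out of
      v. If y lies on P2, its path keeps the rest of P2 and the path to v takes R2; otherwise the
      path to v takes P2. Either way the end of P is kept.\<close>
    show ?thesis
    proof (cases "y \<in> set P2")
      case True
      then obtain S1 S2 where S: "P2 = S1 @ y # S2" by (meson split_list)
      have dP2: "distinct P2" using pP(2) Ps by simp
      have lS: "last (y # S2) = last P" using lP S by simp
      have S2e: "set S2 \<inter> last ` Qs = {}"
      proof -
        have "set S2 \<inter> (?X - {last P}) = {}" using P2X S by auto
        moreover have "y \<notin> set S2" "v \<notin> set S2" using dP2 S vP2 by auto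
        ultimately show ?thesis using lastQs by auto
      qed
      have R2e: "set R2 \<inter> last ` Qs = {}"
        using R2X vP2 P2R2 True lastQs by auto
      have "\<exists>Rs. linkage E W A B Rs \<and> card Rs = card Qs \<and>
        last ` Rs = last ` (Qs - {Q, Q'}) \<union> {last (Q @ R2), last (Q' @ S2)}"
      proof (rule linkage_extend_two[OF Qs(1) sBP(3) Q(1) Q'(1) QQ])
        show "path_in E W (Q @ R2)" using suffix[OF Q vR(1) R2e] sBP by simp
        show "path_in E W (Q' @ S2)"
          using suffix[OF Q' _ S2e, of "S1"] pP2 sBP S by auto
        show "set R2 \<subseteq> B'" "set S2 \<subseteq> B'" using sBP S by auto
        show "set R2 \<inter> set S2 = {}" using P2R2 S by auto
        show "insert (last Q) (set R2) \<inter> B = {last (Q @ R2)}"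
          using Q vnB R2B R2 lR by auto
        have "insert y (set S2) \<inter> B \<subseteq> set P2 \<inter> B" using S by auto
        moreover have "last P \<in> insert y (set S2)" using lS by (metis last_in_set list.distinct(1) list.simps(15))
        ultimately have "insert y (set S2) \<inter> B = {last P}" using P2B by auto
        moreover have "last (Q' @ S2) = last P" using lS Q' by (auto simp: last_append split: if_splits)
        ultimately show "insert (last Q') (set S2) \<inter> B = {last (Q' @ S2)}" using Q' by simp
      qed (use R2e S2e others in auto)
      then obtain Ls where Ls: "linkage E W A B Ls" "card Ls = card Qs"
        "last ` Ls = (?X - {last P}) \<union> {last (Q @ R2), last (Q' @ S2)}" unfolding rest by blast
      have "last (Q' @ S2) = last P" using lS Q' by (auto simp: last_append split: if_splits)
      then have "?X \<subseteq> last ` Ls" unfolding Ls(3) by auto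
      then show ?thesis using Ls(1,2) Qs(2) card' by auto
    next
      case False
      have P2e: "set P2 \<inter> last ` Qs = {}"
        using P2X vP2 False lastQs by auto
      \<comment> \<open>S2 is what remains of R2 after y. It is empty if y is already in B, where y
        need not lie on R2 at all.\<close>
      obtain S1 S2 where S: "y \<in> B \<and> S1 = [] \<and> S2 = [] \<or> y \<notin> B \<and> R2 = S1 @ y # S2"
      proof (cases "y \<in> B")
        case True then show thesis using that[of "[]" "[]"] by simp
      next
        case yB: False
        then have "y \<in> set R2" using False yn yB' by (auto simp: B'_def)
        then obtain S1 S2 where "R2 = S1 @ y # S2" by (meson split_list)
        then show thesis using that[of S1 S2] yB by simp
      qed
      have S2R: "set S2 \<subseteq> set R2" using S by auto
      have yS2: "y \<notin> set S2" using S dR unfolding Rs(1) by auto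
      have S2e: "set S2 \<inter> last ` Qs = {}"
        using R2X vP2 S2R yS2 lastQs by auto
      have "insert y (set S2) \<inter> B = {last (Q' @ S2)}"
      proof (cases "y \<in> B")
        case True
        then show ?thesis using S Q' by auto
      next
        case yB: False
        then have R2S: "R2 = S1 @ y # S2" using S by simp
        then have "last R \<in> set S2" using yB R2B lR linkageD(8)[OF L P(1)] \<open>last R \<in> B\<close>
          by (cases "S2 = []") auto
        moreover from this have "last (Q' @ S2) = last R" using R2S lR by (cases "S2 = []") auto
        moreover have "set S2 \<inter> B \<subseteq> set R2 \<inter> B" using R2S by auto
        ultimately show ?thesis using R2B yB \<open>last R \<in> B\<close> by auto
      qed
      note hitS = this
      have "\<exists>Rs. linkage E W A B Rs \<and> card Rs = card Qs \<and>
        last ` Rs = last ` (Qs - {Q, Q'}) \<union> {last (Q @ P2), last (Q' @ S2)}"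
      proof (rule linkage_extend_two[OF Qs(1) sBP(3) Q(1) Q'(1) QQ])
        show "path_in E W (Q @ P2)" using suffix[OF Q vR(2) P2e] sBP by simp
        have "path_in E W (S1 @ y # S2)"
          using S pR2 yW by (auto simp: path_in_Cons)
        then show "path_in E W (Q' @ S2)"
          using suffix[OF Q' _ S2e, of "S1"] sBP S2R by auto
        show "set P2 \<subseteq> B'" "set S2 \<subseteq> B'" using sBP S2R by auto
        show "set P2 \<inter> set S2 = {}" using P2R2 S2R by auto
        show "insert (last Q) (set P2) \<inter> B = {last (Q @ P2)}"
          using Q vnB P2B P2 lP by auto
        show "insert (last Q') (set S2) \<inter> B = {last (Q' @ S2)}" using hitS Q' by simp
      qed (use P2e S2e others in auto)
      then obtain Ls where Ls: "linkage E W A B Ls" "card Ls = card Qs"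
        "last ` Ls = (?X - {last P}) \<union> {last (Q @ P2), last (Q' @ S2)}" unfolding rest by blast
      have "last (Q @ P2) = last P" using lP P2 by simp
      then have "?X \<subseteq> last ` Ls" unfolding Ls(3) by auto
      then show ?thesis using Ls(1,2) Qs(2) card' by auto
    qed
  qed
qed

section \<open>Fans in highly connected graphs\<close>

text \<open>In a complete graph no vertex set separates anything and \<open>conn\<close> holds for
  every k; there \<open>cardV\<close> is the condition that bounds k.\<close>

locale k_connected =
  fixes V :: "'a set" and E :: "'a rel" and k :: nat
  assumes finV: "finite V" and symE: "sym E" and EV: "E \<subseteq> V \<times> V" and noloop: "(v, v) \<notin> E"
    and cardV: "k < card V"
    and conn: "X \<subseteq> V \<Longrightarrow> card X < k \<Longrightarrow> u \<in> V - X \<Longrightarrow> v \<in> V - X \<Longrightarrow>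
      (u, v) \<in> (E \<inter> (V - X) \<times> (V - X))\<^sup>*"
begin

abbreviation nbrs :: "'a \<Rightarrow> 'a set" where "nbrs v \<equiv> {u. (v, u) \<in> E}"

lemma nbrs_sub: "nbrs v \<subseteq> V" and finite_nbrs: "finite (nbrs v)"
proof -
  show "nbrs v \<subseteq> V" using EV by auto
  then show "finite (nbrs v)" using finV by (rule finite_subset)
qed

text \<open>Deleting fewer than k neighbours would isolate y, while \<open>cardV\<close> guarantees
  a vertex that is neither y nor deleted.\<close>

lemma card_nbrs:
  assumes y: "y \<in> V"
  shows "k \<le> card (nbrs y)"
proof (rule ccontr)
  assume "\<not> ?thesis"
  then have lt: "card (nbrs y) < k" by simp
  have "\<not> V \<subseteq> insert y (nbrs y)"
  proof
    assume "V \<subseteq> insert y (nbrs y)"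
    then have "card V \<le> card (insert y (nbrs y))" using finite_nbrs by (intro card_mono) auto
    also have "\<dots> \<le> Suc (card (nbrs y))" by (rule card_insert_le_m1) auto
    finally show False using lt cardV by simp
  qed
  then obtain v where v: "v \<in> V" "v \<noteq> y" "v \<notin> nbrs y" by auto
  have "(y, v) \<in> (E \<inter> (V - nbrs y) \<times> (V - nbrs y))\<^sup>*"
    using conn[OF nbrs_sub lt, of y v] v y noloop by auto
  then show False using v by (cases rule: converse_rtranclE) auto
qed

text \<open>Fewer than k vertices cannot cover B, and z stays connected to any b that they miss. The
  path from z to b, without z, is what \<open>linkage_augment\<close> asks for.\<close>

lemma fan_augment:
  assumes z: "z \<in> V" and B: "B \<subseteq> V - {z}" "k \<le> card B"
    and L: "linkage E (V - {z}) (nbrs z) B Ps" "card Ps < k"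
  shows "\<exists>Qs. linkage E (V - {z}) (nbrs z) B Qs \<and> card Qs = Suc (card Ps) \<and> last ` Ps \<subseteq> last ` Qs"
proof (rule linkage_augment[OF L(1) _ L(2)])
  show "finite (V - {z})" using finV by simp
next
  fix X assume X: "X \<subseteq> V - {z}" "card X < k"
  have "finite B" using B(1) finV by (meson finite_Diff finite_subset)
  have "\<not> B \<subseteq> X"
    using card_mono[of X B] X B finite_subset[OF X(1)] finV by auto
  then obtain b where b: "b \<in> B" "b \<notin> X" by auto
  have "(z, b) \<in> (E \<inter> (V - X) \<times> (V - X))\<^sup>*"
    by (rule conn) (use X b B z in auto)
  then obtain p where p: "path_in E (V - X) p" "hd p = z" "last p = b"
    using rtrancl_imp_path_in[of z b E "V - X"] z X by auto
  then obtain q where q: "p = z # q" by (cases p) (auto simp: path_in_def)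
  have "b \<noteq> z" using b B by auto
  then have "q \<noteq> []" using p q by auto
  with p q have "path_in E (V - X) q" "(z, hd q) \<in> E" "z \<notin> set q" "last q = b"
    by (auto simp: path_in_Cons)
  then show "\<exists>p. path_in E (V - {z} - X) p \<and> hd p \<in> nbrs z \<and> last p \<in> B"
    using b by (intro exI[of _ q]) (auto simp: path_in_def)
qed

lemma fan:
  assumes z: "z \<in> V" and B: "B \<subseteq> V - {z}" "k \<le> card B"
  shows "\<exists>Ps. linkage E (V - {z}) (nbrs z) B Ps \<and> card Ps = k"
proof -
  have "\<exists>Ps. linkage E (V - {z}) (nbrs z) B Ps \<and> card Ps = n" if "n \<le> k" for n
    using that
  proof (induction n)
    case 0
    show ?case by (intro exI[of _ "{}"]) (simp add: linkage_def)
  next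
    case (Suc n)
    then obtain Ps where "linkage E (V - {z}) (nbrs z) B Ps" "card Ps = n" by auto
    with fan_augment[OF z B, of Ps] Suc.prems show ?case by auto
  qed
  then show ?thesis by blast
qed

text \<open>The fan lemma at x, with the closed neighbourhood of y as target. Having y in the target
  makes up for the removal of x when xy is an edge; the fan member \<open>[y]\<close> then stands
  for that edge and becomes the empty interior.\<close>

lemma disjoint_paths:
  assumes xy: "x \<in> V" "y \<in> V" "x \<noteq> y"
  obtains \<P> where "finite \<P>" "card \<P> = k" "\<And>p. p \<in> \<P> \<Longrightarrow> path_in E V (x # p @ [y])"
    "\<And>p q. p \<in> \<P> \<Longrightarrow> q \<in> \<P> \<Longrightarrow> p \<noteq> q \<Longrightarrow> set p \<inter> set q = {}"
proof -
  define B where "B = insert y (nbrs y) - {x}"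
  have "k \<le> card B"
  proof (cases "x \<in> nbrs y")
    case True
    have "card (insert y (nbrs y)) = Suc (card (nbrs y))" using finite_nbrs noloop by simp
    then have "card B = card (nbrs y)" using True finite_nbrs unfolding B_def by simp
    then show ?thesis using card_nbrs[OF xy(2)] by simp
  next
    case False
    then have "nbrs y \<subseteq> B" by (auto simp: B_def)
    then have "card (nbrs y) \<le> card B" using finite_nbrs by (intro card_mono) (auto simp: B_def)
    then show ?thesis using card_nbrs[OF xy(2)] by simp
  qed
  moreover have "B \<subseteq> V - {x}" using nbrs_sub xy by (auto simp: B_def)
  ultimately obtain Ps where L: "linkage E (V - {x}) (nbrs x) B Ps" "card Ps = k"
    using fan[OF xy(1)] by blast
  define f where "f p = (if last p = y then [] else p)" for p :: "'a list"
  \<comment> \<open>A predecessor of y on the path would be a neighbour of y, hence an earlier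
    vertex of the target.\<close>
  have single: "p = [y]" if p: "p \<in> Ps" "y \<in> set p" for p
  proof -
    have pp: "path_in E (V - {x}) p" using linkageD(2)[OF L(1) p(1)] .
    have "y \<in> B" using xy by (simp add: B_def)
    then have ly: "last p = y" using linkageD(7)[OF L(1) p] by simp
    have "p \<noteq> []" using linkageD(6)[OF L(1) p(1)] .
    then obtain q where q: "p = q @ [y]" using ly by (metis append_butlast_last_id)
    have "q = []"
    proof (rule ccontr)
      assume "q \<noteq> []"
      then have lq: "last q \<in> set q" by simp
      have "(last q, y) \<in> E" using pp q \<open>q \<noteq> []\<close> by (simp add: path_in_append)
      moreover have "last q \<in> set p" "last q \<noteq> y" "last q \<noteq> x"
        using pp q lq by (auto simp: path_in_def)
      ultimately have "last q \<in> B" using symE by (auto simp: B_def dest: symD)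
      then show False using linkageD(7)[OF L(1) p(1)] \<open>last q \<in> set p\<close> \<open>last q \<noteq> y\<close> ly by auto
    qed
    then show ?thesis using q by simp
  qed
  have fne: "f p = p \<and> y \<notin> set p \<or> f p = [] \<and> p = [y]" if "p \<in> Ps" for p
    using single[OF that] linkageD(6)[OF L(1) that] by (auto simp: f_def)
  have "inj_on f Ps"
    by (intro inj_onI) (metis fne linkageD(6)[OF L(1)])
  then have "card (f ` Ps) = k" using L(2) card_image by blast
  with linkageD(1)[OF L(1)] have "finite (f ` Ps)" "card (f ` Ps) = k" by simp_all
  moreover have "path_in E V (x # q @ [y])" if qf: "q \<in> f ` Ps" for q
  proof -
    obtain p where p: "p \<in> Ps" "q = f p" using qf by auto
    have pp: "path_in E (V - {x}) p" "(x, hd p) \<in> E"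
      using linkageD(2,3)[OF L(1) p(1)] by auto
    show ?thesis
    proof (cases "p = [y]")
      case True
      then show ?thesis using p xy pp by (auto simp: f_def path_in_Cons)
    next
      case False
      then have q: "q = p" "y \<notin> set p" using fne[OF p(1)] p(2) by auto
      have "last p \<in> B" "last p \<noteq> y"
        using linkageD(8)[OF L(1) p(1)] q linkageD(6)[OF L(1) p(1)] by auto
      then have "(last p, y) \<in> E" using symE by (auto simp: B_def dest: symD)
      moreover have "path_in E V p" "x \<notin> set p" "p \<noteq> []" using pp by (auto simp: path_in_def)
      ultimately show ?thesis using pp q xy by (auto simp: path_in_Cons path_in_append)
    qed
  qed
  moreover have "set q \<inter> set q' = {}" if qq: "q \<in> f ` Ps" "q' \<in> f ` Ps" "q \<noteq> q'" for q q'
  proof -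
    obtain p p' where "p \<in> Ps" "p' \<in> Ps" "q = f p" "q' = f p'" using qq(1,2) by auto
    then show ?thesis using qq(3) linkageD(5)[OF L(1), of p p'] by (auto simp: f_def)
  qed
  ultimately show thesis by (rule that)
qed

end

text \<open>
  Vertices of \<open>U\<close> lie on lines: \<open>it v\<close> is the line of \<open>v\<close> and \<open>pos v\<close> its position on it.
\<close>

locale lines =
  fixes U :: "'a set" and it :: "'a \<Rightarrow> 'b" and pos :: "'a \<Rightarrow> nat"
  assumes finU: "finite U"
    and inj: "u \<in> U \<Longrightarrow> v \<in> U \<Longrightarrow> it u = it v \<Longrightarrow> pos u = pos v \<Longrightarrow> u = v"
begin

definition between :: "'a \<Rightarrow> 'a \<Rightarrow> 'a \<Rightarrow> bool" where
  "between a q c \<longleftrightarrow> it a = it q \<and> it q = it c \<and> pos a < pos q \<and> pos q < pos c"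

text \<open>The target of the fan depends on its own ends K: a vertex hidden between two hits is no
  longer a target, so later fan paths may run through it.\<close>

definition exposed :: "'a set \<Rightarrow> 'a set" where
  "exposed K = {q \<in> U. \<not> (\<exists>a\<in>K. \<exists>c\<in>K. between a q c)}"

lemma exposed_sub: "exposed K \<subseteq> U" and finite_exposed: "finite (exposed K)"
proof -
  show "exposed K \<subseteq> U" by (auto simp: exposed_def)
  then show "finite (exposed K)" using finU by (rule finite_subset)
qed

lemma exposed_anti: "K \<subseteq> K' \<Longrightarrow> exposed K' \<subseteq> exposed K"
  unfolding exposed_def by blast

text \<open>Of three hits on a line the middle one would be hidden. The invariant
  \<open>K \<subseteq> exposed K\<close> is thus the way to say that each line is hit at most
  twice.\<close>

lemma no_three:
  assumes "K \<subseteq> exposed K" "a \<in> K" "b \<in> K" "c \<in> K" "it a = it b" "it b = it c"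
  shows "a = b \<or> b = c \<or> a = c"
proof (rule ccontr)
  assume neq: "\<not> ?thesis"
  have "a \<in> U" "b \<in> U" "c \<in> U" using assms exposed_sub by auto
  then have "pos a \<noteq> pos b" "pos b \<noteq> pos c" "pos a \<noteq> pos c"
    using neq inj[of a b] inj[of b c] inj[of a c] assms(5,6) by auto
  then consider "between a b c \<or> between c b a" | "between b a c \<or> between c a b"
    | "between a c b \<or> between b c a"
    using assms(5,6) unfolding between_def by (metis linorder_neqE_nat)
  then show False
    using assms(1-4) unfolding exposed_def by cases blast+
qed

text \<open>A hit that makes an older hit \<open>a\<close> lie between two others replaces \<open>a\<close>.\<close>

lemma exposed_replace:
  assumes K: "K \<subseteq> exposed K" and b: "b \<in> exposed K" "b \<notin> K" and bad: "\<not> insert b K \<subseteq> exposed (insert b K)"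
  obtains a where "a \<in> K" "insert b (K - {a}) \<subseteq> exposed (insert b (K - {a}))"
    "exposed (insert b (K - {a})) \<subset> exposed K"
proof -
  have KU: "K \<subseteq> U" "b \<in> U" using K b exposed_sub by auto
  have nb: "\<not> between u b v" if "u \<in> K" "v \<in> K" for u v
    using b(1) that unfolding exposed_def by blast
  have nK: "\<not> between u w v" if "u \<in> K" "v \<in> K" "w \<in> K" for u v w
    using K that unfolding exposed_def by blast
  obtain a u v where auv: "a \<in> insert b K" "u \<in> insert b K" "v \<in> insert b K" "between u a v"
    using bad KU unfolding exposed_def by blast
  have "a \<noteq> b" using auv nb by (auto simp: between_def)
  then have a: "a \<in> K" using auv by auto
  have uvb: "u = b \<and> v \<in> K \<or> u \<in> K \<and> v = b"
    using auv nK[of u v a] a by (auto simp: between_def)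
  then obtain w where w: "w \<in> K" "between b a w \<or> between w a b"
    using auv by blast
  have itb: "it b = it a" "it w = it a" "w \<noteq> a" using w by (auto simp: between_def)
  let ?K = "insert b (K - {a})"
  \<comment> \<open>By \<open>no_three\<close>, a and w are all the old hits on this line; after the
    exchange it carries just b and w.\<close>
  have only: "t = w" if "t \<in> K" "it t = it a" "t \<noteq> a" for t
    using no_three[OF K that(1) a w(1) that(2) itb(2)[symmetric]] that(3) itb(3) by blast
  have ok: "?K \<subseteq> exposed ?K"
  proof (rule ccontr)
    assume "\<not> ?thesis"
    then obtain s u v where s: "s \<in> ?K" "u \<in> ?K" "v \<in> ?K" "between u s v"
      using KU unfolding exposed_def by blast
    have its: "it u = it s" "it v = it s" "s \<noteq> u" "s \<noteq> v" "u \<noteq> v" using s(4) by (auto simp: between_def)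
    have "s \<noteq> b" using s nb[of u v] its by auto
    then have sK: "s \<in> K" "s \<noteq> a" using s by auto
    have "u = b \<or> v = b" using nK[of u v s] s sK by auto
    then have "it s = it a" using its itb by auto
    then have "s = w" using only sK by auto
    moreover have "u \<in> {b, w}" "v \<in> {b, w}"
      using s its only \<open>it s = it a\<close> by auto
    ultimately show False using its by auto
  qed
  \<comment> \<open>The gap between b and w contains the gap between a and w, so nothing that was
    hidden reappears; in addition a itself becomes hidden.\<close>
  have sub: "exposed ?K \<subseteq> exposed K"
  proof
    fix q assume q: "q \<in> exposed ?K"
    show "q \<in> exposed K"
    proof (rule ccontr)
      assume "q \<notin> exposed K"
      then obtain u v where uv: "u \<in> K" "v \<in> K" "between u q v"
        using q unfolding exposed_def by blast
      have nq: "\<not> between u q v" if "u \<in> ?K" "v \<in> ?K" for u v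
        using q that unfolding exposed_def by blast
      have "u = a \<or> v = a" using nq[of u v] uv by auto
      moreover have "it u = it q" "it v = it q" "u \<noteq> v" using uv(3) by (auto simp: between_def)
      ultimately have "{u, v} = {a, w}" using only[of u] only[of v] uv by auto
      moreover have "\<not> between b q w" "\<not> between w q b" using nq[of b w] nq[of w b] w itb by auto
      ultimately show False using uv(3) w(2) unfolding between_def by (auto simp: doubleton_eq_iff)
    qed
  qed
  have "a \<notin> exposed ?K" using w itb unfolding exposed_def by auto
  moreover have "a \<in> exposed K" using a K by auto
  ultimately have "exposed ?K \<subset> exposed K" using sub by auto
  then show thesis using that[OF a ok] by blast
qed

end

text \<open>Each augmentation yields one new end b. Either it joins the hits and the fan is larger,
  or it replaces a hit, the size is unchanged and the exposed set shrinks strictly; hence the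
  lexicographic measure. The exposed set never grows, which keeps z hidden, and \<open>big\<close>
  ensures that it is always large enough to augment towards.\<close>

lemma (in k_connected) saturated_fan:
  assumes lines: "lines U it pos" and z: "z \<in> V" and U: "U \<subseteq> V"
    and big: "\<And>K. K \<subseteq> U \<Longrightarrow> k \<le> card (lines.exposed U it pos K)"
    and init: "linkage E (V - {z}) (nbrs z) (lines.exposed U it pos (last ` Fs)) Fs"
      "z \<notin> lines.exposed U it pos (last ` Fs)" "card Fs \<le> k"
  obtains Gs where "linkage E (V - {z}) (nbrs z) (lines.exposed U it pos (last ` Gs)) Gs"
      "z \<notin> lines.exposed U it pos (last ` Gs)" "card Gs = k"
proof -
  interpret lines U it pos by fact
  have "\<exists>Gs. linkage E (V - {z}) (nbrs z) (exposed (last ` Gs)) Gs \<and>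
    z \<notin> exposed (last ` Gs) \<and> card Gs = k"
    using init
  proof (induction "(k - card Fs, card (exposed (last ` Fs)))" arbitrary: Fs
      rule: wf_induct_rule[OF wf_lex_prod[OF wf_less_than wf_less_than]])
    case (1 Fs)
    note L = 1(2)
    let ?K = "last ` Fs"
    have cK: "card ?K = card Fs" using linkage_inj_last[OF L] by (rule card_image)
    have K: "?K \<subseteq> exposed ?K" using linkageD(8)[OF L] by blast
    show ?case
    proof (cases "card Fs = k")
      case False
      then have lt: "card Fs < k" using 1(4) by simp
      have "exposed ?K \<subseteq> V - {z}" using exposed_sub U 1(3) by blast
      from fan_augment[OF z this big[OF subset_trans[OF K exposed_sub]] L lt] obtain Qs where
        Qs: "linkage E (V - {z}) (nbrs z) (exposed ?K) Qs" "card Qs = Suc (card Fs)"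
          "?K \<subseteq> last ` Qs" by blast
      have finQ: "finite Qs" using linkageD(1)[OF Qs(1)] .
      have "card (last ` Qs) = Suc (card ?K)"
        using card_image[OF linkage_inj_last[OF Qs(1)]] Qs(2) cK by simp
      then have "card (last ` Qs - ?K) = 1"
        using Qs(3) linkageD(1)[OF L] by (simp add: card_Diff_subset)
      then obtain b where "last ` Qs - ?K = {b}" by (meson card_1_singletonE)
      then have lQ: "last ` Qs = insert b ?K" and bK: "b \<notin> ?K" using Qs(3) by auto
      have "b \<in> last ` Qs" using lQ by simp
      then obtain q where "q \<in> Qs" "b = last q" by (rule imageE)
      then have b: "b \<in> exposed ?K" using linkageD(8)[OF Qs(1)] by simp
      show ?thesis
      proof (cases "insert b ?K \<subseteq> exposed (insert b ?K)")
        case True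
        have sub: "exposed (last ` Qs) \<subseteq> exposed ?K" unfolding lQ by (rule exposed_anti) auto
        have "linkage E (V - {z}) (nbrs z) (exposed (last ` Qs)) Qs"
          using linkage_mono[OF Qs(1) sub] True lQ by simp
        moreover have "z \<notin> exposed (last ` Qs)" using sub 1(3) by blast
        moreover have "((k - card Qs, card (exposed (last ` Qs))), (k - card Fs, card (exposed ?K)))
            \<in> less_than <*lex*> less_than" using lt Qs(2) by auto
        ultimately show ?thesis using 1(1)[of Qs] Qs(2) lt by auto
      next
        case False
        obtain a where a: "a \<in> ?K" "insert b (?K - {a}) \<subseteq> exposed (insert b (?K - {a}))"
          "exposed (insert b (?K - {a})) \<subset> exposed ?K"
          using exposed_replace[OF K b bK False] by blast
        \<comment> \<open>The path to the newly hidden hit a is dropped; the path to b takes its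
          place, so the size is again that of Fs.\<close>
        define Rs where "Rs = {q \<in> Qs. last q \<noteq> a}"
        have lR: "last ` Rs = insert b (?K - {a})"
        proof -
          have "last ` Rs = last ` Qs - {a}" by (auto simp: Rs_def)
          then show ?thesis using lQ bK a(1) by auto
        qed
        have LR: "linkage E (V - {z}) (nbrs z) (exposed (last ` Rs)) Rs"
        proof (rule linkage_mono)
          show "linkage E (V - {z}) (nbrs z) (exposed ?K) Rs"
            using Qs(1) by (rule linkage_subset) (auto simp: Rs_def)
        qed (use a lR in auto)
        have "card Rs = card (last ` Rs)" using card_image[OF linkage_inj_last[OF LR]] by simp
        also have "\<dots> = card Fs"
          unfolding lR using bK card.remove[OF _ a(1)] cK linkageD(1)[OF L] by simp
        finally have cR: "card Rs = card Fs" .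
        have "card (exposed (last ` Rs)) < card (exposed ?K)"
          using a(3) lR finite_exposed by (simp add: psubset_card_mono)
        then have "((k - card Rs, card (exposed (last ` Rs))), (k - card Fs, card (exposed ?K)))
            \<in> less_than <*lex*> less_than" using cR by simp
        moreover have "z \<notin> exposed (last ` Rs)" using a(3) lR 1(3) by auto
        ultimately show ?thesis using 1(1)[of Rs] LR cR lt by auto
      qed
    qed (use 1 in blast)
  qed
  then show thesis using that by blast
qed

section \<open>Packing connected subgraphs\<close>

lemma pairs_between:
  assumes "finite A" "finite B" "A \<inter> B = {}" "card A = n" "card B = n"
  shows "\<exists>\<T>. finite \<T> \<and> card \<T> = n \<and> disjoint \<T> \<and> \<Union> \<T> \<subseteq> A \<union> B \<and>
    (\<forall>\<tau>\<in>\<T>. \<exists>a\<in>A. \<exists>b\<in>B. \<tau> = {a, b})"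
proof -
  obtain f where f: "bij_betw f A B" using finite_same_card_bij[OF assms(1,2)] assms(4,5) by auto
  have fB: "f a \<in> B" if "a \<in> A" for a using f that by (auto simp: bij_betw_def)
  have AB: "a \<noteq> f a'" if "a \<in> A" "a' \<in> A" for a a' using fB[OF that(2)] that(1) assms(3) by auto
  have finj: "f a = f a' \<Longrightarrow> a = a'" if "a \<in> A" "a' \<in> A" for a a'
    using f that by (auto simp: bij_betw_def inj_on_def)
  let ?T = "(\<lambda>a. {a, f a}) ` A"
  have "inj_on (\<lambda>a. {a, f a}) A" using AB by (auto simp: inj_on_def doubleton_eq_iff)
  then have "card ?T = n" using card_image assms(4) by blast
  moreover have "disjoint ?T"
    unfolding disjoint_def
  proof (intro ballI impI)
    fix s t assume "s \<in> ?T" "t \<in> ?T" "s \<noteq> t"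
    then obtain a a' where "a \<in> A" "a' \<in> A" "s = {a, f a}" "t = {a', f a'}" "a \<noteq> a'" by auto
    then show "s \<inter> t = {}" using AB[of a a'] AB[of a' a] finj[of a a'] by auto
  qed
  ultimately show ?thesis using fB assms(1) by (intro exI[of _ ?T]) auto
qed

lemma disjoint_family_union:
  assumes "disjoint \<A>" "disjoint \<B>" "\<Union> \<A> \<inter> \<Union> \<B> = {}"
  shows "disjoint (\<A> \<union> \<B>)"
  using assms unfolding disjoint_def by blast

text \<open>A, B and C will be the links of the three pairs of terminals: two links of different
  kinds connect all three terminals, while an element of D does so alone. Each of A, B, C is cut
  into two parts, one for each kind of partner.\<close>

lemma cross_pairs:
  fixes A B C D :: "'i set"
  assumes fin: "finite A" "finite B" "finite C" "finite D"
    and dis: "A \<inter> B = {}" "A \<inter> C = {}" "B \<inter> C = {}" "D \<inter> (A \<union> B \<union> C) = {}"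
    and card: "i + k \<le> card A" "i + j \<le> card B" "j + k \<le> card C"
  obtains \<T> where "finite \<T>" "card \<T> = card D + i + j + k" "disjoint \<T>"
    "\<Union> \<T> \<subseteq> A \<union> B \<union> C \<union> D"
    "\<And>\<tau>. \<tau> \<in> \<T> \<Longrightarrow> (\<exists>d\<in>D. \<tau> = {d}) \<or> (\<exists>a\<in>A. \<exists>b\<in>B. \<tau> = {a, b}) \<or>
      (\<exists>b\<in>B. \<exists>c\<in>C. \<tau> = {b, c}) \<or> (\<exists>a\<in>A. \<exists>c\<in>C. \<tau> = {a, c})"
proof -
  have two: "\<exists>X1 X2. X1 \<subseteq> X \<and> X2 \<subseteq> X \<and> X1 \<inter> X2 = {} \<and> card X1 = m \<and> card X2 = n"
    if fX: "finite X" "m + n \<le> card X" for X :: "'i set" and m n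
  proof -
    obtain X1 where X1: "X1 \<subseteq> X" "card X1 = m"
      using obtain_subset_with_card_n[of m X] fX by auto
    have "n \<le> card (X - X1)" using fX X1 by (simp add: card_Diff_subset finite_subset)
    then obtain X2 where "X2 \<subseteq> X - X1" "card X2 = n"
      using obtain_subset_with_card_n[of n "X - X1"] by auto
    then show ?thesis using X1 by blast
  qed
  obtain A1 A2 where A: "A1 \<subseteq> A" "A2 \<subseteq> A" "A1 \<inter> A2 = {}" "card A1 = i" "card A2 = k"
    using two[OF fin(1) card(1)] by blast
  obtain B1 B2 where B: "B1 \<subseteq> B" "B2 \<subseteq> B" "B1 \<inter> B2 = {}" "card B1 = i" "card B2 = j"
    using two[OF fin(2) card(2)] by blast
  obtain C1 C2 where C: "C1 \<subseteq> C" "C2 \<subseteq> C" "C1 \<inter> C2 = {}" "card C1 = j" "card C2 = k"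
    using two[OF fin(3) card(3)] by blast
  have fins: "finite A1" "finite A2" "finite B1" "finite B2" "finite C1" "finite C2"
    using A B C fin finite_subset by metis+
  obtain T1 where T1: "finite T1" "card T1 = i" "disjoint T1" "\<Union> T1 \<subseteq> A1 \<union> B1"
    "\<forall>\<tau>\<in>T1. \<exists>a\<in>A1. \<exists>b\<in>B1. \<tau> = {a, b}"
    using pairs_between[OF fins(1,3) _ A(4) B(4)] A B dis by (metis (no_types, opaque_lifting) inf_mono subset_empty)
  obtain T2 where T2: "finite T2" "card T2 = j" "disjoint T2" "\<Union> T2 \<subseteq> B2 \<union> C1"
    "\<forall>\<tau>\<in>T2. \<exists>a\<in>B2. \<exists>b\<in>C1. \<tau> = {a, b}"
    using pairs_between[OF fins(4,5) _ B(5) C(4)] B C dis by (metis (no_types, opaque_lifting) inf_mono subset_empty)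
  obtain T3 where T3: "finite T3" "card T3 = k" "disjoint T3" "\<Union> T3 \<subseteq> A2 \<union> C2"
    "\<forall>\<tau>\<in>T3. \<exists>a\<in>A2. \<exists>b\<in>C2. \<tau> = {a, b}"
    using pairs_between[OF fins(2,6) _ A(5) C(5)] A C dis by (metis (no_types, opaque_lifting) inf_mono subset_empty)
  let ?Ds = "(\<lambda>d. {d}) ` D"
  have T0: "finite ?Ds" "card ?Ds = card D" "disjoint ?Ds" "\<Union> ?Ds \<subseteq> D"
    using fin by (auto simp: card_image disjoint_def)
  have sep: "X \<inter> Y = {}" if XY: "\<Union> X \<inter> \<Union> Y = {}" "{} \<notin> X" for X Y :: "'i set set"
  proof (rule ccontr)
    assume "X \<inter> Y \<noteq> {}"
    then obtain s where s: "s \<in> X" "s \<in> Y" by auto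
    moreover from s XY(2) obtain e where "e \<in> s" by (metis ex_in_conv)
    ultimately show False using XY(1) by auto
  qed
  have ne: "{} \<notin> T1" "{} \<notin> T2" "{} \<notin> T3" using T1(5) T2(5) T3(5) by blast+
  have d1: "\<Union> T1 \<inter> \<Union> T2 = {}"
    using T1(4) T2(4) A B C dis by blast
  have d2: "\<Union> (T1 \<union> T2) \<inter> \<Union> T3 = {}"
    using T1(4) T2(4) T3(4) A B C dis by blast
  have sub: "\<Union> (T1 \<union> T2 \<union> T3) \<subseteq> A \<union> B \<union> C"
    using T1(4) T2(4) T3(4) A B C by blast
  have d3: "\<Union> (T1 \<union> T2 \<union> T3) \<inter> \<Union> ?Ds = {}"
    using sub T0(4) dis by blast
  show thesis
  proof (rule that)
    let ?T = "T1 \<union> T2 \<union> T3 \<union> ?Ds"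
    show "finite ?T" using T1 T2 T3 T0 by simp
    have "card (T1 \<union> T2) = i + j" using card_Un_disjoint[OF T1(1) T2(1) sep[OF d1]] ne T1 T2 by simp
    moreover have "card (T1 \<union> T2 \<union> T3) = card (T1 \<union> T2) + card T3"
      using card_Un_disjoint[OF _ T3(1) sep[OF d2]] ne T1 T2 by simp
    moreover have "card ?T = card (T1 \<union> T2 \<union> T3) + card ?Ds"
      by (rule card_Un_disjoint[OF _ T0(1) sep[OF d3]]) (use ne T1(1) T2(1) T3(1) in auto)
    ultimately show "card ?T = card D + i + j + k" using T3(2) T0(2) by linarith
    show "disjoint ?T"
      by (intro disjoint_family_union T1 T2 T3 T0 d1 d2 d3)
    show "\<Union> ?T \<subseteq> A \<union> B \<union> C \<union> D" using sub T0(4) by auto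
    fix \<tau> assume "\<tau> \<in> ?T"
    then show "(\<exists>d\<in>D. \<tau> = {d}) \<or> (\<exists>a\<in>A. \<exists>b\<in>B. \<tau> = {a, b}) \<or>
      (\<exists>b\<in>B. \<exists>c\<in>C. \<tau> = {b, c}) \<or> (\<exists>a\<in>A. \<exists>c\<in>C. \<tau> = {a, c})"
    proof (elim UnE, goal_cases)
      case 1
      then obtain a b where "a \<in> A1" "b \<in> B1" "\<tau> = {a, b}" using T1(5) by blast
      moreover from this have "a \<in> A" "b \<in> B" using A(1,2) B(1,2) C(1,2) by auto
      ultimately show ?thesis by blast
    next
      case 2
      then obtain a b where "a \<in> B2" "b \<in> C1" "\<tau> = {a, b}" using T2(5) by blast
      moreover from this have "a \<in> B" "b \<in> C" using A(1,2) B(1,2) C(1,2) by auto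
      ultimately show ?thesis by blast
    next
      case 3
      then obtain a b where "a \<in> A2" "b \<in> C2" "\<tau> = {a, b}" using T3(5) by blast
      moreover from this have "a \<in> A" "b \<in> C" using A(1,2) B(1,2) C(1,2) by auto
      ultimately show ?thesis by blast
    next
      case 4
      then show ?thesis by blast
    qed
  qed
qed

section \<open>Arc sets linking the terminals\<close>

context k_connected
begin

text \<open>With \<open>D = {}\<close> the link is the edge joining the two terminals.\<close>

definition link_arcs :: "'a set \<Rightarrow> 'a set \<Rightarrow> 'a rel" where
  "link_arcs D T = {(u, v) \<in> E. u \<in> D \<union> T \<and> v \<in> D \<union> T \<and> (u \<in> D \<or> v \<in> D \<or> D = {})}"

lemma sym_link_arcs: "sym (link_arcs D T)"
  using symE unfolding link_arcs_def sym_def by blast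

lemma link_arcs_sub: "link_arcs D T \<subseteq> E" "link_arcs D T \<subseteq> (D \<union> T) \<times> (D \<union> T)"
  by (auto simp: link_arcs_def)

text \<open>A common arc would join two terminals. A link contains such an arc only if it has no
  inner vertex, and two links of that kind share at most one terminal.\<close>

lemma link_arcs_disjoint:
  assumes "D \<inter> D' = {}" "D \<inter> T' = {}" "D' \<inter> T = {}"
    and "\<And>u v. D = {} \<Longrightarrow> D' = {} \<Longrightarrow> u \<in> T \<inter> T' \<Longrightarrow> v \<in> T \<inter> T' \<Longrightarrow> u = v"
  shows "link_arcs D T \<inter> link_arcs D' T' = {}"
proof (rule ccontr)
  assume "\<not> ?thesis"
  then obtain u v where uv: "(u, v) \<in> link_arcs D T" "(u, v) \<in> link_arcs D' T'" by auto
  then have in1: "u \<in> D \<union> T" "v \<in> D \<union> T" "u \<in> D' \<union> T'" "v \<in> D' \<union> T'" and e: "(u, v) \<in> E"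
    by (auto simp: link_arcs_def)
  then have "u \<notin> D" "v \<notin> D" "u \<notin> D'" "v \<notin> D'" using assms(1-3) by blast+
  then have "D = {}" "D' = {}" using uv by (auto simp: link_arcs_def)
  then have "u = v" using assms(4) in1 by auto
  then show False using e noloop by simp
qed

lemma link_arcs_leg:
  assumes "path_in E V (t # w)" "t \<in> T" "set w \<subseteq> D" "w \<noteq> []"
  shows "(t, last w) \<in> (link_arcs D T)\<^sup>*"
  using assms
proof (induction w rule: rev_induct)
  case (snoc v w)
  show ?case
  proof (cases "w = []")
    case True
    with snoc.prems have "(t, v) \<in> link_arcs D T" by (auto simp: link_arcs_def path_in_Cons)
    then show ?thesis by simp
  next
    case False
    with snoc.prems have "path_in E V (t # w)" "(last w, v) \<in> E" "last w \<in> D"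
      by (auto simp: path_in_Cons path_in_append)
    with snoc.IH snoc.prems False have "(t, last w) \<in> (link_arcs D T)\<^sup>*" by simp
    moreover have "(last w, v) \<in> link_arcs D T"
      using \<open>(last w, v) \<in> E\<close> \<open>last w \<in> D\<close> snoc.prems by (auto simp: link_arcs_def)
    ultimately show ?thesis by simp
  qed
qed simp

lemma link_arcs_path:
  assumes "path_in E V (t # w @ [t'])" "t \<in> T" "t' \<in> T"
  shows "(t, t') \<in> (link_arcs (set w) T)\<^sup>*"
proof (cases "w = []")
  case True
  then have "(t, t') \<in> link_arcs (set w) T" using assms by (auto simp: link_arcs_def path_in_Cons)
  then show ?thesis by simp
next
  case False
  with assms have "path_in E V (t # w)" "(last w, t') \<in> E"
    by (auto simp: path_in_Cons path_in_append)
  with link_arcs_leg[of t w T "set w"] assms False have "(t, last w) \<in> (link_arcs (set w) T)\<^sup>*"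
    by simp
  moreover have "(last w, t') \<in> link_arcs (set w) T"
    using \<open>(last w, t') \<in> E\<close> False assms by (auto simp: link_arcs_def)
  ultimately show ?thesis by simp
qed

lemma link_arcs_sym: "(u, v) \<in> (link_arcs D T)\<^sup>* \<Longrightarrow> (v, u) \<in> (link_arcs D T)\<^sup>*"
  using sym_link_arcs sym_rtrancl symD by metis

end

text \<open>
  \<open>P\<close> is the set of interiors of the \<open>x\<close>--\<open>y\<close> paths, with \<open>[]\<close> for the edge \<open>xy\<close>. A path through \<open>z\<close>
  is a line that includes its ends \<open>x\<close> and \<open>y\<close>; if there is none, \<open>x\<close> and \<open>y\<close> are lines of their own.
\<close>

locale hit_config = k_connected V E k + lines U it pos
  for V :: "'a set" and E k U and it :: "'a \<Rightarrow> 'a list" and pos +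
  fixes x y z :: 'a and P :: "'a list set" and Fs :: "'a list set"
  assumes xyz: "x \<in> V" "y \<in> V" "z \<in> V" "x \<noteq> y" "x \<noteq> z" "y \<noteq> z"
    and finP: "finite P" and cardP: "card P = k"
    and Ppath: "p \<in> P \<Longrightarrow> path_in E V (x # p @ [y])"
    and Pdisj: "p \<in> P \<Longrightarrow> q \<in> P \<Longrightarrow> p \<noteq> q \<Longrightarrow> set p \<inter> set q = {}"
    and U_eq: "U = {x, y} \<union> \<Union> (set ` P)"
    and it_P: "p \<in> P \<Longrightarrow> v \<in> set p \<Longrightarrow> it v = p"
    and it_ends: "it x \<in> P \<and> it y = it x \<and> z \<in> set (it x) \<or> it x \<notin> P \<and> it y \<notin> P \<and> it x \<noteq> it y"
    and pos_x: "pos x = 0"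
    and pos_P: "l @ v # r \<in> P \<Longrightarrow> pos v = Suc (length l)"
    and pos_y: "v \<in> U \<Longrightarrow> v \<noteq> y \<Longrightarrow> pos v < pos y"
    and L: "linkage E (V - {z}) (nbrs z) (exposed (last ` Fs)) Fs"
    and z_hidden: "z \<notin> exposed (last ` Fs)"
    and cardFs: "card Fs = k"
begin

text \<open>
  A piece \<open>(Y, T)\<close> consists of a set \<open>Y\<close> of exposed vertices on one line and the terminals \<open>T\<close> that it
  links; \<open>D Y\<close> adds the fan paths that end in \<open>Y\<close> and drops the terminals. \<open>IA\<close>, \<open>IB\<close>, \<open>IC\<close> and \<open>IS\<close>
  are the pieces linking \<open>xy\<close>, \<open>yz\<close>, \<open>xz\<close> and all three terminals.
\<close>

definition K where "K = last ` Fs"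
definition F where "F = inv_into Fs last"
definition S where "S = {x, y, z}"
definition hits where "hits p = {a \<in> K. it a = p}"
definition low where "low a = {v \<in> U. it v = it a \<and> pos v \<le> pos a}"
definition up where "up a = {v \<in> U. it v = it a \<and> pos a \<le> pos v}"
definition D where "D Y = (Y \<union> (\<Union>a\<in>K \<inter> Y. set (F a))) - S"
definition P0 where "P0 = {p \<in> P. hits p = {}}"
definition K1 where "K1 = {a \<in> K. it a \<in> P \<and> hits (it a) = {a}}"
definition Clo where "Clo = {a \<in> K. it a \<in> P \<and> (\<exists>c\<in>K. it c = it a \<and> pos a < pos c)}"
definition Bup where "Bup = {a \<in> K. it a \<in> P \<and> (\<exists>c\<in>K. it c = it a \<and> pos c < pos a)}"
definition Kx where "Kx = {a \<in> K. a = x \<and> it x \<notin> P}"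
definition Ky where "Ky = {a \<in> K. a = y \<and> it y \<notin> P}"

definition IA where "IA = (\<lambda>p. (set p, {x, y})) ` P0"
definition IB where "IB = (\<lambda>a. (up a, {y, z})) ` (Bup \<union> Ky)"
definition IC where "IC = (\<lambda>a. (low a, {x, z})) ` (Clo \<union> Kx)"
definition IS where "IS = (\<lambda>a. (set (it a), S)) ` K1"

lemma finite_Fs: "finite Fs" using linkageD(1)[OF L] .

lemma finite_K: "finite K" using finite_Fs by (simp add: K_def)

lemma card_K: "card K = k"
  using card_image[OF linkage_inj_last[OF L]] cardFs by (simp add: K_def)

lemma K_exposed: "K \<subseteq> exposed K"
  using linkageD(8)[OF L] by (auto simp: K_def)

lemma K_U: "K \<subseteq> U" using K_exposed exposed_sub by blast

lemma zK: "z \<notin> exposed K" using z_hidden by (simp add: K_def)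

lemma F_props:
  assumes "a \<in> K"
  shows "path_in E V (z # F a)" "last (F a) = a" "F a \<noteq> []" "z \<notin> set (F a)"
    "v \<in> set (F a) \<Longrightarrow> v \<in> exposed K \<Longrightarrow> v = a" "a \<in> set (F a)"
proof -
  have a: "F a \<in> Fs" "last (F a) = a"
    using assms unfolding F_def K_def by (auto intro: inv_into_into f_inv_into_f)
  show "last (F a) = a" by fact
  show ne: "F a \<noteq> []" using linkageD(6)[OF L a(1)] .
  have p: "path_in E (V - {z}) (F a)" "hd (F a) \<in> nbrs z" using linkageD(2,3)[OF L a(1)] .
  then show "z \<notin> set (F a)" by (auto simp: path_in_def)
  moreover have "path_in E V (F a)" using p(1) by (rule path_in_mono) auto
  ultimately show "path_in E V (z # F a)" using p(2) xyz by (auto simp: path_in_Cons)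
  show "v \<in> set (F a) \<Longrightarrow> v \<in> exposed K \<Longrightarrow> v = a"
    using linkageD(7)[OF L a(1)] a(2) by (simp add: K_def)
  show "a \<in> set (F a)" using a(2) ne by (metis last_in_set)
qed

lemma F_disjoint: "a \<in> K \<Longrightarrow> b \<in> K \<Longrightarrow> a \<noteq> b \<Longrightarrow> set (F a) \<inter> set (F b) = {}"
proof -
  assume ab: "a \<in> K" "b \<in> K" "a \<noteq> b"
  then have "F a \<noteq> F b" using F_props(2)[of a] F_props(2)[of b] by auto
  moreover have "F a \<in> Fs" "F b \<in> Fs"
    using ab(1,2) unfolding F_def K_def by (auto intro: inv_into_into)
  ultimately show ?thesis using linkageD(5)[OF L] by blast
qed

lemma notbetween: "u \<in> K \<Longrightarrow> w \<in> K \<Longrightarrow> v \<in> K \<Longrightarrow> it u = it w \<Longrightarrow> it w = it v \<Longrightarrow>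
    pos u < pos w \<Longrightarrow> pos w < pos v \<Longrightarrow> False"
  using K_exposed unfolding exposed_def between_def by blast

lemma P_ends: "p \<in> P \<Longrightarrow> x \<notin> set p" "p \<in> P \<Longrightarrow> y \<notin> set p"
  using Ppath by (auto simp: path_in_def)

lemma xU: "x \<in> U" and yU: "y \<in> U" by (simp_all add: U_eq)

lemma set_P_U: "p \<in> P \<Longrightarrow> set p \<subseteq> U" by (auto simp: U_eq)

lemma x_exposed: "x \<in> exposed K" and y_exposed: "y \<in> exposed K"
proof -
  show "x \<in> exposed K" using pos_x xU by (auto simp: exposed_def between_def)
  have "\<not> pos y < pos c" if "c \<in> K" for c using that pos_y[of c] K_U by (cases "c = y") auto
  then show "y \<in> exposed K" using yU by (auto simp: exposed_def between_def)
qed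

lemma exposedI:
  assumes "v \<in> U" "\<And>u w. u \<in> K \<Longrightarrow> w \<in> K \<Longrightarrow> it u = it v \<Longrightarrow> it w = it v \<Longrightarrow> pos u < pos v \<Longrightarrow> pos v < pos w \<Longrightarrow> False"
  shows "v \<in> exposed K"
  using assms unfolding exposed_def between_def by force

lemma set_P_exposed:
  assumes p: "p \<in> P" and h: "hits p \<subseteq> {a}"
  shows "set p \<subseteq> exposed K"
proof
  fix v assume v: "v \<in> set p"
  show "v \<in> exposed K"
  proof (rule exposedI)
    show "v \<in> U" using v set_P_U[OF p] by auto
  next
    fix u w assume uw: "u \<in> K" "w \<in> K" "it u = it v" "it w = it v" "pos u < pos v" "pos v < pos w"
    then have "u \<in> hits p" "w \<in> hits p" using it_P[OF p v] by (auto simp: hits_def)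
    then have "u = w" using h by blast
    then show False using uw by simp
  qed
qed

text \<open>In this case z lies on the line of x and is hidden, so there is a hit on either side of
  it.\<close>

lemma two_hits_if_ends: "it x \<in> P \<Longrightarrow> \<exists>a\<in>K. \<exists>c\<in>K. it a = it x \<and> it c = it x \<and> a \<noteq> c"
proof -
  assume "it x \<in> P"
  then have z: "z \<in> set (it x)" using it_ends by auto
  then have "z \<in> U" "it z = it x" using it_P set_P_U \<open>it x \<in> P\<close> by auto
  then show ?thesis using zK unfolding exposed_def between_def by fastforce
qed

lemma in_P_cases:
  assumes "a \<in> U" "it a \<in> P" "a \<noteq> x" "a \<noteq> y"
  obtains l r where "it a = l @ a # r" "a \<in> set (it a)"
proof -
  obtain p where "p \<in> P" "a \<in> set p" using assms by (auto simp: U_eq)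
  then have "a \<in> set (it a)" using it_P by auto
  then show thesis using that by (meson split_list)
qed

lemma K1_props:
  assumes "a \<in> K1"
  shows "a \<in> K" "it a \<in> P" "hits (it a) = {a}" "a \<noteq> x" "a \<noteq> y" "a \<in> U" "a \<in> set (it a)"
proof -
  show a: "a \<in> K" "it a \<in> P" "hits (it a) = {a}" using assms by (auto simp: K1_def)
  show aU: "a \<in> U" using a K_U by auto
  have "it a \<noteq> it x"
  proof
    assume "it a = it x"
    with two_hits_if_ends a obtain b c where "b \<in> hits (it a)" "c \<in> hits (it a)" "b \<noteq> c"
      by (auto simp: hits_def)
    then show False using a(3) by simp
  qed
  then show ax: "a \<noteq> x" and ay: "a \<noteq> y" using it_ends a(2) by auto
  from in_P_cases[OF aU a(2) ax ay] show "a \<in> set (it a)" .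
qed

lemma Clo_props:
  assumes "a \<in> Clo \<union> Kx"
  shows "a \<in> K" "a \<in> U" "a \<noteq> y" "a \<noteq> x \<Longrightarrow> it a \<in> P"
proof -
  show a: "a \<in> K" using assms by (auto simp: Clo_def Kx_def)
  then show "a \<in> U" using K_U by auto
  show "a \<noteq> y"
  proof
    assume ay: "a = y"
    then have "a \<in> Clo" using assms xyz by (auto simp: Kx_def)
    then obtain c where "c \<in> K" "pos a < pos c" by (auto simp: Clo_def)
    then show False using ay pos_y[of c] K_U by (cases "c = y") auto
  qed
  show "a \<noteq> x \<Longrightarrow> it a \<in> P" using assms by (auto simp: Clo_def Kx_def)
qed

lemma Bup_props:
  assumes "a \<in> Bup \<union> Ky"
  shows "a \<in> K" "a \<in> U" "a \<noteq> x" "a \<noteq> y \<Longrightarrow> it a \<in> P"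
proof -
  show a: "a \<in> K" using assms by (auto simp: Bup_def Ky_def)
  then show "a \<in> U" using K_U by auto
  show "a \<noteq> x" using assms xyz pos_x by (auto simp: Bup_def Ky_def)
  show "a \<noteq> y \<Longrightarrow> it a \<in> P" using assms by (auto simp: Bup_def Ky_def)
qed

lemma low_x: "low x = {x}"
  using inj[of _ x] pos_x xU by (auto simp: low_def)

lemma up_y: "up y = {y}"
proof -
  have "v = y" if "v \<in> U" "pos y \<le> pos v" for v using pos_y[of v] that by fastforce
  then show ?thesis using yU by (auto simp: up_def)
qed

text \<open>A hit below a vertex of \<open>low a\<close> would leave a strictly between that hit and
  the hit above a, although a is exposed.\<close>

lemma low_exposed: "a \<in> Clo \<union> Kx \<Longrightarrow> low a \<subseteq> exposed K"
proof
  fix v assume a: "a \<in> Clo \<union> Kx" and v: "v \<in> low a"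
  show "v \<in> exposed K"
  proof (cases "a \<in> Clo")
    case True
    then obtain c where c: "a \<in> K" "c \<in> K" "it c = it a" "pos a < pos c" by (auto simp: Clo_def)
    show ?thesis
    proof (rule exposedI)
      show "v \<in> U" using v by (simp add: low_def)
    next
      fix u w assume u: "u \<in> K" "it u = it v" "pos u < pos v"
      have v': "it v = it a" "pos v \<le> pos a" using v by (simp_all add: low_def)
      show False
        by (rule notbetween[OF u(1) c(1,2)]) (use u v' c in simp_all)
    qed
  next
    case False
    then show ?thesis using a v low_x x_exposed by (auto simp: Kx_def)
  qed
qed

lemma up_exposed: "a \<in> Bup \<union> Ky \<Longrightarrow> up a \<subseteq> exposed K"
proof
  fix v assume a: "a \<in> Bup \<union> Ky" and v: "v \<in> up a"
  show "v \<in> exposed K"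
  proof (cases "a \<in> Bup")
    case True
    then obtain c where c: "a \<in> K" "c \<in> K" "it c = it a" "pos c < pos a" by (auto simp: Bup_def)
    show ?thesis
    proof (rule exposedI)
      show "v \<in> U" using v by (simp add: up_def)
    next
      fix u w assume w: "w \<in> K" "it w = it v" "pos v < pos w"
      have v': "it v = it a" "pos a \<le> pos v" using v by (simp_all add: up_def)
      show False
        by (rule notbetween[OF c(2,1) w(1)]) (use w v' c in simp_all)
    qed
  next
    case False
    then show ?thesis using a v up_y y_exposed by (auto simp: Ky_def)
  qed
qed

lemma D_S: "D Y \<inter> S = {}" by (auto simp: D_def)

text \<open>A fan path meets the exposed vertices only in its end. Attaching to disjoint exposed
  sets the fan paths that end there therefore creates no intersection.\<close>

lemma D_disjoint:
  assumes "Y \<subseteq> exposed K" "Y' \<subseteq> exposed K" "Y \<inter> Y' = {}"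
  shows "D Y \<inter> D Y' = {}"
proof (rule ccontr)
  assume "\<not> ?thesis"
  then obtain v where v: "v \<in> D Y" "v \<in> D Y'" by auto
  then consider "v \<in> Y" | a where "a \<in> K" "a \<in> Y" "v \<in> set (F a)" by (auto simp: D_def)
  then show False
  proof cases
    case 1
    then have "v \<notin> Y'" using assms(3) by auto
    then obtain a where a: "a \<in> K" "a \<in> Y'" "v \<in> set (F a)" using v(2) by (auto simp: D_def)
    then show False using F_props(5)[of a v] 1 assms by auto
  next
    case 2
    show False
    proof (cases "v \<in> Y'")
      case True
      then show False using F_props(5)[of a v] 2 assms by auto
    next
      case False
      then obtain b where b: "b \<in> K" "b \<in> Y'" "v \<in> set (F b)" using v(2) by (auto simp: D_def)
      then show False using F_disjoint[of a b] 2 assms(3) by auto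
    qed
  qed
qed

lemma S_Int_exposed: "v \<in> S \<Longrightarrow> v \<in> exposed K \<Longrightarrow> v = x \<or> v = y"
  using zK by (auto simp: S_def)

text \<open>Both x and y are exposed and z is removed from the fan, so only the end of a fan path
  can be a terminal.\<close>

lemma F_S: "a \<in> K \<Longrightarrow> v \<in> set (F a) \<Longrightarrow> v \<in> S \<Longrightarrow> v = a"
  using F_props(4,5)[of a] x_exposed y_exposed unfolding S_def by blast

lemma z_leg:
  assumes "a \<in> K" "a \<in> Y" "a \<notin> S" "z \<in> T"
  shows "(z, a) \<in> (link_arcs (D Y) T)\<^sup>*"
proof -
  have "set (F a) \<subseteq> D Y" using assms F_S[of a] by (auto simp: D_def)
  then show ?thesis
    using link_arcs_leg[of z "F a" T "D Y"] F_props[OF assms(1)] assms(4) by simp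
qed

lemma in_D: "v \<in> Y \<Longrightarrow> v \<notin> S \<Longrightarrow> v \<in> D Y"
  by (auto simp: D_def)

lemma x_leg:
  assumes "l @ a # r \<in> P" "set (l @ [a]) \<subseteq> Y" "Y \<subseteq> exposed K" "x \<in> T"
  shows "(x, a) \<in> (link_arcs (D Y) T)\<^sup>*"
proof -
  have "set (l @ [a]) \<subseteq> D Y"
  proof
    fix v assume v: "v \<in> set (l @ [a])"
    have "v \<noteq> x" "v \<noteq> y" using P_ends[OF assms(1)] v by auto
    moreover have "v \<in> exposed K" using v assms by auto
    ultimately show "v \<in> D Y" using v assms(2) S_Int_exposed by (blast intro: in_D)
  qed
  moreover have "path_in E V (x # l @ [a])"
    using path_in_prefix[where p = "x # l @ [a]" and q = "r @ [y]"] Ppath[OF assms(1)] by simp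
  ultimately show ?thesis
    using link_arcs_leg[of x "l @ [a]" T "D Y"] assms(4) by simp
qed

lemma y_leg:
  assumes "l @ a # r \<in> P" "set (a # r) \<subseteq> Y" "Y \<subseteq> exposed K" "y \<in> T"
  shows "(y, a) \<in> (link_arcs (D Y) T)\<^sup>*"
proof -
  have "set (rev r @ [a]) \<subseteq> D Y"
  proof
    fix v assume v: "v \<in> set (rev r @ [a])"
    have "v \<noteq> x" "v \<noteq> y" using P_ends[OF assms(1)] v by auto
    moreover have "v \<in> exposed K" "v \<in> Y" using v assms by auto
    ultimately show "v \<in> D Y" using S_Int_exposed by (blast intro: in_D)
  qed
  moreover have "path_in E V (rev (x # (l @ a # r) @ [y]))"
    by (rule path_in_rev[OF symE Ppath[OF assms(1)]])
  then have "path_in E V (y # rev r @ [a])"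
    using path_in_prefix[where p = "y # rev r @ [a]" and q = "rev l @ [x]"] by simp
  ultimately show ?thesis
    using link_arcs_leg[of y "rev r @ [a]" T "D Y"] assms(4) by simp
qed

section \<open>Each kind of piece connects its terminals\<close>

lemma alpha_conn:
  assumes "p \<in> P0"
  shows "(x, y) \<in> (link_arcs (D (set p)) {x, y})\<^sup>*" "D (set p) = set p" "set p \<subseteq> exposed K"
proof -
  have p: "p \<in> P" "hits p = {}" using assms by (auto simp: P0_def)
  then show ex: "set p \<subseteq> exposed K" using set_P_exposed[of p x] by simp
  have "K \<inter> set p = {}" using p it_P[OF p(1)] by (auto simp: hits_def)
  moreover have "set p \<inter> S = {}" using ex S_Int_exposed P_ends[OF p(1)] by blast
  ultimately show D: "D (set p) = set p" by (auto simp: D_def)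
  show "(x, y) \<in> (link_arcs (D (set p)) {x, y})\<^sup>*"
    unfolding D using link_arcs_path[OF Ppath[OF p(1)], of "{x, y}"] by simp
qed

lemma star_conn:
  assumes "a \<in> K1"
  shows "(x, a) \<in> (link_arcs (D (set (it a))) S)\<^sup>*" "(y, a) \<in> (link_arcs (D (set (it a))) S)\<^sup>*"
    "(z, a) \<in> (link_arcs (D (set (it a))) S)\<^sup>*" "a \<in> D (set (it a))" "set (it a) \<subseteq> exposed K"
proof -
  note a = K1_props[OF assms]
  show ex: "set (it a) \<subseteq> exposed K" using set_P_exposed[of "it a" a] a by simp
  obtain l r where lr: "it a = l @ a # r" using a by (meson split_list)
  have aS: "a \<notin> S" using a ex S_Int_exposed by blast
  then show "a \<in> D (set (it a))" using a by (blast intro: in_D)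
  show "(z, a) \<in> (link_arcs (D (set (it a))) S)\<^sup>*"
    using z_leg[of a "set (it a)" S] a aS by (simp add: S_def)
  show "(x, a) \<in> (link_arcs (D (set (it a))) S)\<^sup>*"
    by (rule x_leg[of l a r]) (use a ex lr in \<open>auto simp: S_def\<close>)
  show "(y, a) \<in> (link_arcs (D (set (it a))) S)\<^sup>*"
    by (rule y_leg[of l a r]) (use a ex lr in \<open>auto simp: S_def\<close>)
qed

lemma gamma_conn:
  assumes a: "a \<in> Clo \<union> Kx"
  shows "(x, z) \<in> (link_arcs (D (low a)) {x, z})\<^sup>*" "a \<noteq> x \<Longrightarrow> a \<in> D (low a)"
proof -
  note ap = Clo_props[OF a] and ex = low_exposed[OF a]
  have al: "a \<in> low a" using ap by (simp add: low_def)
  have notS: "a \<noteq> x \<Longrightarrow> a \<notin> S" using S_Int_exposed ap al ex by blast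
  then show "a \<noteq> x \<Longrightarrow> a \<in> D (low a)" using al by (blast intro: in_D)
  show "(x, z) \<in> (link_arcs (D (low a)) {x, z})\<^sup>*"
  proof (cases "a = x")
    case True
    \<comment> \<open>The fan path to x is the whole link. Its interior w is empty if it consists of
      the edge zx.\<close>
    note Fx = F_props[OF ap(1), unfolded True]
    obtain w where w: "F x = w @ [x]" using Fx(2,3) by (metis append_butlast_last_id)
    have "x \<notin> set w" using Fx(1) w by (auto simp: path_in_def)
    then have "D (low a) = set w"
      using F_S[OF ap(1)] ap(1) w unfolding True low_x by (auto simp: D_def S_def)
    then show ?thesis
      using link_arcs_path[of z w x "{x, z}"] Fx(1) w by (simp add: link_arcs_sym)
  next
    case False
    obtain l r where lr: "it a = l @ a # r" using in_P_cases[OF ap(2) ap(4)[OF False] False ap(3)] .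
    have pP: "it a \<in> P" using ap(4) False by simp
    have "set (l @ [a]) \<subseteq> low a"
    proof
      fix v assume v: "v \<in> set (l @ [a])"
      then have vp: "v \<in> set (it a)" using lr by auto
      have "pos v \<le> pos a"
      proof (cases "v = a")
        case False
        then obtain l1 l2 where l: "l = l1 @ v # l2" using v by (auto dest: split_list)
        then have "pos v = Suc (length l1)" using pos_P[of l1 v "l2 @ a # r"] pP lr by simp
        moreover have "pos a = Suc (length l)" using pos_P[of l a r] pP lr by simp
        ultimately show ?thesis using l by simp
      qed simp
      then show "v \<in> low a" using it_P[OF pP vp] set_P_U[OF pP] vp by (auto simp: low_def)
    qed
    then have "(x, a) \<in> (link_arcs (D (low a)) {x, z})\<^sup>*"
      using x_leg[of l a r "low a"] pP lr ex by simp
    moreover have "(z, a) \<in> (link_arcs (D (low a)) {x, z})\<^sup>*"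
      using z_leg[of a "low a"] ap al notS False by simp
    ultimately show ?thesis by (meson link_arcs_sym rtrancl_trans)
  qed
qed

lemma beta_conn:
  assumes a: "a \<in> Bup \<union> Ky"
  shows "(y, z) \<in> (link_arcs (D (up a)) {y, z})\<^sup>*" "a \<noteq> y \<Longrightarrow> a \<in> D (up a)"
proof -
  note ap = Bup_props[OF a] and ex = up_exposed[OF a]
  have al: "a \<in> up a" using ap by (simp add: up_def)
  have notS: "a \<noteq> y \<Longrightarrow> a \<notin> S" using S_Int_exposed ap al ex by blast
  then show "a \<noteq> y \<Longrightarrow> a \<in> D (up a)" using al by (blast intro: in_D)
  show "(y, z) \<in> (link_arcs (D (up a)) {y, z})\<^sup>*"
  proof (cases "a = y")
    case True
    note Fx = F_props[OF ap(1), unfolded True]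
    obtain w where w: "F y = w @ [y]" using Fx(2,3) by (metis append_butlast_last_id)
    have "y \<notin> set w" using Fx(1) w by (auto simp: path_in_def)
    then have "D (up a) = set w"
      using F_S[OF ap(1)] ap(1) w unfolding True up_y by (auto simp: D_def S_def)
    then show ?thesis
      using link_arcs_path[of z w y "{y, z}"] Fx(1) w by (simp add: link_arcs_sym)
  next
    case False
    obtain l r where lr: "it a = l @ a # r" using in_P_cases[OF ap(2) ap(4)[OF False] ap(3) False] .
    have pP: "it a \<in> P" using ap(4) False by simp
    have "set (a # r) \<subseteq> up a"
    proof
      fix v assume v: "v \<in> set (a # r)"
      then have vp: "v \<in> set (it a)" using lr by auto
      have "pos a \<le> pos v"
      proof (cases "v = a")
        case False
        then obtain l1 l2 where l: "r = l1 @ v # l2" using v by (auto dest: split_list)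
        then have "pos v = Suc (length (l @ a # l1))" using pos_P[of "l @ a # l1" v "l2"] pP lr by simp
        moreover have "pos a = Suc (length l)" using pos_P[of l a r] pP lr by simp
        ultimately show ?thesis using l by simp
      qed simp
      then show "v \<in> up a" using it_P[OF pP vp] set_P_U[OF pP] vp by (auto simp: up_def)
    qed
    then have "(y, a) \<in> (link_arcs (D (up a)) {y, z})\<^sup>*"
      using y_leg[of l a r "up a"] pP lr ex by simp
    moreover have "(z, a) \<in> (link_arcs (D (up a)) {y, z})\<^sup>*"
      using z_leg[of a "up a"] ap al notS False by simp
    ultimately show ?thesis by (meson link_arcs_sym rtrancl_trans)
  qed
qed

section \<open>Disjointness and number of the pieces\<close>

definition I where "I = IA \<union> IB \<union> IC \<union> IS"

lemma IA_info: "i \<in> IA \<Longrightarrow> v \<in> fst i \<Longrightarrow> i = (set (it v), {x, y}) \<and> hits (it v) = {}"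
  using it_P by (auto simp: IA_def P0_def)

lemma IS_info:
  "i \<in> IS \<Longrightarrow> v \<in> fst i \<Longrightarrow> i = (set (it v), S) \<and> it v \<in> P \<and> (\<exists>a. hits (it v) = {a})"
  using it_P by (auto simp: IS_def K1_def)

lemma IC_info:
  "i \<in> IC \<Longrightarrow> v \<in> fst i \<Longrightarrow> \<exists>a\<in>hits (it v). i = (low a, {x, z}) \<and> pos v \<le> pos a \<and>
     (it v \<in> P \<and> (\<exists>c\<in>hits (it v). pos a < pos c) \<or> it v \<notin> P \<and> a = x)"
proof -
  assume "i \<in> IC" and v: "v \<in> fst i"
  then obtain a where a: "a \<in> Clo \<union> Kx" "i = (low a, {x, z})" by (auto simp: IC_def)
  then have va: "it v = it a" "pos v \<le> pos a" using v by (auto simp: low_def)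
  from a(1) have "it a \<in> P \<and> (\<exists>c\<in>hits (it a). pos a < pos c) \<or> it a \<notin> P \<and> a = x"
    by (auto simp: Clo_def Kx_def hits_def)
  then show ?thesis using a va Clo_props(1)[OF a(1)] by (intro bexI[of _ a]) (auto simp: hits_def)
qed

lemma IB_info:
  "i \<in> IB \<Longrightarrow> v \<in> fst i \<Longrightarrow> \<exists>a\<in>hits (it v). i = (up a, {y, z}) \<and> pos a \<le> pos v \<and>
     (it v \<in> P \<and> (\<exists>c\<in>hits (it v). pos c < pos a) \<or> it v \<notin> P \<and> a = y)"
proof -
  assume "i \<in> IB" and v: "v \<in> fst i"
  then obtain a where a: "a \<in> Bup \<union> Ky" "i = (up a, {y, z})" by (auto simp: IB_def)
  then have va: "it v = it a" "pos a \<le> pos v" using v by (auto simp: up_def)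
  from a(1) have "it a \<in> P \<and> (\<exists>c\<in>hits (it a). pos c < pos a) \<or> it a \<notin> P \<and> a = y"
    by (auto simp: Bup_def Ky_def hits_def)
  then show ?thesis using a va Bup_props(1)[OF a(1)] by (intro bexI[of _ a]) (auto simp: hits_def)
qed

lemma hits_notbetween:
  "u \<in> hits p \<Longrightarrow> w \<in> hits p \<Longrightarrow> v \<in> hits p \<Longrightarrow> pos u < pos w \<Longrightarrow> pos w < pos v \<Longrightarrow> False"
  using notbetween[of u w v] by (simp add: hits_def)

lemma hits_inj: "u \<in> hits p \<Longrightarrow> w \<in> hits p \<Longrightarrow> pos u = pos w \<Longrightarrow> u = w"
  using inj[of u w] K_U by (auto simp: hits_def)

text \<open>A vertex determines its line, and the number of hits there determines which kinds of
  piece can occur. A vertex common to a lower and an upper piece of one path would yield hits at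
  positions c < b \<le> a < d, with b strictly between two hits.\<close>

lemma pieces_share:
  assumes "i \<in> I" "j \<in> I" "v \<in> fst i" "v \<in> fst j"
  shows "i = j"
proof -
  have BC: False if ij: "i \<in> IB" "j \<in> IC" "v \<in> fst i" "v \<in> fst j" for i j
  proof -
    obtain b where b: "b \<in> hits (it v)" "pos b \<le> pos v"
      "it v \<in> P \<and> (\<exists>c\<in>hits (it v). pos c < pos b) \<or> it v \<notin> P \<and> b = y"
      using IB_info[OF ij(1,3)] by blast
    obtain a where a: "a \<in> hits (it v)" "pos v \<le> pos a"
      "it v \<in> P \<and> (\<exists>c\<in>hits (it v). pos a < pos c) \<or> it v \<notin> P \<and> a = x"
      using IC_info[OF ij(2,4)] by blast
    show False
    proof (cases "it v \<in> P")
      case True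
      then obtain c d where cd: "c \<in> hits (it v)" "pos c < pos b" "d \<in> hits (it v)" "pos a < pos d"
        using a b by auto
      show False using hits_notbetween[of c "it v" b d] a b cd by simp
    next
      case False
      then have "it x = it y" using a b by (simp add: hits_def)
      moreover have "it x = it v" using a(1,3) False by (simp add: hits_def)
      ultimately show False using it_ends False by auto
    qed
  qed
  have CC: "i = j" if ij: "i \<in> IC" "j \<in> IC" "v \<in> fst i" "v \<in> fst j" for i j
  proof -
    obtain a where a: "a \<in> hits (it v)" "i = (low a, {x, z})"
      "it v \<in> P \<and> (\<exists>c\<in>hits (it v). pos a < pos c) \<or> it v \<notin> P \<and> a = x"
      using IC_info[OF ij(1,3)] by blast
    obtain b where b: "b \<in> hits (it v)" "j = (low b, {x, z})"
      "it v \<in> P \<and> (\<exists>c\<in>hits (it v). pos b < pos c) \<or> it v \<notin> P \<and> b = x"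
      using IC_info[OF ij(2,4)] by blast
    have "a = b"
    proof (cases "it v \<in> P")
      case True
      then obtain c d where cd: "c \<in> hits (it v)" "pos a < pos c" "d \<in> hits (it v)" "pos b < pos d"
        using a b by auto
      have "\<not> pos a < pos b" using hits_notbetween[OF a(1) b(1) cd(3)] cd by auto
      moreover have "\<not> pos b < pos a" using hits_notbetween[OF b(1) a(1) cd(1)] cd by auto
      ultimately show ?thesis using hits_inj[OF a(1) b(1)] by simp
    qed (use a b in auto)
    then show ?thesis using a b by simp
  qed
  have BB: "i = j" if ij: "i \<in> IB" "j \<in> IB" "v \<in> fst i" "v \<in> fst j" for i j
  proof -
    obtain a where a: "a \<in> hits (it v)" "i = (up a, {y, z})"
      "it v \<in> P \<and> (\<exists>c\<in>hits (it v). pos c < pos a) \<or> it v \<notin> P \<and> a = y"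
      using IB_info[OF ij(1,3)] by blast
    obtain b where b: "b \<in> hits (it v)" "j = (up b, {y, z})"
      "it v \<in> P \<and> (\<exists>c\<in>hits (it v). pos c < pos b) \<or> it v \<notin> P \<and> b = y"
      using IB_info[OF ij(2,4)] by blast
    have "a = b"
    proof (cases "it v \<in> P")
      case True
      then obtain c d where cd: "c \<in> hits (it v)" "pos c < pos a" "d \<in> hits (it v)" "pos d < pos b"
        using a b by auto
      have "\<not> pos b < pos a" using hits_notbetween[OF cd(3) b(1) a(1)] cd by auto
      moreover have "\<not> pos a < pos b" using hits_notbetween[OF cd(1) a(1) b(1)] cd by auto
      ultimately show ?thesis using hits_inj[OF a(1) b(1)] by simp
    qed (use a b in auto)
    then show ?thesis using a b by simp
  qed
  have A: "i = j" if "i \<in> IA" "j \<in> I" "v \<in> fst i" "v \<in> fst j" for i j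
    using that IA_info[of i v] IA_info[of j v] IS_info[of j v] IC_info[of j v] IB_info[of j v]
    unfolding I_def by auto
  have S: "i = j" if ij: "i \<in> IS" "j \<in> I" "v \<in> fst i" "v \<in> fst j" for i j
  proof -
    obtain a where i: "i = (set (it v), S)" "hits (it v) = {a}" "it v \<in> P"
      using IS_info[OF ij(1,3)] by blast
    show ?thesis
      using ij(2,4) i IA_info[of j v] IS_info[of j v] IC_info[of j v] IB_info[of j v]
      unfolding I_def by auto
  qed
  from assms(1,2) show ?thesis
    unfolding I_def using A[of i j] A[of j i] S[of i j] S[of j i] BC[of i j] BC[of j i] BB CC assms
    by (metis Un_iff)
qed

lemma pieces_exposed: "i \<in> I \<Longrightarrow> fst i \<subseteq> exposed K"
  using alpha_conn(3) star_conn(5) low_exposed up_exposed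
  unfolding I_def IA_def IB_def IC_def IS_def by (elim UnE imageE) simp_all

text \<open>A hit that is not a terminal is an inner vertex of its piece, so a piece without inner
  vertices is a single edge between terminals. There is one candidate for each pair of terminals,
  which is what \<open>link_arcs_disjoint\<close> requires.\<close>

lemma pieces_empty:
  assumes "i \<in> I" "D (fst i) = {}"
  shows "i \<in> {({}, {x, y}), (low x, {x, z}), (up y, {y, z})}"
proof -
  have "i \<notin> IS"
  proof
    assume "i \<in> IS"
    then obtain a where "a \<in> K1" "i = (set (it a), S)" unfolding IS_def by auto
    then show False using star_conn(4)[of a] assms(2) by auto
  qed
  moreover have "i = ({}, {x, y})" if iA: "i \<in> IA"
  proof -
    obtain p where "p \<in> P0" "i = (set p, {x, y})" using iA unfolding IA_def by auto
    then show ?thesis using alpha_conn(2)[of p] assms(2) by auto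
  qed
  moreover have "i = (low x, {x, z})" if iC: "i \<in> IC"
  proof -
    obtain a where "a \<in> Clo \<union> Kx" "i = (low a, {x, z})" using iC unfolding IC_def by auto
    then show ?thesis using gamma_conn(2)[of a] assms(2) by auto
  qed
  moreover have "i = (up y, {y, z})" if iB: "i \<in> IB"
  proof -
    obtain a where "a \<in> Bup \<union> Ky" "i = (up a, {y, z})" using iB unfolding IB_def by auto
    then show ?thesis using beta_conn(2)[of a] assms(2) by auto
  qed
  ultimately show ?thesis using assms(1) by (auto simp: I_def)
qed

definition arcs_of where "arcs_of i = link_arcs (D (fst i)) (snd i)"

lemma pieces_T: "i \<in> I \<Longrightarrow> snd i \<subseteq> S"
  unfolding I_def IA_def IB_def IC_def IS_def S_def by auto

lemma pieces_disjoint: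
  assumes "i \<in> I" "j \<in> I" "i \<noteq> j"
  shows "D (fst i) \<inter> D (fst j) = {}" "arcs_of i \<inter> arcs_of j = {}"
proof -
  have "fst i \<inter> fst j = {}" using pieces_share[OF assms(1,2)] assms(3) by blast
  then show DD: "D (fst i) \<inter> D (fst j) = {}"
    by (intro D_disjoint pieces_exposed assms)
  show "arcs_of i \<inter> arcs_of j = {}"
    unfolding arcs_of_def
  proof (rule link_arcs_disjoint[OF DD])
    show "D (fst i) \<inter> snd j = {}" "D (fst j) \<inter> snd i = {}"
      using D_S pieces_T assms by blast+
  next
    fix u v assume e: "D (fst i) = {}" "D (fst j) = {}" and uv: "u \<in> snd i \<inter> snd j" "v \<in> snd i \<inter> snd j"
    show "u = v"
      using pieces_empty[OF assms(1) e(1)] pieces_empty[OF assms(2) e(2)] uv assms(3) xyz by auto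
  qed
qed

lemma card_pieces:
  shows "card IA = card P0" "card IB = card (Bup \<union> Ky)" "card IC = card (Clo \<union> Kx)" "card IS = card K1"
proof -
  have setinj: "p = q" if "p \<in> P" "q \<in> P" "set p = set q" for p q
    using Pdisj[OF that(1,2)] that(3) by (metis Int_absorb set_empty)
  have "inj_on (\<lambda>p. (set p, {x, y})) P0" using setinj by (auto simp: inj_on_def P0_def)
  then show "card IA = card P0" unfolding IA_def by (rule card_image)
  have "inj_on (\<lambda>a. (up a, {y, z})) (Bup \<union> Ky)"
  proof (rule inj_onI)
    fix a b assume ab: "a \<in> Bup \<union> Ky" "b \<in> Bup \<union> Ky" "(up a, {y, z}) = (up b, {y, z})"
    have U: "a \<in> U" "b \<in> U" using Bup_props ab by blast+
    then have "a \<in> up b" "b \<in> up a" using ab(3) by (auto simp: up_def)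
    then show "a = b" using inj[OF U] by (auto simp: up_def)
  qed
  then show "card IB = card (Bup \<union> Ky)" unfolding IB_def by (rule card_image)
  have "inj_on (\<lambda>a. (low a, {x, z})) (Clo \<union> Kx)"
  proof (rule inj_onI)
    fix a b assume ab: "a \<in> Clo \<union> Kx" "b \<in> Clo \<union> Kx" "(low a, {x, z}) = (low b, {x, z})"
    have U: "a \<in> U" "b \<in> U" using Clo_props ab by blast+
    then have "a \<in> low b" "b \<in> low a" using ab(3) by (auto simp: low_def)
    then show "a = b" using inj[OF U] by (auto simp: low_def)
  qed
  then show "card IC = card (Clo \<union> Kx)" unfolding IC_def by (rule card_image)
  have "inj_on (\<lambda>a. (set (it a), S)) K1"
  proof (rule inj_onI)
    fix a b assume ab: "a \<in> K1" "b \<in> K1" "(set (it a), S) = (set (it b), S)"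
    then have "it a = it b" using setinj K1_props(2) by auto
    then have "{a} = {b}" using K1_props(3)[OF ab(1)] K1_props(3)[OF ab(2)] by metis
    then show "a = b" by simp
  qed
  then show "card IS = card K1" unfolding IS_def by (rule card_image)
qed

text \<open>Double counting: sorting the paths by their hits gives k = |P0| + |K1| + m, and sorting
  the hits gives k = |K1| + 2m + hx + hy, with hx and hy the sizes of \<open>Kx\<close> and
  \<open>Ky\<close>. Comparing the two yields |P0| = m + hx + hy.\<close>

lemma counts:
  obtains m hx hy where "card IA = m + hx + hy" "card IB = m + hy" "card IC = m + hx"
    "k = card IS + 2 * m + hx + hy"
proof -
  have fin: "finite K1" "finite Clo" "finite Bup" "finite Kx" "finite Ky" "finite P0"
    using finite_K finP by (auto simp: K1_def Clo_def Bup_def Kx_def Ky_def P0_def)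
  have injC: "inj_on it Clo"
  proof (rule inj_onI)
    fix a b assume ab: "a \<in> Clo" "b \<in> Clo" "it a = it b"
    then obtain c d where cd: "c \<in> hits (it a)" "pos a < pos c" "d \<in> hits (it a)" "pos b < pos d"
      by (auto simp: Clo_def hits_def)
    have h: "a \<in> hits (it a)" "b \<in> hits (it a)" using ab by (auto simp: hits_def Clo_def)
    have "\<not> pos a < pos b" "\<not> pos b < pos a"
      using hits_notbetween[OF h(1) h(2) cd(3)] hits_notbetween[OF h(2) h(1) cd(1)] cd by auto
    then show "a = b" using hits_inj[OF h] by simp
  qed
  have injB: "inj_on it Bup"
  proof (rule inj_onI)
    fix a b assume ab: "a \<in> Bup" "b \<in> Bup" "it a = it b"
    then obtain c d where cd: "c \<in> hits (it a)" "pos c < pos a" "d \<in> hits (it a)" "pos d < pos b"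
      by (auto simp: Bup_def hits_def)
    have h: "a \<in> hits (it a)" "b \<in> hits (it a)" using ab by (auto simp: hits_def Bup_def)
    have "\<not> pos a < pos b" "\<not> pos b < pos a"
      using hits_notbetween[OF cd(1) h(1) h(2)] hits_notbetween[OF cd(3) h(2) h(1)] cd by auto
    then show "a = b" using hits_inj[OF h] by simp
  qed
  have inj1: "inj_on it K1"
    using K1_props(3) by (intro inj_onI) (metis singleton_inject)
  have img: "it ` Clo = it ` Bup"
  proof
    show "it ` Clo \<subseteq> it ` Bup"
    proof
      fix p assume "p \<in> it ` Clo"
      then obtain a c where "a \<in> K" "p = it a" "it a \<in> P" "c \<in> K" "it c = it a" "pos a < pos c"
        by (auto simp: Clo_def)
      then have "c \<in> Bup" "p = it c" by (auto simp: Bup_def)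
      then show "p \<in> it ` Bup" by blast
    qed
    show "it ` Bup \<subseteq> it ` Clo"
    proof
      fix p assume "p \<in> it ` Bup"
      then obtain a c where "a \<in> K" "p = it a" "it a \<in> P" "c \<in> K" "it c = it a" "pos c < pos a"
        by (auto simp: Bup_def)
      then have "c \<in> Clo" "p = it c" by (auto simp: Clo_def)
      then show "p \<in> it ` Clo" by blast
    qed
  qed
  define m where "m = card Clo"
  have cB: "card Bup = m"
    using card_image[OF injC] card_image[OF injB] img by (simp add: m_def)
  have split: "a \<in> K1 \<or> a \<in> Clo \<or> a \<in> Bup" if "a \<in> K" "it a \<in> P" for a
  proof (cases "hits (it a) = {a}")
    case False
    have "a \<in> hits (it a)" using that by (simp add: hits_def)
    then obtain b where b: "b \<in> hits (it a)" "b \<noteq> a" using False by blast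
    then have "pos b \<noteq> pos a" using hits_inj \<open>a \<in> hits (it a)\<close> by blast
    then consider "pos b < pos a" | "pos a < pos b" by linarith
    then show ?thesis
    proof cases
      case 1
      then have "a \<in> Bup" using that b unfolding Bup_def hits_def by blast
      then show ?thesis by simp
    next
      case 2
      then have "a \<in> Clo" using that b unfolding Clo_def hits_def by blast
      then show ?thesis by simp
    qed
  qed (use that in \<open>simp add: K1_def\<close>)
  have Peq: "P = P0 \<union> it ` K1 \<union> it ` Clo"
  proof
    show "P \<subseteq> P0 \<union> it ` K1 \<union> it ` Clo"
    proof
      fix p assume p: "p \<in> P"
      show "p \<in> P0 \<union> it ` K1 \<union> it ` Clo"
      proof (cases "hits p = {}")
        case False
        then obtain a where "a \<in> K" "it a = p" by (auto simp: hits_def)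
        then show ?thesis using split[of a] p img by blast
      qed (use p in \<open>simp add: P0_def\<close>)
    qed
    show "P0 \<union> it ` K1 \<union> it ` Clo \<subseteq> P" by (auto simp: P0_def K1_def Clo_def)
  qed
  have d1: "P0 \<inter> it ` K1 = {}" by (auto simp: P0_def K1_def)
  have d2: "(P0 \<union> it ` K1) \<inter> it ` Clo = {}"
  proof -
    have "it a \<notin> P0" if "a \<in> Clo" for a using that by (auto simp: P0_def Clo_def hits_def)
    moreover have "it a \<noteq> it b" if ab: "a \<in> Clo" "b \<in> K1" for a b
    proof
      assume e: "it a = it b"
      obtain c where c: "c \<in> K" "it c = it a" "pos a < pos c" using ab(1) by (auto simp: Clo_def)
      have "a \<in> hits (it b)" "c \<in> hits (it b)" using c e ab(1) by (auto simp: hits_def Clo_def)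
      then have "a = c" using K1_props(3)[OF ab(2)] by simp
      then show False using c(3) by simp
    qed
    ultimately show ?thesis unfolding disjoint_iff image_iff Un_iff by metis
  qed
  have kP: "k = card P0 + card K1 + m"
    using card_Un_disjoint[OF _ _ d2] card_Un_disjoint[OF _ _ d1] fin cardP
      card_image[OF injC] card_image[OF inj1] Peq by (simp add: m_def)
  have K1C: "K1 \<inter> (Clo \<union> Bup) = {}"
  proof (rule ccontr)
    assume "K1 \<inter> (Clo \<union> Bup) \<noteq> {}"
    then obtain a where a: "a \<in> K1" "a \<in> Clo \<union> Bup" by blast
    then obtain c where "c \<in> hits (it a)" "pos c \<noteq> pos a" by (auto simp: Clo_def Bup_def hits_def)
    then show False using K1_props(3)[OF a(1)] by simp
  qed
  have CB: "Clo \<inter> Bup = {}"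
  proof (rule ccontr)
    assume "Clo \<inter> Bup \<noteq> {}"
    then obtain a c d where "a \<in> hits (it a)" "c \<in> hits (it a)" "pos a < pos c" "d \<in> hits (it a)" "pos d < pos a"
      by (auto simp: Clo_def Bup_def hits_def)
    then show False using hits_notbetween by blast
  qed
  have exy: "(K1 \<union> (Clo \<union> Bup)) \<inter> (Kx \<union> Ky) = {}" "Kx \<inter> Ky = {}"
    using xyz by (auto simp: K1_def Clo_def Bup_def Kx_def Ky_def)
  have Keq: "K = (K1 \<union> (Clo \<union> Bup)) \<union> (Kx \<union> Ky)"
  proof
    show "K \<subseteq> (K1 \<union> (Clo \<union> Bup)) \<union> (Kx \<union> Ky)"
    proof
      fix a assume a: "a \<in> K"
      show "a \<in> (K1 \<union> (Clo \<union> Bup)) \<union> (Kx \<union> Ky)"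
      proof (cases "it a \<in> P")
        case False
        have "a \<in> U" using a K_U by auto
        then have "a = x \<or> a = y" using False it_P by (auto simp: U_eq)
        then show ?thesis using a False by (auto simp: Kx_def Ky_def)
      qed (use split a in auto)
    qed
    show "(K1 \<union> (Clo \<union> Bup)) \<union> (Kx \<union> Ky) \<subseteq> K" by (auto simp: K1_def Clo_def Bup_def Kx_def Ky_def)
  qed
  have "card (K1 \<union> (Clo \<union> Bup) \<union> (Kx \<union> Ky)) = card K1 + (card Clo + card Bup) + (card Kx + card Ky)"
    using fin exy K1C CB by (simp add: card_Un_disjoint)
  then have kK: "k = card K1 + 2 * m + card Kx + card Ky" using card_K Keq cB by (simp add: m_def)
  have cIB: "card (Bup \<union> Ky) = m + card Ky"
    using exy fin cB by (subst card_Un_disjoint) auto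
  have cIC: "card (Clo \<union> Kx) = m + card Kx"
    using exy fin by (subst card_Un_disjoint) (auto simp: m_def)
  show thesis
    by (rule that[of m "card Kx" "card Ky"]) (use kP kK cIB cIC card_pieces in auto)
qed

lemma conn_A: "i \<in> IA \<Longrightarrow> (x, y) \<in> (arcs_of i)\<^sup>*"
  using alpha_conn(1) by (auto simp: IA_def arcs_of_def)

lemma conn_B: "i \<in> IB \<Longrightarrow> (y, z) \<in> (arcs_of i)\<^sup>*"
  using beta_conn(1) by (auto simp: IB_def arcs_of_def)

lemma conn_C: "i \<in> IC \<Longrightarrow> (x, z) \<in> (arcs_of i)\<^sup>*"
  using gamma_conn(1) by (auto simp: IC_def arcs_of_def)

lemma conn_S: "i \<in> IS \<Longrightarrow> (x, y) \<in> (arcs_of i)\<^sup>* \<and> (y, z) \<in> (arcs_of i)\<^sup>*"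
proof -
  assume "i \<in> IS"
  then obtain a where a: "a \<in> K1" "i = (set (it a), S)" by (auto simp: IS_def)
  then have "(x, a) \<in> (arcs_of i)\<^sup>*" "(y, a) \<in> (arcs_of i)\<^sup>*" "(z, a) \<in> (arcs_of i)\<^sup>*"
    using star_conn[OF a(1)] by (auto simp: arcs_of_def)
  moreover from this have "(a, y) \<in> (arcs_of i)\<^sup>*" "(a, z) \<in> (arcs_of i)\<^sup>*"
    unfolding arcs_of_def by (auto intro: link_arcs_sym)
  ultimately show ?thesis by (meson rtrancl_trans)
qed

lemma I_disjoint: "IA \<inter> IB = {}" "IA \<inter> IC = {}" "IB \<inter> IC = {}" "IS \<inter> (IA \<union> IB \<union> IC) = {}"
  using xyz unfolding IA_def IB_def IC_def IS_def S_def by (auto simp: set_eq_iff)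

lemma finite_I: "finite IA" "finite IB" "finite IC" "finite IS"
proof -
  have "finite (Bup \<union> Ky)" "finite (Clo \<union> Kx)" "finite K1" "finite P0"
    using finite_K finP by (auto simp: K1_def Clo_def Bup_def Kx_def Ky_def P0_def)
  then show "finite IA" "finite IB" "finite IC" "finite IS"
    by (simp_all add: IA_def IB_def IC_def IS_def)
qed

lemma packing:
  obtains \<C> :: "('a set \<times> 'a rel) set" where "finite \<C>" "k \<le> card \<C> + (k div 2 + 1) div 2"
    "\<And>D A. (D, A) \<in> \<C> \<Longrightarrow> D \<inter> {x, y, z} = {} \<and> sym A \<and> A \<subseteq> E \<and>
      A \<subseteq> (D \<union> {x, y, z}) \<times> (D \<union> {x, y, z}) \<and> (x, y) \<in> A\<^sup>* \<and> (x, z) \<in> A\<^sup>*"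
    "\<And>D A D' A'. (D, A) \<in> \<C> \<Longrightarrow> (D', A') \<in> \<C> \<Longrightarrow> (D, A) \<noteq> (D', A') \<Longrightarrow>
      D \<inter> D' = {} \<and> A \<inter> A' = {}"
proof -
  obtain m hx hy where m: "card IA = m + hx + hy" "card IB = m + hy" "card IC = m + hx"
    "k = card IS + 2 * m + hx + hy" using counts .
  define q e where "q = m div 2" and "e = m mod 2"
  have me: "m = 2 * q + e" "e \<le> 1" by (auto simp: q_def e_def)
  \<comment> \<open>The numbers of pairs of the kinds xy-yz, yz-xz and xy-xz are hy + q + e, q and
    hx + q. They use every piece, except one xz piece if m is odd.\<close>
  have le: "(hy + q + e) + (hx + q) \<le> card IA" "(hy + q + e) + q \<le> card IB" "q + (hx + q) \<le> card IC"
    using m me by auto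
  obtain \<T> where T: "finite \<T>" "card \<T> = card IS + (hy + q + e) + q + (hx + q)" "disjoint \<T>"
    "\<Union> \<T> \<subseteq> IA \<union> IB \<union> IC \<union> IS"
    "\<And>\<tau>. \<tau> \<in> \<T> \<Longrightarrow> (\<exists>d\<in>IS. \<tau> = {d}) \<or> (\<exists>a\<in>IA. \<exists>b\<in>IB. \<tau> = {a, b}) \<or>
      (\<exists>b\<in>IB. \<exists>c\<in>IC. \<tau> = {b, c}) \<or> (\<exists>a\<in>IA. \<exists>c\<in>IC. \<tau> = {a, c})"
    using cross_pairs[OF finite_I I_disjoint le] by blast
  have TI: "\<tau> \<subseteq> I" if "\<tau> \<in> \<T>" for \<tau> using T(4) that by (auto simp: I_def)
  define Dm where "Dm \<tau> = (\<Union>i\<in>\<tau>. D (fst i))" for \<tau> :: "('a set \<times> 'a set) set"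
  define Am where "Am \<tau> = (\<Union>i\<in>\<tau>. arcs_of i)" for \<tau> :: "('a set \<times> 'a set) set"
  have symA: "sym (Am \<tau>)" for \<tau>
    using sym_link_arcs unfolding Am_def arcs_of_def by (intro sym_UNION) auto
  have conn: "(x, y) \<in> (Am \<tau>)\<^sup>* \<and> (x, z) \<in> (Am \<tau>)\<^sup>*" if t: "\<tau> \<in> \<T>" for \<tau>
  proof -
    have mono: "(u, v) \<in> (Am \<tau>)\<^sup>*" if "i \<in> \<tau>" "(u, v) \<in> (arcs_of i)\<^sup>*" for i u v
      using rtrancl_mono[of "arcs_of i" "Am \<tau>"] that by (auto simp: Am_def)
    have flip: "(v, u) \<in> (Am \<tau>)\<^sup>*" if "(u, v) \<in> (Am \<tau>)\<^sup>*" for u v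
      using that symA sym_rtrancl symD by metis
    from T(5)[OF t] consider d where "d \<in> IS" "\<tau> = {d}" | a b where "a \<in> IA" "b \<in> IB" "\<tau> = {a, b}"
      | b c where "b \<in> IB" "c \<in> IC" "\<tau> = {b, c}" | a c where "a \<in> IA" "c \<in> IC" "\<tau> = {a, c}" by blast
    then show ?thesis
    proof cases
      case 1
      then have "(x, y) \<in> (Am \<tau>)\<^sup>*" "(y, z) \<in> (Am \<tau>)\<^sup>*" using conn_S mono by auto
      then show ?thesis by (meson rtrancl_trans)
    next
      case 2
      then have "(x, y) \<in> (Am \<tau>)\<^sup>*" "(y, z) \<in> (Am \<tau>)\<^sup>*" using mono[OF _ conn_A, of a] mono[OF _ conn_B, of b] by auto
      then show ?thesis by (meson rtrancl_trans)
    next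
      case 3
      then have "(x, z) \<in> (Am \<tau>)\<^sup>*" "(y, z) \<in> (Am \<tau>)\<^sup>*" using mono[OF _ conn_C, of c] mono[OF _ conn_B, of b] by auto
      then show ?thesis using flip by (meson rtrancl_trans)
    next
      case 4
      then show ?thesis using mono[OF _ conn_A, of a] mono[OF _ conn_C, of c] by auto
    qed
  qed
  have dis: "Dm \<tau> \<inter> Dm \<tau>' = {}" "Am \<tau> \<inter> Am \<tau>' = {}" if t: "\<tau> \<in> \<T>" "\<tau>' \<in> \<T>" "\<tau> \<noteq> \<tau>'" for \<tau> \<tau>'
  proof -
    have ne: "i \<noteq> j" if "i \<in> \<tau>" "j \<in> \<tau>'" for i j
      using T(3) t that unfolding disjoint_def by blast
    have "D (fst i) \<inter> D (fst j) = {}" "arcs_of i \<inter> arcs_of j = {}" if "i \<in> \<tau>" "j \<in> \<tau>'" for i j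
      using pieces_disjoint[of i j] ne[OF that] TI[OF t(1)] TI[OF t(2)] that by blast+
    then show "Dm \<tau> \<inter> Dm \<tau>' = {}" "Am \<tau> \<inter> Am \<tau>' = {}"
      unfolding Dm_def Am_def by fastforce+
  qed
  \<comment> \<open>Nonempty disjoint arc sets are distinct, so no member is lost in passing from
    pairs of pieces to arc sets.\<close>
  have Ane: "Am \<tau> \<noteq> {}" if "\<tau> \<in> \<T>" for \<tau>
    using conn[OF that] xyz by auto
  have injT: "inj_on (\<lambda>\<tau>. (Dm \<tau>, Am \<tau>)) \<T>"
    using dis(2) Ane by (intro inj_onI) (metis Int_absorb prod.inject)
  define \<C> where "\<C> = (\<lambda>\<tau>. (Dm \<tau>, Am \<tau>)) ` \<T>"
  show thesis
  proof (rule that)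
    show "finite \<C>" using T by (simp add: \<C>_def)
    have "card \<C> = card IS + hy + hx + 3 * q + e"
      using card_image[OF injT] T(2) by (simp add: \<C>_def)
    \<comment> \<open>The loss q + e is ceil(m/2), and the last count gives 2m \<le> k, so it is at
      most ceil(floor(k/2)/2).\<close>
    moreover have "q + e \<le> (k div 2 + 1) div 2" using m(4) me by linarith
    ultimately show "k \<le> card \<C> + (k div 2 + 1) div 2" using m(4) me by linarith
  next
    fix X A assume "(X, A) \<in> \<C>"
    then obtain \<tau> where t: "\<tau> \<in> \<T>" "X = Dm \<tau>" "A = Am \<tau>" by (auto simp: \<C>_def)
    have "X \<inter> S = {}" using D_S unfolding t Dm_def by blast
    moreover have "A \<subseteq> E"
      unfolding t(3) Am_def arcs_of_def using link_arcs_sub(1) by blast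
    moreover have "A \<subseteq> (X \<union> S) \<times> (X \<union> S)"
      unfolding t(3) Am_def
    proof (rule UN_least)
      fix i assume i: "i \<in> \<tau>"
      have sb: "D (fst i) \<union> snd i \<subseteq> X \<union> S" using i pieces_T[of i] TI[OF t(1)] unfolding t(2) Dm_def by blast
      then have "(D (fst i) \<union> snd i) \<times> (D (fst i) \<union> snd i) \<subseteq> (X \<union> S) \<times> (X \<union> S)"
        by (intro Sigma_mono sb)
      then show "arcs_of i \<subseteq> (X \<union> S) \<times> (X \<union> S)"
        unfolding arcs_of_def using link_arcs_sub(2) by (rule subset_trans[rotated])
    qed
    ultimately show "X \<inter> {x, y, z} = {} \<and> sym A \<and> A \<subseteq> E \<and>
      A \<subseteq> (X \<union> {x, y, z}) \<times> (X \<union> {x, y, z}) \<and> (x, y) \<in> A\<^sup>* \<and> (x, z) \<in> A\<^sup>*"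
      using conn[OF t(1)] symA t(3) by (simp add: S_def)
  next
    fix X A X' A' assume "(X, A) \<in> \<C>" "(X', A') \<in> \<C>" and ne: "(X, A) \<noteq> (X', A')"
    then obtain \<tau> \<tau>' where t: "\<tau> \<in> \<T>" "X = Dm \<tau>" "A = Am \<tau>" "\<tau>' \<in> \<T>" "X' = Dm \<tau>'" "A' = Am \<tau>'"
      by (auto simp: \<C>_def)
    then have "\<tau> \<noteq> \<tau>'" using ne by auto
    then show "X \<inter> X' = {} \<and> A \<inter> A' = {}" using dis t by simp
  qed
qed

end

section \<open>Existence of a saturated configuration\<close>

context k_connected
begin

text \<open>The bound 2 \<le> k leaves room for the initial fan of two paths that hides z when z
  lies on one of the x--y paths.\<close>

lemma hit_config_exists:
  assumes xyz: "x \<in> V" "y \<in> V" "z \<in> V" "x \<noteq> y" "x \<noteq> z" "y \<noteq> z" and k: "2 \<le> k"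
  shows "\<exists>U it pos P Fs. hit_config V E k U it pos x y z P Fs"
proof -
  obtain P where P: "finite P" "card P = k" "\<And>p. p \<in> P \<Longrightarrow> path_in E V (x # p @ [y])"
    "\<And>p q. p \<in> P \<Longrightarrow> q \<in> P \<Longrightarrow> p \<noteq> q \<Longrightarrow> set p \<inter> set q = {}"
    using disjoint_paths[OF xyz(1,2,4)] by metis
  define U where "U = {x, y} \<union> \<Union> (set ` P)"
  \<comment> \<open>The lists \<open>[x, x]\<close> and \<open>[y, y]\<close> serve as labels of two
    separate lines: they contain an end of the paths, so they are not in P.\<close>
  define it where "it v = (if v \<in> {x, y}
      then (if \<exists>p\<in>P. z \<in> set p then (SOME p. p \<in> P \<and> z \<in> set p) else [v, v])
      else (SOME p. p \<in> P \<and> v \<in> set p))" for v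
  \<comment> \<open>A position inside a path is at most \<open>card V\<close>, so
    \<open>Suc (card V)\<close> puts y behind everything.\<close>
  define pos where "pos v = (if v = x then 0 else if v = y then Suc (card V)
      else Suc (length (takeWhile (\<lambda>u. u \<noteq> v) (it v))))" for v
  have Pxy: "x \<notin> set p" "y \<notin> set p" "distinct p" "set p \<subseteq> V" if "p \<in> P" for p
    using P(3)[OF that] by (auto simp: path_in_def)
  have uniq: "p = q" if "p \<in> P" "q \<in> P" "v \<in> set p" "v \<in> set q" for p q v
    using P(4) that by blast
  have it_P: "it v = p" if p: "p \<in> P" "v \<in> set p" for p v
  proof -
    have "v \<notin> {x, y}" using Pxy[OF p(1)] p(2) by auto
    then have "it v = (SOME p. p \<in> P \<and> v \<in> set p)" by (simp add: it_def)
    also have "\<dots> = p" using p uniq by (intro some_equality) blast+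
    finally show ?thesis .
  qed
  have it_special: "it x = p" "it y = p" if p: "p \<in> P" "z \<in> set p" for p
  proof -
    have "(SOME p. p \<in> P \<and> z \<in> set p) = p" using p uniq by (intro some_equality) blast+
    then show "it x = p" "it y = p" using p by (auto simp: it_def)
  qed
  have it_other: "it x = [x, x]" "it y = [y, y]" if "\<forall>p\<in>P. z \<notin> set p"
    using that by (auto simp: it_def)
  have itx: "it x \<notin> P" "it y \<notin> P" "it x \<noteq> it y" if "\<forall>p\<in>P. z \<notin> set p"
    using it_other[OF that] Pxy[of "[x, x]"] Pxy[of "[y, y]"] xyz by auto
  have it_ends: "it x \<in> P \<and> it y = it x \<and> z \<in> set (it x) \<or> it x \<notin> P \<and> it y \<notin> P \<and> it x \<noteq> it y"
  proof (cases "\<exists>p\<in>P. z \<in> set p")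
    case True
    then obtain p where p: "p \<in> P" "z \<in> set p" by blast
    then show ?thesis using it_special[OF p] by simp
  next
    case False
    then show ?thesis using itx by blast
  qed
  have pos_P: "pos v = Suc (length l)" if p: "l @ v # r \<in> P" for l v r
  proof -
    have v: "v \<noteq> x" "v \<noteq> y" "v \<notin> set l" using Pxy[OF p] by auto
    moreover have "it v = l @ v # r" using it_P[OF p] by simp
    moreover have "takeWhile (\<lambda>u. u \<noteq> v) (l @ v # r) = l" using v by (subst takeWhile_append2) auto
    ultimately show ?thesis by (simp add: pos_def)
  qed
  have inP: "\<exists>l r. it v = l @ v # r \<and> it v \<in> P \<and> pos v = Suc (length l) \<and> length l < card V"
    if v: "v \<in> U" "v \<noteq> x" "v \<noteq> y" for v
  proof -
    obtain p where p: "p \<in> P" "v \<in> set p" using v by (auto simp: U_def)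
    then obtain l r where lr: "p = l @ v # r" by (meson split_list)
    have "length p = card (set p)" using Pxy(3)[OF p(1)] by (simp add: distinct_card)
    also have "\<dots> \<le> card V" using Pxy(4)[OF p(1)] finV by (rule card_mono[rotated])
    finally have "length l < card V" using lr by simp
    then show ?thesis using lr p it_P[OF p] pos_P[of l v r] by auto
  qed
  have pos_x: "pos x = 0" and pos_yv: "pos y = Suc (card V)" using xyz by (auto simp: pos_def)
  have pos_y: "pos v < pos y" if "v \<in> U" "v \<noteq> y" for v
    using inP[of v] that pos_x pos_yv by (cases "v = x") auto
  have pos0: "u = x" if "pos u = 0" for u using that by (auto simp: pos_def split: if_splits)
  have UV: "U \<subseteq> V" using Pxy(4) xyz by (auto simp: U_def)
  have lines: "lines U it pos"
  proof
    show "finite U" using UV finV by (rule finite_subset)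
  next
    fix u v assume uv: "u \<in> U" "v \<in> U" "it u = it v" "pos u = pos v"
    show "u = v"
    proof (cases "u = x \<or> u = y \<or> v = x \<or> v = y")
      case True
      then show ?thesis
      proof (elim disjE)
        assume "u = x" then show ?thesis using pos0[of v] pos_x uv(4) by simp
      next
        assume "v = x" then show ?thesis using pos0[of u] pos_x uv(4) by simp
      next
        assume "u = y" then show ?thesis using pos_y[OF uv(2)] uv(4) by (cases "v = y") auto
      next
        assume "v = y" then show ?thesis using pos_y[OF uv(1)] uv(4) by (cases "u = y") auto
      qed
    next
      case False
      then obtain l r l' r' where lr: "it u = l @ u # r" "pos u = Suc (length l)"
        "it v = l' @ v # r'" "pos v = Suc (length l')"
        using inP[of u] inP[of v] uv(1,2) by blast
      have "l @ u # r = l' @ v # r'" using lr(1,3) uv(3) by metis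
      moreover have "length l = length l'" using lr(2,4) uv(4) by linarith
      ultimately show ?thesis by simp
    qed
  qed
  interpret lines U it pos by fact
  have xyU: "x \<in> U" "y \<in> U" by (auto simp: U_def)
  have PU: "set p \<subseteq> U" if "p \<in> P" for p using that by (auto simp: U_def)
  \<comment> \<open>The first vertex of a path has position 1 and could be hidden only by a hit in
    x, the sole vertex at position 0, on the same line. So x, y and the first vertices of all paths
    except \<open>[]\<close> and \<open>it x\<close> are exposed: at least 2 + (k - 2)
    vertices.\<close>
  have big: "k \<le> card (exposed K)" if KU: "K \<subseteq> U" for K
  proof -
    let ?Q = "P - {[], it x}"
    have hdQ: "hd p \<in> exposed K \<and> hd p \<noteq> x \<and> hd p \<noteq> y \<and> it (hd p) = p" if p: "p \<in> ?Q" for p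
    proof -
      obtain v r where vr: "p = v # r" using p by (cases p) auto
      have pP: "p \<in> P" using p by simp
      have v: "v \<noteq> x" "v \<noteq> y" "it v = p" "v \<in> U" "pos v = 1"
        using Pxy[OF pP] it_P[OF pP, of v] pos_P[of "[]" v r] PU[OF pP] pP vr by auto
      have "\<not> between a v c" for a c
      proof
        assume "between a v c"
        then have "pos a = 0" "it a = p" using v by (auto simp: between_def)
        then show False using pos0[of a] p by auto
      qed
      then show ?thesis using v vr by (auto simp: exposed_def)
    qed
    have xy: "x \<in> exposed K" "y \<in> exposed K"
    proof -
      show "x \<in> exposed K" using pos_x xyU by (auto simp: exposed_def between_def)
      have "\<not> pos y < pos c" if "c \<in> K" for c using that pos_y[of c] KU by (cases "c = y") auto
      then show "y \<in> exposed K" using xyU by (auto simp: exposed_def between_def)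
    qed
    have "inj_on hd ?Q" using hdQ by (metis inj_onI)
    then have "card (hd ` ?Q) = card ?Q" by (rule card_image)
    moreover have "k - 2 \<le> card ?Q"
      using P(1,2) diff_card_le_card_Diff[of "{[], it x}" P] card_insert_le_m1[of 2 "{it x}" "[]"] by auto
    moreover have "card ({x, y} \<union> hd ` ?Q) = 2 + card (hd ` ?Q)"
      using hdQ P(1) xyz by (subst card_Un_disjoint) auto
    moreover have "card ({x, y} \<union> hd ` ?Q) \<le> card (exposed K)"
      by (rule card_mono[OF finite_exposed]) (use hdQ xy in auto)
    ultimately show ?thesis by linarith
  qed
  \<comment> \<open>If z is on no path, it is not in U and the empty fan will do. Otherwise its
    neighbours a and c on the path, possibly x or y, form two fan paths of one vertex each and hide
    z.\<close>
  obtain Fs where Fs: "linkage E (V - {z}) (nbrs z) (exposed (last ` Fs)) Fs"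
    "z \<notin> exposed (last ` Fs)" "card Fs \<le> k"
  proof (cases "\<exists>p\<in>P. z \<in> set p")
    case False
    then have "z \<notin> exposed (last ` {})" using exposed_sub xyz by (auto simp: exposed_def U_def)
    then show thesis using that[of "{}"] by (simp add: linkage_def)
  next
    case True
    then obtain p1 p2 where p: "p1 @ z # p2 \<in> P" by (metis split_list)
    define a c where "a = last (x # p1)" and "c = hd (p2 @ [y])"
    have pz: "pos z = Suc (length p1)" "it z = p1 @ z # p2" using pos_P[OF p] it_P[OF p] by auto
    have itxy: "it x = p1 @ z # p2" "it y = p1 @ z # p2" using it_special[OF p] by auto
    have a: "it a = it z" "pos a < pos z" "a \<in> U"
    proof -
      have "it a = it z \<and> pos a < pos z \<and> a \<in> U"
      proof (cases p1 rule: rev_cases)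
        case Nil
        then show ?thesis using pz pos_x itxy xyU by (simp add: a_def)
      next
        case (snoc q b)
        then have "a = b" by (simp add: a_def)
        then show ?thesis
          using pos_P[of q b "z # p2"] it_P[OF p, of b] PU[OF p] p snoc pz by auto
      qed
      then show "it a = it z" "pos a < pos z" "a \<in> U" by auto
    qed
    have c: "it c = it z" "pos z < pos c" "c \<in> U"
    proof -
      have "it c = it z \<and> pos z < pos c \<and> c \<in> U"
      proof (cases p2)
        case Nil
        have "z \<in> U" "z \<noteq> y" using PU[OF p] xyz by auto
        then show ?thesis using Nil pz pos_y[of z] itxy xyU by (simp add: c_def)
      next
        case (Cons b q)
        then have "c = b" by (simp add: c_def)
        then show ?thesis
          using pos_P[of "p1 @ [z]" b q] it_P[OF p, of b] PU[OF p] p Cons pz by auto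
      qed
      then show "it c = it z" "pos z < pos c" "c \<in> U" by auto
    qed
    have az: "a \<noteq> z" "c \<noteq> z" "a \<noteq> c" using a c by auto
    have "path_in E V ((x # p1) @ z # (p2 @ [y]))" using P(3)[OF p] by simp
    then have "(a, z) \<in> E" "(z, c) \<in> E"
      unfolding a_def c_def path_in_append by (auto simp: path_in_Cons)
    then have E: "(z, a) \<in> E" "(z, c) \<in> E" using symE by (auto dest: symD)
    have ex: "a \<in> exposed {a, c}" "c \<in> exposed {a, c}" "z \<notin> exposed {a, c}"
      using a c unfolding exposed_def between_def by auto
    let ?F = "{[a], [c]}"
    have im: "last ` ?F = {a, c}" by simp
    have "linkage E (V - {z}) (nbrs z) (exposed (last ` ?F)) ?F"
      unfolding linkage_def im using ex E az a(3) c(3) UV by (auto simp: path_in_def)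
    moreover have "card ?F \<le> k" using k az by simp
    ultimately show thesis using that[of ?F] ex(3) im by simp
  qed
  obtain Gs where "linkage E (V - {z}) (nbrs z) (exposed (last ` Gs)) Gs"
    "z \<notin> exposed (last ` Gs)" "card Gs = k"
    using saturated_fan[OF lines xyz(3) UV big Fs] by metis
  then have "hit_config V E k U it pos x y z P Gs"
    using P xyz it_P it_ends pos_x pos_P pos_y U_def by unfold_locales auto
  then show ?thesis by blast
qed

text \<open>For k \<le> 1 the loss term is 0: nothing is needed if k = 0, and the whole connected
  graph is the single member if k = 1.\<close>

lemma tree_packing:
  assumes xyz: "x \<in> V" "y \<in> V" "z \<in> V" "x \<noteq> y" "x \<noteq> z" "y \<noteq> z"
  obtains \<C> :: "('a set \<times> 'a rel) set" where "finite \<C>" "k \<le> card \<C> + (k div 2 + 1) div 2"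
    "\<And>D A. (D, A) \<in> \<C> \<Longrightarrow> D \<inter> {x, y, z} = {} \<and> sym A \<and> A \<subseteq> E \<and>
      A \<subseteq> (D \<union> {x, y, z}) \<times> (D \<union> {x, y, z}) \<and> (x, y) \<in> A\<^sup>* \<and> (x, z) \<in> A\<^sup>*"
    "\<And>D A D' A'. (D, A) \<in> \<C> \<Longrightarrow> (D', A') \<in> \<C> \<Longrightarrow> (D, A) \<noteq> (D', A') \<Longrightarrow>
      D \<inter> D' = {} \<and> A \<inter> A' = {}"
proof (cases "2 \<le> k")
  case True
  then obtain U it pos P Fs where "hit_config V E k U it pos x y z P Fs"
    using hit_config_exists[OF xyz] by blast
  then interpret hit_config V E k U it pos x y z P Fs .
  show thesis using packing that by blast
next
  case False
  show thesis
  proof (cases "k = 0")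
    case True
    then show thesis using that[of "{}"] by simp
  next
    case nz: False
    have k1: "k = 1" using False nz by simp
    have "(x, y) \<in> (E \<inter> (V - {}) \<times> (V - {}))\<^sup>*" "(x, z) \<in> (E \<inter> (V - {}) \<times> (V - {}))\<^sup>*"
      by (rule conn; use xyz k1 in simp)+
    then have c: "(x, y) \<in> E\<^sup>*" "(x, z) \<in> E\<^sup>*"
      using rtrancl_mono[of "E \<inter> (V - {}) \<times> (V - {})" E] by auto
    have "(V - {x, y, z}) \<union> {x, y, z} = V" using xyz by auto
    then show thesis
      using that[of "{(V - {x, y, z}, E)}"] k1 symE EV c by auto
  qed
qed

end

section \<open>Trees and generalized connectivity\<close>

lemma rtrancl_on_eq: "u \<in> F \<Longrightarrow> (u, v) \<in> rtrancl_on F r \<longleftrightarrow> (u, v) \<in> (r \<inter> F \<times> F)\<^sup>*"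
proof
  assume "(u, v) \<in> rtrancl_on F r" "u \<in> F"
  then show "(u, v) \<in> (r \<inter> F \<times> F)\<^sup>*"
    by (induction rule: rtrancl_on_induct) (auto intro: rtrancl_into_rtrancl)
next
  assume "(u, v) \<in> (r \<inter> F \<times> F)\<^sup>*" "u \<in> F"
  then show "(u, v) \<in> rtrancl_on F r"
    by (induction rule: rtrancl_induct) (auto intro: rtrancl_on_into_rtrancl_on)
qed

lemma connected_iff_rtrancl:
  assumes "sym (arcs_ends D)"
  shows "Digraph_Component.connected D \<longleftrightarrow> verts D \<noteq> {} \<and>
    (\<forall>u\<in>verts D. \<forall>v\<in>verts D. (u, v) \<in> (arcs_ends D \<inter> verts D \<times> verts D)\<^sup>*)"
proof -
  have "(arcs_ends D)\<^sup>s = arcs_ends D"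
    using assms by (auto simp: symcl_def dest: symD)
  then show ?thesis by (simp add: connected_conv rtrancl_on_eq)
qed

lemma pair_graph_iff:
  "pair_graph G \<longleftrightarrow> finite (pverts G) \<and> parcs G \<subseteq> pverts G \<times> pverts G \<and> sym (parcs G) \<and>
    (\<forall>v. (v, v) \<notin> parcs G)"
proof
  assume "pair_graph G"
  then interpret pair_graph G .
  show "finite (pverts G) \<and> parcs G \<subseteq> pverts G \<times> pverts G \<and> sym (parcs G) \<and> (\<forall>v. (v, v) \<notin> parcs G)"
    using pair_finite_verts in_arcsD1 in_arcsD2 arcs_symmetric by (auto intro: symI dest: no_loops')
next
  assume G: "finite (pverts G) \<and> parcs G \<subseteq> pverts G \<times> pverts G \<and> sym (parcs G) \<and> (\<forall>v. (v, v) \<notin> parcs G)"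
  then have "finite (parcs G)" by (meson finite_SigmaI finite_subset)
  then show "pair_graph G"
    using G by unfold_locales (auto simp: symmetric_def)
qed

lemma connected_pair_iff:
  assumes "pair_graph G"
  shows "Digraph_Component.connected (with_proj G) \<longleftrightarrow> pverts G \<noteq> {} \<and>
    (\<forall>u\<in>pverts G. \<forall>v\<in>pverts G. (u, v) \<in> (parcs G)\<^sup>*)"
proof -
  have "sym (parcs G)" "parcs G \<inter> pverts G \<times> pverts G = parcs G"
    using assms by (auto simp: pair_graph_iff)
  then show ?thesis using connected_iff_rtrancl[of "with_proj G"] by simp
qed

lemma connected_induce_iff:
  assumes "pair_graph G"
  shows "Digraph_Component.connected (with_proj G \<restriction> X) \<longleftrightarrow> X \<noteq> {} \<and>
    (\<forall>u\<in>X. \<forall>v\<in>X. (u, v) \<in> (parcs G \<inter> X \<times> X)\<^sup>*)"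
proof -
  have e: "arcs_ends (with_proj G \<restriction> X) = parcs G \<inter> X \<times> X"
    by (force simp: arcs_ends_conv)
  have "sym (parcs G \<inter> X \<times> X)" using assms by (auto simp: pair_graph_iff sym_def)
  then show ?thesis using connected_iff_rtrancl[of "with_proj G \<restriction> X"] e
    by (simp add: Int_assoc)
qed

lemma last_pawalk_verts: "pcas u p v \<Longrightarrow> last (pawalk_verts u p) = v"
  by (induction p arbitrary: u) (auto split: list.splits, (case_tac p; auto)+)

lemma pawalk_verts_ends:
  "pcas u p v \<Longrightarrow> (a, b) \<in> set p \<Longrightarrow> a \<in> set (pawalk_verts u p) \<and> b \<in> set (tl (pawalk_verts u p))"
proof (induction p arbitrary: u)
  case (Cons e p)
  have "snd e \<in> set (pawalk_verts (snd e) p)" using Cons.prems by (cases p) auto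
  moreover have "set (tl (pawalk_verts (snd e) p)) \<subseteq> set (pawalk_verts (snd e) p)"
    by (cases p) auto
  ultimately show ?case using Cons by auto
qed simp

lemma pcas_imp_rtrancl: "pcas u p v \<Longrightarrow> set p \<subseteq> A \<Longrightarrow> (u, v) \<in> A\<^sup>*"
  by (induction p arbitrary: u) (auto intro: converse_rtrancl_into_rtrancl)

lemma pawalk_verts_nonempty: "pawalk_verts u p \<noteq> []"
  by (cases p) auto

text \<open>An edge on a cycle of length at least three can be deleted without disconnecting the
  graph; the induction is on the number of arcs.\<close>

lemma spanning_tree_exists:
  assumes "finite V" "V \<noteq> {}" "A \<subseteq> V \<times> V" "sym A" "\<And>v. (v, v) \<notin> A"
    and "\<And>u v. u \<in> V \<Longrightarrow> v \<in> V \<Longrightarrow> (u, v) \<in> A\<^sup>*"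
  shows "\<exists>T. undirected_tree T \<and> pverts T = V \<and> parcs T \<subseteq> A"
  using assms(3-)
proof (induction "card A" arbitrary: A rule: less_induct)
  case less
  let ?G = "\<lparr> pverts = V, parcs = A \<rparr>"
  have finA: "finite A" using less.prems(1) assms(1) by (meson finite_SigmaI finite_subset)
  have pg: "pair_graph ?G" using less.prems assms(1) by (simp add: pair_graph_iff)
  then have cg: "connected_graph ?G"
    using connected_pair_iff[OF pg] less.prems(4) assms(2) by (simp add: connected_graph_def)
  show ?case
  proof (cases "\<exists>p. pre_digraph.cycle (with_proj ?G) p \<and> 3 \<le> length p")
    case False
    then have "undirected_tree ?G" using cg by (simp add: undirected_tree_def)
    then show ?thesis by (intro exI[of _ ?G]) simp
  next
    case True
    then obtain p where p: "pre_digraph.cycle (with_proj ?G) p" "3 \<le> length p" by blast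
    then obtain u where u: "pre_digraph.awalk (with_proj ?G) u p u"
      "distinct (tl (pre_digraph.awalk_verts (with_proj ?G) u p))"
      unfolding pre_digraph.cycle_def by blast
    then have cas: "pcas u p u" and pA: "set p \<subseteq> A" and dist: "distinct (tl (pawalk_verts u p))"
      by (auto simp: pre_digraph.awalk_def cas_with_proj_eq awalk_verts_with_proj_eq)
    obtain e1 e2 e3 q where pq: "p = e1 # e2 # e3 # q"
      using p(2) by (metis Suc_le_length_iff numeral_3_eq_3)
    define v where "v = snd e1"
    define r where "r = e2 # e3 # q"
    have e1: "e1 = (u, v)" using cas pq by (cases e1) (simp add: v_def)
    have rc: "pcas v r u" and rd: "distinct (pawalk_verts v r)"
      using cas dist pq by (auto simp: v_def r_def)
    have e2: "fst e2 = v" using rc by (simp add: r_def)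
    define w where "w = snd e2"
    have vr: "pawalk_verts v r = v # w # pawalk_verts (snd e3) q" using rc by (auto simp: r_def w_def)
    \<comment> \<open>Here the length at least three enters: on the closed walk u, v, u the vertex w
      would be u, and the edge would not be redundant.\<close>
    have wu: "w \<noteq> u"
    proof -
      have "u = last (pawalk_verts v r)" using last_pawalk_verts[OF rc] by simp
      also have "\<dots> \<in> set (pawalk_verts (snd e3) q)"
        unfolding vr by (simp add: pawalk_verts_nonempty)
      finally show ?thesis using rd vr by auto
    qed
    define A' where "A' = A - {(u, v), (v, u)}"
    have uvA: "(u, v) \<in> A" using pA pq e1 by auto
    have sA': "sym A'" using less.prems(2) by (auto simp: A'_def sym_def)
    \<comment> \<open>The rest of the cycle avoids both arcs of the edge: no arc of r enters its
      start v, and the only arc of r that leaves v goes to w.\<close>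
    have "set r \<subseteq> A'"
    proof
      fix e assume e: "e \<in> set r"
      obtain a b where ab: "e = (a, b)" by (cases e)
      have "e \<in> A" using e pA pq by (auto simp: r_def)
      moreover have "b \<noteq> v"
        using pawalk_verts_ends[OF rc, of a b] e ab rd vr by auto
      moreover have "(a, b) \<noteq> (v, u)"
      proof
        assume vu: "(a, b) = (v, u)"
        have "e \<noteq> e2" using vu ab wu by (auto simp: w_def)
        then have "e \<in> set (e3 # q)" using e by (simp add: r_def)
        moreover have "pcas w (e3 # q) u" using rc by (simp add: r_def w_def)
        ultimately have "a \<in> set (pawalk_verts w (e3 # q))"
          using pawalk_verts_ends[of w "e3 # q" u a b] ab by blast
        moreover have "pawalk_verts v r = v # pawalk_verts w (e3 # q)" using e2 by (simp add: r_def w_def)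
        ultimately show False using rd vu by auto
      qed
      ultimately show "e \<in> A'" using ab by (auto simp: A'_def)
    qed
    then have "(v, u) \<in> A'\<^sup>*" using pcas_imp_rtrancl[OF rc] by blast
    moreover from this have "(u, v) \<in> A'\<^sup>*" using sA' sym_rtrancl symD by metis
    ultimately have "A \<subseteq> A'\<^sup>*" by (auto simp: A'_def)
    then have "A\<^sup>* \<subseteq> A'\<^sup>*" using rtrancl_subset_rtrancl by blast
    then have conn: "(a, b) \<in> A'\<^sup>*" if "a \<in> V" "b \<in> V" for a b using less.prems(4) that by blast
    have "A' \<subset> A" using uvA by (auto simp: A'_def)
    then have "card A' < card A" using finA by (rule psubset_card_mono[rotated])
    moreover have "A' \<subseteq> V \<times> V" "\<And>v. (v, v) \<notin> A'" using less.prems by (auto simp: A'_def)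
    ultimately obtain T where "undirected_tree T" "pverts T = V" "parcs T \<subseteq> A'"
      using less.hyps[of A'] sA' conn by blast
    then show ?thesis unfolding A'_def by blast
  qed
qed

section \<open>Upper and lower bounds for packings of S-trees\<close>

lemma S_treeD:
  assumes "S_tree G S T"
  shows "pair_graph T" "pverts T \<subseteq> pverts G" "parcs T \<subseteq> parcs G" "S \<subseteq> pverts T"
    "u \<in> pverts T \<Longrightarrow> v \<in> pverts T \<Longrightarrow> (u, v) \<in> (parcs T)\<^sup>*"
proof -
  show pg: "pair_graph T" using assms by (simp add: S_tree_def undirected_tree_def connected_graph_def)
  show "pverts T \<subseteq> pverts G" "parcs T \<subseteq> parcs G" "S \<subseteq> pverts T"
    using assms by (auto simp: S_tree_def subgraph_def)
  show "u \<in> pverts T \<Longrightarrow> v \<in> pverts T \<Longrightarrow> (u, v) \<in> (parcs T)\<^sup>*"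
    using assms connected_pair_iff[OF pg]
    by (simp add: S_tree_def undirected_tree_def connected_graph_def)
qed

lemma finite_S_trees:
  assumes "pair_graph G"
  shows "finite {T. S_tree G S T}"
proof -
  let ?f = "\<lambda>T :: 'a pair_pre_digraph. (pverts T, parcs T)"
  have "finite (parcs G)" "finite (pverts G)"
    using assms by (auto simp: pair_graph_iff intro: finite_subset)
  moreover have "?f ` {T. S_tree G S T} \<subseteq> Pow (pverts G) \<times> Pow (parcs G)"
    using S_treeD(2,3) by fastforce
  ultimately have "finite (?f ` {T. S_tree G S T})" by (meson finite_Pow_iff finite_SigmaI finite_subset)
  moreover have "inj_on ?f {T. S_tree G S T}" by (auto simp: inj_on_def)
  ultimately show ?thesis by (rule finite_imageD)
qed

lemma finite_packing_sizes:
  assumes "pair_graph G"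
  shows "finite {card F | F. (\<forall>T\<in>F. S_tree G S T) \<and> pairwise (internally_disjoint S) F}"
proof -
  have "{card F | F. (\<forall>T\<in>F. S_tree G S T) \<and> pairwise (internally_disjoint S) F} \<subseteq> card ` Pow {T. S_tree G S T}"
    by blast
  then show ?thesis using finite_S_trees[OF assms] by (meson finite_Pow_iff finite_imageI finite_subset)
qed

lemma set_connectivity_ge:
  assumes "pair_graph G" "\<And>T. T \<in> F \<Longrightarrow> S_tree G S T" "pairwise (internally_disjoint S) F"
  shows "card F \<le> set_connectivity G S"
  unfolding set_connectivity_def
  by (rule Max_ge[OF finite_packing_sizes[OF assms(1)]]) (use assms in blast)

lemma set_connectivity_le:
  assumes "pair_graph G"
    and "\<And>F. finite F \<Longrightarrow> (\<And>T. T \<in> F \<Longrightarrow> S_tree G S T) \<Longrightarrow> pairwise (internally_disjoint S) F \<Longrightarrow> card F \<le> n"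
  shows "set_connectivity G S \<le> n"
  unfolding set_connectivity_def
proof (rule Max.boundedI[OF finite_packing_sizes[OF assms(1)]])
  have "card {} \<in> {card F | F. (\<forall>T\<in>F. S_tree G S T) \<and> pairwise (internally_disjoint S) F}"
    by (auto intro!: exI[of _ "{}"])
  then show "{card F | F. (\<forall>T\<in>F. S_tree G S T) \<and> pairwise (internally_disjoint S) F} \<noteq> {}" by blast
next
  fix a assume "a \<in> {card F | F. (\<forall>T\<in>F. S_tree G S T) \<and> pairwise (internally_disjoint S) F}"
  then obtain F where F: "a = card F" "\<forall>T\<in>F. S_tree G S T" "pairwise (internally_disjoint S) F" by blast
  have "finite F" using F(2) finite_S_trees[OF assms(1)] by (meson finite_subset mem_Collect_eq subsetI)
  then show "a \<le> n" using assms(2)[of F] F by simp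
qed

text \<open>Every tree has to leave v to reach u, and trees with disjoint arc sets do so by
  different arcs.\<close>

lemma set_connectivity_le_degree:
  assumes G: "pair_graph G" and S: "v \<in> S" "u \<in> S" "u \<noteq> v"
  shows "set_connectivity G S \<le> out_degree (with_proj G) v"
proof (rule set_connectivity_le[OF G])
  fix F assume F: "finite F" "\<And>T. T \<in> F \<Longrightarrow> S_tree G S T" "pairwise (internally_disjoint S) F"
  have "\<exists>w. (v, w) \<in> parcs T" if "T \<in> F" for T
  proof -
    note T = S_treeD[OF F(2)[OF that]]
    have "(v, u) \<in> (parcs T)\<^sup>*" using T(4) S by (intro T(5)) auto
    then show ?thesis using S(3) by (cases rule: converse_rtranclE) auto
  qed
  then obtain f where f: "\<And>T. T \<in> F \<Longrightarrow> (v, f T) \<in> parcs T" by metis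
  have "inj_on (\<lambda>T. (v, f T)) F"
  proof (rule inj_onI)
    fix T T' assume T: "T \<in> F" "T' \<in> F" "(v, f T) = (v, f T')"
    show "T = T'"
    proof (rule ccontr)
      assume "T \<noteq> T'"
      then have "parcs T \<inter> parcs T' = {}"
        using F(3) T by (auto simp: pairwise_def internally_disjoint_def)
      then show False using f[OF T(1)] f[OF T(2)] T(3) by auto
    qed
  qed
  moreover have "(\<lambda>T. (v, f T)) ` F \<subseteq> out_arcs (with_proj G) v"
    using f S_treeD(3)[OF F(2)] by (auto simp: out_arcs_def)
  moreover have "finite (out_arcs (with_proj G) v)"
    using G by (auto simp: out_arcs_def pair_graph_iff intro: finite_subset)
  ultimately show "card F \<le> out_degree (with_proj G) v"
    unfolding out_degree_def by (rule card_inj_on_le)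
qed

text \<open>On its way from u to w every tree leaves A through C. Vertices of C are not in S, so
  different trees use different ones.\<close>

lemma set_connectivity_le_cut:
  assumes G: "pair_graph G" and C: "finite C" "S \<inter> C = {}"
    and S: "u \<in> S" "w \<in> S" "u \<in> A" "w \<notin> A"
    and cut: "\<And>a b. (a, b) \<in> parcs G \<Longrightarrow> a \<in> A \<Longrightarrow> b \<in> A \<union> C"
  shows "set_connectivity G S \<le> card C"
proof (rule set_connectivity_le[OF G])
  fix F assume F: "finite F" "\<And>T. T \<in> F \<Longrightarrow> S_tree G S T" "pairwise (internally_disjoint S) F"
  have "\<exists>c. c \<in> C \<and> c \<in> pverts T" if "T \<in> F" for T
  proof (rule ccontr)
    assume no: "\<not> ?thesis"
    note T = S_treeD[OF F(2)[OF that]]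
    have TV: "parcs T \<subseteq> pverts T \<times> pverts T" using T(1) by (simp add: pair_graph_iff)
    have "(u, w) \<in> (parcs T)\<^sup>*" using T(4) S by (intro T(5)) auto
    then have "w \<in> A"
    proof (induction rule: rtrancl_induct)
      case (step a b)
      then show ?case using cut[of a b] T(3) TV no by blast
    qed (use S in simp)
    then show False using S by simp
  qed
  then obtain f where f: "\<And>T. T \<in> F \<Longrightarrow> f T \<in> C \<and> f T \<in> pverts T" by metis
  have "inj_on f F"
  proof (rule inj_onI)
    fix T T' assume T: "T \<in> F" "T' \<in> F" "f T = f T'"
    show "T = T'"
    proof (rule ccontr)
      assume "T \<noteq> T'"
      then have "pverts T \<inter> pverts T' = S"
        using F(3) T by (auto simp: pairwise_def internally_disjoint_def)
      then show False using f[OF T(1)] f[OF T(2)] T(3) C(2) by auto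
    qed
  qed
  moreover have "f ` F \<subseteq> C" using f by auto
  ultimately show "card F \<le> card C" using C(1) by (intro card_inj_on_le)
qed

lemma finite_set_connectivities:
  "finite (pverts G) \<Longrightarrow> finite {set_connectivity G S | S. S \<subseteq> pverts G \<and> card S = k}"
  by (rule finite_subset[of _ "set_connectivity G ` Pow (pverts G)"]) auto

lemma gen_connectivity_le:
  assumes "pair_graph G" "S \<subseteq> pverts G" "card S = k"
  shows "gen_connectivity k G \<le> set_connectivity G S"
proof -
  have fin: "finite (pverts G)" using assms(1) by (simp add: pair_graph_iff)
  then have "k \<le> card (pverts G)" using assms card_mono by blast
  then show ?thesis
    unfolding gen_connectivity_def
    using Min_le[OF finite_set_connectivities[OF fin]] assms(2,3) by auto
qed

lemma gen_connectivity_ge: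
  assumes "connected_graph G" "k \<le> card (pverts G)"
    and "\<And>S. S \<subseteq> pverts G \<Longrightarrow> card S = k \<Longrightarrow> n \<le> set_connectivity G S"
  shows "n \<le> gen_connectivity k G"
proof -
  have fin: "finite (pverts G)" using assms(1) by (simp add: connected_graph_def pair_graph_iff)
  obtain S0 where "S0 \<subseteq> pverts G" "card S0 = k"
    using obtain_subset_with_card_n[OF assms(2)] by blast
  then have ne: "{set_connectivity G S | S. S \<subseteq> pverts G \<and> card S = k} \<noteq> {}" by blast
  have "n \<le> Min {set_connectivity G S | S. S \<subseteq> pverts G \<and> card S = k}"
    using assms(3) by (intro Min.boundedI[OF finite_set_connectivities[OF fin] ne]) auto
  then show ?thesis
    using assms(1,2) by (simp add: gen_connectivity_def connected_graph_def)
qed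

section \<open>Connectivity and the Cartesian product\<close>

lemma finite_cut_sizes:
  "finite (pverts G) \<Longrightarrow> finite {card X | X. X \<subseteq> pverts G \<and> Q X}"
  by (rule finite_subset[of _ "card ` Pow (pverts G)"]) auto

lemma vertex_connectivity_le:
  assumes "pair_graph G" "X \<subseteq> pverts G"
    "\<not> Digraph_Component.connected (with_proj G \<restriction> (pverts G - X)) \<or> card (pverts G - X) = 1"
  shows "vertex_connectivity G \<le> card X"
proof -
  have fin: "finite (pverts G)" using assms(1) by (simp add: pair_graph_iff)
  show ?thesis
    unfolding vertex_connectivity_def
    by (rule Min_le[OF finite_cut_sizes[OF fin]]) (use assms in blast)
qed

lemma vertex_connectivity_attained:
  assumes "pair_graph G"
  obtains X where "X \<subseteq> pverts G" "card X = vertex_connectivity G"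
    "\<not> Digraph_Component.connected (with_proj G \<restriction> (pverts G - X)) \<or> card (pverts G - X) = 1"
proof -
  have fin: "finite (pverts G)" using assms by (simp add: pair_graph_iff)
  let ?M = "{card X | X. X \<subseteq> pverts G \<and>
       (\<not> Digraph_Component.connected (with_proj G \<restriction> (pverts G - X)) \<or> card (pverts G - X) = 1)}"
  \<comment> \<open>The graph without vertices counts as disconnected, so removing all vertices is
    always admissible and the minimum is taken over a nonempty set.\<close>
  have "\<not> Digraph_Component.connected (with_proj G \<restriction> (pverts G - pverts G))"
    using connected_induce_iff[OF assms] by simp
  then have "?M \<noteq> {}" by blast
  then have "Min ?M \<in> ?M" by (rule Min_in[OF finite_cut_sizes[OF fin]])
  then show thesis using that unfolding vertex_connectivity_def by auto
qed

lemma vertex_connectivity_less_card: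
  assumes "pair_graph G" "pverts G \<noteq> {}"
  shows "vertex_connectivity G < card (pverts G)"
proof -
  have fin: "finite (pverts G)" using assms by (simp add: pair_graph_iff)
  obtain v where v: "v \<in> pverts G" using assms by auto
  then have "pverts G - (pverts G - {v}) = {v}" by auto
  then have "vertex_connectivity G \<le> card (pverts G - {v})"
    using vertex_connectivity_le[OF assms(1), of "pverts G - {v}"] by simp
  then show ?thesis using v fin by (metis card_Diff1_less le_less_trans)
qed

lemma vertex_connectivity_pos:
  assumes "connected_graph G" "2 \<le> card (pverts G)"
  shows "1 \<le> vertex_connectivity G"
proof -
  have G: "pair_graph G" "Digraph_Component.connected (with_proj G)"
    using assms by (auto simp: connected_graph_def)
  have fin: "finite (pverts G)" using G by (simp add: pair_graph_iff)
  obtain X where X: "X \<subseteq> pverts G" "card X = vertex_connectivity G"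
    "\<not> Digraph_Component.connected (with_proj G \<restriction> (pverts G - X)) \<or> card (pverts G - X) = 1"
    using vertex_connectivity_attained[OF G(1)] .
  have "X \<noteq> {}"
  proof
    assume "X = {}"
    moreover have "parcs G \<inter> pverts G \<times> pverts G = parcs G" using G by (auto simp: pair_graph_iff)
    then have "Digraph_Component.connected (with_proj G \<restriction> pverts G)"
      using connected_induce_iff[OF G(1), of "pverts G"] connected_pair_iff[OF G(1)] G(2) by simp
    ultimately show False using X(3) assms(2) by simp
  qed
  then show ?thesis using X fin by (metis One_nat_def Suc_leI card_gt_0_iff finite_subset)
qed

lemma k_connected_vertex_connectivity:
  assumes "connected_graph G"
  shows "k_connected (pverts G) (parcs G) (vertex_connectivity G)"
proof -
  have G: "pair_graph G" and ne: "pverts G \<noteq> {}"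
    using assms connected_pair_iff[of G] by (auto simp: connected_graph_def)
  show ?thesis
  proof
    fix X u v
    assume X: "X \<subseteq> pverts G" "card X < vertex_connectivity G" and uv: "u \<in> pverts G - X" "v \<in> pverts G - X"
    then have "Digraph_Component.connected (with_proj G \<restriction> (pverts G - X))"
      using vertex_connectivity_le[OF G X(1)] by auto
    then show "(u, v) \<in> (parcs G \<inter> (pverts G - X) \<times> (pverts G - X))\<^sup>*"
      using connected_induce_iff[OF G] uv by blast
  qed (use G vertex_connectivity_less_card[OF G ne] in \<open>auto simp: pair_graph_iff\<close>)
qed

text \<open>Connected arc sets suffice in place of trees: each contains a spanning tree of the
  component of x. The trees are distinct because their arc sets are disjoint and, since x and y
  differ, nonempty.\<close>

lemma set_connectivity_ge_packing:
  assumes G: "pair_graph G" and xyz: "x \<in> pverts G" "x \<noteq> y"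
    and S: "S = {x, y, z}"
    and C: "\<And>D A. (D, A) \<in> \<C> \<Longrightarrow> D \<inter> {x, y, z} = {} \<and> sym A \<and> A \<subseteq> parcs G \<and>
      A \<subseteq> (D \<union> {x, y, z}) \<times> (D \<union> {x, y, z}) \<and> (x, y) \<in> A\<^sup>* \<and> (x, z) \<in> A\<^sup>*"
    and dis: "\<And>D A D' A'. (D, A) \<in> \<C> \<Longrightarrow> (D', A') \<in> \<C> \<Longrightarrow> (D, A) \<noteq> (D', A') \<Longrightarrow>
      D \<inter> D' = {} \<and> A \<inter> A' = {}"
  shows "card \<C> \<le> set_connectivity G S"
proof -
  have Gp: "finite (pverts G)" "parcs G \<subseteq> pverts G \<times> pverts G" "\<And>v. (v, v) \<notin> parcs G"
    using G by (auto simp: pair_graph_iff)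
  have ex: "\<exists>T. S_tree G S T \<and> pverts T \<subseteq> fst c \<union> S \<and> parcs T \<subseteq> snd c" if c: "c \<in> \<C>" for c
  proof -
    obtain D A where DA: "c = (D, A)" by (cases c)
    have cA: "D \<inter> S = {}" "sym A" "A \<subseteq> parcs G" "A \<subseteq> (D \<union> S) \<times> (D \<union> S)" "(x, y) \<in> A\<^sup>*" "(x, z) \<in> A\<^sup>*"
      using C[of D A] c DA S by auto
    \<comment> \<open>D may contain vertices that A does not join to x, so the tree spans only the
      component W of x, which contains all three terminals.\<close>
    define W where "W = {v. (x, v) \<in> A\<^sup>*}"
    define B where "B = A \<inter> W \<times> W"
    have AV: "A \<subseteq> pverts G \<times> pverts G" using cA(3) Gp(2) by (rule subset_trans)
    have WV: "W \<subseteq> pverts G"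
    proof
      fix v assume "v \<in> W"
      then have "(x, v) \<in> A\<^sup>*" by (simp add: W_def)
      then show "v \<in> pverts G" by (cases rule: rtranclE) (use xyz AV in auto)
    qed
    have WD: "W \<subseteq> D \<union> S"
    proof
      fix v assume "v \<in> W"
      then have "(x, v) \<in> A\<^sup>*" by (simp add: W_def)
      then show "v \<in> D \<union> S" by (cases rule: rtranclE) (use cA(4) S in auto)
    qed
    have symB: "sym B" using cA(2) by (auto simp: B_def sym_def)
    have xv: "(x, v) \<in> B\<^sup>*" if "v \<in> W" for v
    proof -
      have "(x, v) \<in> A\<^sup>*" using that by (simp add: W_def)
      then show ?thesis
      proof (induction rule: rtrancl_induct)
        case (step a b)
        then have "(a, b) \<in> B" by (auto simp: B_def W_def)
        then show ?case using step by simp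
      qed simp
    qed
    have "(u, v) \<in> B\<^sup>*" if "u \<in> W" "v \<in> W" for u v
      using xv[OF that(1)] xv[OF that(2)] symB sym_rtrancl symD rtrancl_trans by metis
    moreover have "finite W" "W \<noteq> {}" using WV Gp(1) by (auto simp: W_def intro: finite_subset)
    moreover have "B \<subseteq> W \<times> W" "\<And>v. (v, v) \<notin> B" using cA(3) Gp(3) by (auto simp: B_def)
    ultimately obtain T where T: "undirected_tree T" "pverts T = W" "parcs T \<subseteq> B"
      using spanning_tree_exists[of W B] symB by blast
    have "S \<subseteq> W" using cA S by (auto simp: W_def)
    moreover have "pair_graph T" using T(1) by (simp add: undirected_tree_def connected_graph_def)
    then have "wf_digraph (with_proj T)" "wf_digraph (with_proj G)"
      using G by (simp_all add: wf_digraph_wp_iff pair_graph.axioms pair_digraph.axioms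
          pair_fin_digraph.axioms)
    ultimately have "S_tree G S T"
      using T WV cA(3) by (auto simp: S_tree_def subgraph_def compatible_def B_def)
    then show ?thesis using T WD DA by (intro exI[of _ T]) (auto simp: B_def)
  qed
  then obtain t where t: "\<And>c. c \<in> \<C> \<Longrightarrow> S_tree G S (t c) \<and> pverts (t c) \<subseteq> fst c \<union> S \<and> parcs (t c) \<subseteq> snd c"
    by metis
  have ne: "parcs (t c) \<noteq> {}" if "c \<in> \<C>" for c
  proof -
    note T = S_treeD[of G S "t c"]
    have "(x, y) \<in> (parcs (t c))\<^sup>*" using T(4,5) t[OF that] S by auto
    then show ?thesis using xyz(2) by auto
  qed
  have disc: "fst c \<inter> fst c' = {} \<and> snd c \<inter> snd c' = {}" if "c \<in> \<C>" "c' \<in> \<C>" "c \<noteq> c'" for c c'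
    using dis[of "fst c" "snd c" "fst c'" "snd c'"] that by simp
  have inj: "inj_on t \<C>"
  proof (rule inj_onI)
    fix c c' assume c: "c \<in> \<C>" "c' \<in> \<C>" "t c = t c'"
    show "c = c'"
    proof (rule ccontr)
      assume "c \<noteq> c'"
      then show False using disc[of c c'] c t[OF c(1)] t[OF c(2)] ne[OF c(1)] by auto
    qed
  qed
  have "card (t ` \<C>) \<le> set_connectivity G S"
  proof (rule set_connectivity_ge[OF G])
    show "S_tree G S T" if "T \<in> t ` \<C>" for T using that t by auto
    show "pairwise (internally_disjoint S) (t ` \<C>)"
      unfolding pairwise_def
    proof (intro ballI impI)
      fix T T' assume TT: "T \<in> t ` \<C>" "T' \<in> t ` \<C>" "T \<noteq> T'"
      then obtain c c' where c: "c \<in> \<C>" "c' \<in> \<C>" "T = t c" "T' = t c'" "c \<noteq> c'" by auto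
      have "parcs T \<inter> parcs T' = {}" using disc[OF c(1,2,5)] t[OF c(1)] t[OF c(2)] c by blast
      moreover have "pverts T \<inter> pverts T' \<subseteq> S" using disc[OF c(1,2,5)] t[OF c(1)] t[OF c(2)] c by blast
      moreover have "S \<subseteq> pverts T" "S \<subseteq> pverts T'" using S_treeD(4) t c by blast+
      ultimately show "internally_disjoint S T T'" by (auto simp: internally_disjoint_def)
    qed
  qed
  then show ?thesis using card_image[OF inj] by simp
qed

text \<open>The inequality of Li, Li and Zhou in additive form, free of truncated subtraction: if
  the connectivity is 4s + r, the last summand is s + floor(r/2), which leaves 3s + ceil(r/2). A
  graph with two vertices has connectivity below 2, and the conventional value 1 is enough.\<close>

lemma gen_connectivity_3_lower_bound:
  assumes G: "connected_graph G" and card2: "2 \<le> card (pverts G)"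
  shows "vertex_connectivity G \<le> gen_connectivity 3 G + (vertex_connectivity G div 2 + 1) div 2"
proof (cases "3 \<le> card (pverts G)")
  case False
  have pG: "pair_graph G" "pverts G \<noteq> {}" using G card2 by (auto simp: connected_graph_def)
  have "gen_connectivity 3 G = 1"
    using G False by (simp add: gen_connectivity_def connected_graph_def)
  moreover have "vertex_connectivity G < 2"
    using vertex_connectivity_less_card[OF pG] False card2 by simp
  ultimately show ?thesis by simp
next
  case True
  interpret k_connected "pverts G" "parcs G" "vertex_connectivity G"
    using G by (rule k_connected_vertex_connectivity)
  have "vertex_connectivity G - (vertex_connectivity G div 2 + 1) div 2 \<le> gen_connectivity 3 G"
  proof (rule gen_connectivity_ge[OF G True])
    fix S assume S: "S \<subseteq> pverts G" "card S = 3"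
    then obtain x y z where xyz: "S = {x, y, z}" "x \<noteq> y" "x \<noteq> z" "y \<noteq> z"
      by (auto simp: card_3_iff)
    have V: "x \<in> pverts G" "y \<in> pverts G" "z \<in> pverts G" using S xyz by auto
    show "vertex_connectivity G - (vertex_connectivity G div 2 + 1) div 2 \<le> set_connectivity G S"
    proof (rule tree_packing[OF V xyz(2-4)])
      fix \<C> :: "('a set \<times> 'a rel) set"
      assume "vertex_connectivity G \<le> card \<C> + (vertex_connectivity G div 2 + 1) div 2"
        and C: "\<And>D A. (D, A) \<in> \<C> \<Longrightarrow> D \<inter> {x, y, z} = {} \<and> sym A \<and> A \<subseteq> parcs G \<and>
          A \<subseteq> (D \<union> {x, y, z}) \<times> (D \<union> {x, y, z}) \<and> (x, y) \<in> A\<^sup>* \<and> (x, z) \<in> A\<^sup>*"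
          "\<And>D A D' A'. (D, A) \<in> \<C> \<Longrightarrow> (D', A') \<in> \<C> \<Longrightarrow> (D, A) \<noteq> (D', A') \<Longrightarrow>
            D \<inter> D' = {} \<and> A \<inter> A' = {}"
      moreover have "card \<C> \<le> set_connectivity G S"
        by (rule set_connectivity_ge_packing[OF _ V(1) xyz(2,1) C])
          (use G in \<open>simp_all add: connected_graph_def\<close>)
      ultimately show ?thesis by linarith
    qed
  qed
  then show ?thesis by linarith
qed

lemma vertex_connectivity_le_floor:
  assumes "k \<le> g + (k div 2 + 1) div 2" "r \<in> {0, 1, 2, 3}" "[r = k] (mod 4)"
  shows "int k \<le> \<lfloor>4 / 3 * real g + real r - 4 / 3 * real_of_int \<lceil>real r / 2\<rceil>\<rfloor>"
proof -
  define s where "s = k div 4"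
  have k: "k = 4 * s + r"
  proof -
    have "r mod 4 = r" using assms(2) by auto
    then have "r = k mod 4" using assms(3) by (simp add: cong_def)
    then show ?thesis by (simp add: s_def)
  qed
  \<comment> \<open>Once r is fixed the ceiling is a constant, and what remains is linear in s and
    g.\<close>
  consider "r = 0" | "r = 1" | "r = 2" | "r = 3" using assms(2) by auto
  then show ?thesis
  proof cases
    case 1
    then have "3 * s \<le> g" using assms(1) k by linarith
    then show ?thesis using 1 k by (simp add: le_floor_iff)
  next
    case 2
    then have "3 * s + 1 \<le> g" using assms(1) k by linarith
    moreover have "\<lceil>1 / 2 :: real\<rceil> = 1" by (simp add: ceiling_eq_iff)
    ultimately show ?thesis using 2 k by (simp add: le_floor_iff)
  next
    case 3
    then have "3 * s + 1 \<le> g" using assms(1) k by linarith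
    then show ?thesis using 3 k by (simp add: le_floor_iff)
  next
    case 4
    then have "3 * s + 2 \<le> g" using assms(1) k by linarith
    moreover have "\<lceil>3 / 2 :: real\<rceil> = 2" by (simp add: ceiling_eq_iff)
    ultimately show ?thesis using 4 k by (simp add: le_floor_iff)
  qed
qed

section \<open>Degree bounds and lifted cuts\<close>

lemma min_degree_attained:
  assumes "finite (pverts G)" "pverts G \<noteq> {}"
  obtains u where "u \<in> pverts G" "out_degree (with_proj G) u = min_degree G"
proof -
  have "min_degree G \<in> out_degree (with_proj G) ` pverts G"
    unfolding min_degree_def using assms by (intro Min_in) auto
  then show thesis using that by auto
qed

lemma out_degree_nbrs: "out_degree (with_proj G) v = card {u. (v, u) \<in> parcs G}"
proof -
  have "out_arcs (with_proj G) v = Pair v ` {u. (v, u) \<in> parcs G}"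
    by (force simp: out_arcs_def)
  then show ?thesis unfolding out_degree_def by (simp add: card_image inj_on_def)
qed

lemma min_degree_less_card:
  assumes "pair_graph G" "pverts G \<noteq> {}"
  shows "min_degree G < card (pverts G)"
proof -
  have G: "finite (pverts G)" "parcs G \<subseteq> pverts G \<times> pverts G" "\<And>v. (v, v) \<notin> parcs G"
    using assms by (auto simp: pair_graph_iff)
  obtain u where u: "u \<in> pverts G" "out_degree (with_proj G) u = min_degree G"
    using min_degree_attained[OF G(1) assms(2)] .
  have "{w. (u, w) \<in> parcs G} \<subset> pverts G" using G(2,3) u(1) by blast
  from psubset_card_mono[OF G(1) this] show ?thesis using u(2) by (simp add: out_degree_nbrs)
qed

lemma min_degree_pos:
  assumes "connected_graph G" "2 \<le> card (pverts G)"
  shows "1 \<le> min_degree G"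
proof -
  have G: "pair_graph G" "finite (pverts G)" "parcs G \<subseteq> pverts G \<times> pverts G" "pverts G \<noteq> {}"
    using assms by (auto simp: connected_graph_def pair_graph_iff)
  obtain u where u: "u \<in> pverts G" "out_degree (with_proj G) u = min_degree G"
    using min_degree_attained[OF G(2,4)] .
  have "\<not> pverts G \<subseteq> {u}"
    using assms(2) card_mono[of "{u}" "pverts G"] by auto
  then obtain v where v: "v \<in> pverts G" "v \<noteq> u" by blast
  have "(u, v) \<in> (parcs G)\<^sup>*"
    using assms(1) connected_pair_iff[OF G(1)] u v by (simp add: connected_graph_def)
  then obtain w where "(u, w) \<in> parcs G" using v(2) by (cases rule: converse_rtranclE) auto
  moreover have "finite {w. (u, w) \<in> parcs G}" using G(2,3) by (auto intro: finite_subset)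
  ultimately have "0 < out_degree (with_proj G) u" unfolding out_degree_nbrs by (auto simp: card_gt_0_iff)
  then show ?thesis using u(2) by simp
qed

lemma gen_connectivity_le_one: "card (pverts G) < k \<Longrightarrow> gen_connectivity k G \<le> 1"
  by (simp add: gen_connectivity_def)

lemma obtain_set_card_3:
  assumes "finite V" "3 \<le> card V" "u \<in> V"
  obtains v w where "v \<in> V" "w \<in> V" "u \<noteq> v" "u \<noteq> w" "v \<noteq> w"
proof -
  have "2 \<le> card (V - {u})" using assms by simp
  then obtain Y where "Y \<subseteq> V - {u}" "card Y = 2" using obtain_subset_with_card_n by metis
  then obtain v w where "Y = {v, w}" "v \<noteq> w" by (auto simp: card_2_iff)
  with \<open>Y \<subseteq> V - {u}\<close> show thesis using that[of v w] by auto
qed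

lemma gen_connectivity_3_le_degree:
  assumes "pair_graph G" "3 \<le> card (pverts G)" "u \<in> pverts G"
  shows "gen_connectivity 3 G \<le> out_degree (with_proj G) u"
proof -
  have fin: "finite (pverts G)" using assms by (simp add: pair_graph_iff)
  obtain v w where vw: "v \<in> pverts G" "w \<in> pverts G" "u \<noteq> v" "u \<noteq> w" "v \<noteq> w"
    using obtain_set_card_3[OF fin assms(2,3)] .
  have "gen_connectivity 3 G \<le> set_connectivity G {u, v, w}"
    using gen_connectivity_le[OF assms(1), of "{u, v, w}" 3] vw assms(3) by simp
  also have "\<dots> \<le> out_degree (with_proj G) u"
    using set_connectivity_le_degree[OF assms(1), of u "{u, v, w}" v] vw by auto
  finally show ?thesis .
qed

text \<open>
  The graph \<open>\<Gamma>\<close> stands for a Cartesian product with \<open>G\<close> as one of the two factors, \<open>f\<close> for the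
  projection to \<open>G\<close> and \<open>g\<close> for the other projection, with range \<open>Y\<close>.
\<close>

lemma gen_connectivity_3_le_cut:
  assumes G: "connected_graph G" "2 \<le> card (pverts G)" and \<Gamma>: "pair_graph \<Gamma>"
    and Y: "finite Y" "Y \<noteq> {}"
    and bij: "bij_betw (\<lambda>c. (f c, g c)) (pverts \<Gamma>) (pverts G \<times> Y)"
    and proj: "\<And>a b. (a, b) \<in> parcs \<Gamma> \<Longrightarrow> f a = f b \<or> (f a, f b) \<in> parcs G"
    and deg: "gen_connectivity 3 \<Gamma> \<le> (card (pverts G) - 1) + (card Y - 1)"
  shows "gen_connectivity 3 \<Gamma> \<le> vertex_connectivity G * card Y"
proof -
  have pG: "pair_graph G" "finite (pverts G)" "pverts G \<noteq> {}"
    using G by (auto simp: connected_graph_def pair_graph_iff)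
  have fin: "finite (pverts \<Gamma>)" using \<Gamma> by (simp add: pair_graph_iff)
  have \<Gamma>V: "parcs \<Gamma> \<subseteq> pverts \<Gamma> \<times> pverts \<Gamma>" using \<Gamma> by (simp add: pair_graph_iff)
  have \<kappa>: "1 \<le> vertex_connectivity G" using vertex_connectivity_pos[OF G] .
  have cY: "1 \<le> card Y" using Y by (simp add: Suc_leI card_gt_0_iff)
  have fg: "f c \<in> pverts G \<and> g c \<in> Y" if "c \<in> pverts \<Gamma>" for c
    using bij_betwE[OF bij] that by auto
  have fginj: "c = d" if "c \<in> pverts \<Gamma>" "d \<in> pverts \<Gamma>" "f c = f d" "g c = g d" for c d
    using bij that unfolding bij_betw_def inj_on_def by blast
  have pre: "\<exists>c\<in>pverts \<Gamma>. f c = a \<and> g c = b" if "a \<in> pverts G" "b \<in> Y" for a b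
  proof -
    have "(a, b) \<in> (\<lambda>c. (f c, g c)) ` pverts \<Gamma>"
      using bij that unfolding bij_betw_def by simp
    then show ?thesis by auto
  qed
  obtain X where X: "X \<subseteq> pverts G" "card X = vertex_connectivity G"
    "\<not> Digraph_Component.connected (with_proj G \<restriction> (pverts G - X)) \<or> card (pverts G - X) = 1"
    using vertex_connectivity_attained[OF pG(1)] .
  have finX: "finite X" using X(1) pG(2) by (rule finite_subset)
  consider "card (pverts \<Gamma>) < 3" | "3 \<le> card (pverts \<Gamma>)" "card (pverts G - X) = 1"
    | "3 \<le> card (pverts \<Gamma>)" "\<not> Digraph_Component.connected (with_proj G \<restriction> (pverts G - X))"
    using X(3) by linarith
  then show ?thesis
  proof cases
    case 1
    have "1 * 1 \<le> vertex_connectivity G * card Y" using \<kappa> cY by (rule mult_le_mono)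
    then show ?thesis using gen_connectivity_le_one[OF 1] by linarith
  next
    case 2
    \<comment> \<open>The cut leaves one vertex, so the connectivity is one less than the order of
      G, and lifting it need not separate anything. The bound \<open>deg\<close> replaces the cut,
      since c + (n - 1) \<le> c * n for c, n \<ge> 1.\<close>
    have "card (pverts G) - card X = 1" using 2 X(1) finX by (simp add: card_Diff_subset)
    then have "gen_connectivity 3 \<Gamma> \<le> vertex_connectivity G + (card Y - 1)" using deg X(2) by simp
    also have "\<dots> \<le> vertex_connectivity G + vertex_connectivity G * (card Y - 1)" using \<kappa> by simp
    also have "\<dots> = vertex_connectivity G * card Y" using cY by (cases "card Y") auto
    finally show ?thesis .
  next
    case 3
    have "pverts G - X \<noteq> {}"
    proof
      assume "pverts G - X = {}"
      then have "X = pverts G" using X(1) by auto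
      then show False using vertex_connectivity_less_card[OF pG(1,3)] X(2) by simp
    qed
    then obtain u w where uw: "u \<in> pverts G - X" "w \<in> pverts G - X"
      "(u, w) \<notin> (parcs G \<inter> (pverts G - X) \<times> (pverts G - X))\<^sup>*"
      using 3(2) connected_induce_iff[OF pG(1)] by blast
    let ?R = "parcs G \<inter> (pverts G - X) \<times> (pverts G - X)"
    define A where "A = {v. (u, v) \<in> ?R\<^sup>*}"
    have step: "b \<in> A \<union> X" if "(a, b) \<in> parcs G" "a \<in> A" "a \<in> pverts G - X" for a b
    proof (cases "b \<in> X")
      case False
      have "b \<in> pverts G" using that(1) pG(1) by (auto simp: pair_graph_iff)
      then have "(a, b) \<in> ?R" using that False by auto
      moreover have "(u, a) \<in> ?R\<^sup>*" using that(2) by (simp add: A_def)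
      ultimately have "(u, b) \<in> ?R\<^sup>*" by (rule rtrancl_into_rtrancl[rotated])
      then show ?thesis by (simp add: A_def)
    qed simp
    have AX: "a \<in> pverts G - X" if "a \<in> A" for a
    proof -
      have "(u, a) \<in> ?R\<^sup>*" using that by (simp add: A_def)
      then show ?thesis by (cases rule: rtranclE) (use uw in auto)
    qed
    have uA: "u \<in> A" "w \<notin> A" using uw by (auto simp: A_def)
    obtain h where h: "h \<in> Y" using Y by auto
    obtain cu where cu: "cu \<in> pverts \<Gamma>" "f cu = u" "g cu = h" using pre[of u h] uw h by auto
    obtain cw where cw: "cw \<in> pverts \<Gamma>" "f cw = w" "g cw = h" using pre[of w h] uw h by auto
    have cuw: "cu \<noteq> cw" using cu cw uA by auto
    \<comment> \<open>The cut bounds a triple that avoids the lifted cut. A third vertex is missing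
      only if Y is a single point and G - X consists of u and w.\<close>
    show ?thesis
    proof (cases "\<exists>t\<in>pverts \<Gamma>. f t \<notin> X \<and> t \<noteq> cu \<and> t \<noteq> cw")
      case True
      then obtain t where t: "t \<in> pverts \<Gamma>" "f t \<notin> X" "t \<noteq> cu" "t \<noteq> cw" by blast
      let ?S = "{cu, cw, t}" and ?C = "{c \<in> pverts \<Gamma>. f c \<in> X}"
      have "gen_connectivity 3 \<Gamma> \<le> set_connectivity \<Gamma> ?S"
        using gen_connectivity_le[OF \<Gamma>, of ?S 3] t cu cw cuw by simp
      also have "\<dots> \<le> card ?C"
      proof (rule set_connectivity_le_cut[OF \<Gamma>, where A = "{c \<in> pverts \<Gamma>. f c \<in> A}" and u = cu and w = cw])
        show "?S \<inter> ?C = {}" using cu cw t uw by auto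
      next
        fix a b assume ab: "(a, b) \<in> parcs \<Gamma>" "a \<in> {c \<in> pverts \<Gamma>. f c \<in> A}"
        have "b \<in> pverts \<Gamma>" using ab \<Gamma>V by auto
        moreover have "f b \<in> A \<union> X" using proj[OF ab(1)] step[of "f a" "f b"] AX ab(2) by auto
        ultimately show "b \<in> {c \<in> pverts \<Gamma>. f c \<in> A} \<union> ?C" by auto
      qed (use fin cu cw uA in auto)
      also have "\<dots> \<le> card (X \<times> Y)"
      proof (rule card_inj_on_le[where f = "\<lambda>c. (f c, g c)"])
        show "inj_on (\<lambda>c. (f c, g c)) ?C"
          using bij unfolding bij_betw_def by (auto elim: inj_on_subset)
        show "(\<lambda>c. (f c, g c)) ` ?C \<subseteq> X \<times> Y" using fg by auto
      qed (use finX Y in simp)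
      finally show ?thesis using X(2) by (simp add: card_cartesian_product)
    next
      case False
      \<comment> \<open>A second point h' of Y would supply the third vertex (u, h').\<close>
      have Yh: "Y = {h}"
      proof -
        have "h' = h" if "h' \<in> Y" for h'
        proof -
          obtain c where "c \<in> pverts \<Gamma>" "f c = u" "g c = h'" using pre[of u h'] uw \<open>h' \<in> Y\<close> by auto
          then show ?thesis using False uw uA cu cw by auto
        qed
        then show ?thesis using h by blast
      qed
      \<comment> \<open>Outside the lifted cut the only vertex besides cu is cw, and no arc leads
        from A to w. So all neighbours of cu project into X, and the degree of cu is at most the
        size of the cut.\<close>
      have sub: "f ` {b. (cu, b) \<in> parcs \<Gamma>} \<subseteq> X"
      proof
        fix v assume "v \<in> f ` {b. (cu, b) \<in> parcs \<Gamma>}"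
        then obtain b where b: "(cu, b) \<in> parcs \<Gamma>" "v = f b" by auto
        have bV: "b \<in> pverts \<Gamma>" using b \<Gamma>V by auto
        have "b \<noteq> cu" using b \<Gamma> by (auto simp: pair_graph_iff)
        then have "f b \<noteq> u" using fginj[OF bV cu(1)] fg[OF bV] cu Yh by auto
        then have "(u, f b) \<in> parcs G" using proj[OF b(1)] cu by auto
        then have "f b \<in> A \<union> X" using step[of u "f b"] uA uw by auto
        moreover have "f b \<notin> A"
        proof
          assume fA: "f b \<in> A"
          then have "f b \<notin> X" "b \<noteq> cw" using AX cw uA by auto
          then show False using False bV \<open>b \<noteq> cu\<close> by blast
        qed
        ultimately show "v \<in> X" using b by auto
      qed
      have "inj_on f {b. (cu, b) \<in> parcs \<Gamma>}"
      proof (rule inj_onI)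
        fix b c assume bc: "b \<in> {b. (cu, b) \<in> parcs \<Gamma>}" "c \<in> {b. (cu, b) \<in> parcs \<Gamma>}" "f b = f c"
        then have "b \<in> pverts \<Gamma>" "c \<in> pverts \<Gamma>" using \<Gamma>V by auto
        then show "b = c" using fginj[of b c] fg[of b] fg[of c] bc(3) Yh by auto
      qed
      then have "out_degree (with_proj \<Gamma>) cu \<le> card X"
        unfolding out_degree_nbrs using sub finX by (rule card_inj_on_le)
      then show ?thesis
        using gen_connectivity_3_le_degree[OF \<Gamma> 3(1) cu(1)] X(2) Yh by simp
    qed
  qed
qed

section \<open>The Cartesian product\<close>

lemma pair_graph_product:
  assumes "pair_graph G" "pair_graph H"
  shows "pair_graph (G \<box> H)"
  using assms unfolding pair_graph_iff cartesian_product_def by (auto simp: sym_def)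

lemma pverts_product: "pverts (G \<box> H) = pverts G \<times> pverts H"
  by (simp add: cartesian_product_def)

lemma out_degree_product:
  assumes "pair_graph G" "pair_graph H" "u \<in> pverts G" "v \<in> pverts H"
  shows "out_degree (with_proj (G \<box> H)) (u, v) = out_degree (with_proj G) u + out_degree (with_proj H) v"
proof -
  have fin: "finite {w. (u, w) \<in> parcs G}" "finite {w. (v, w) \<in> parcs H}"
    using assms(1,2) by (auto simp: pair_graph_iff intro: finite_subset)
  have noloop: "(u, u) \<notin> parcs G" using assms(1) by (simp add: pair_graph_iff)
  have eq: "{w. ((u, v), w) \<in> parcs (G \<box> H)} =
      (\<lambda>w. (w, v)) ` {w. (u, w) \<in> parcs G} \<union> (\<lambda>w. (u, w)) ` {w. (v, w) \<in> parcs H}"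
    using assms(3,4) by (auto simp: cartesian_product_def)
  show ?thesis
    unfolding out_degree_nbrs eq
    by (subst card_Un_disjoint) (use fin noloop in \<open>auto simp: card_image inj_on_def\<close>)
qed

lemma gen_connectivity_3_product_le_degree:
  assumes G: "connected_graph G" and H: "connected_graph H"
    and two: "2 \<le> card (pverts G) \<or> 2 \<le> card (pverts H)"
  shows "gen_connectivity 3 (G \<box> H) \<le> min_degree G + min_degree H"
proof (cases "3 \<le> card (pverts (G \<box> H))")
  case True
  have p: "pair_graph G" "pair_graph H" "finite (pverts G)" "finite (pverts H)"
    "pverts G \<noteq> {}" "pverts H \<noteq> {}"
    using G H connected_pair_iff by (auto simp: connected_graph_def pair_graph_iff)
  obtain u where u: "u \<in> pverts G" "out_degree (with_proj G) u = min_degree G"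
    using min_degree_attained[OF p(3,5)] .
  obtain v where v: "v \<in> pverts H" "out_degree (with_proj H) v = min_degree H"
    using min_degree_attained[OF p(4,6)] .
  show ?thesis
    using gen_connectivity_3_le_degree[OF pair_graph_product[OF p(1,2)] True, of "(u, v)"]
      out_degree_product[OF p(1,2) u(1) v(1)] u v by (simp add: pverts_product)
next
  case False
  \<comment> \<open>With fewer than three vertices the value is at most 1 by convention. The factor
    that has two vertices is connected, so its minimum degree is at least 1.\<close>
  then have "gen_connectivity 3 (G \<box> H) \<le> 1" by (intro gen_connectivity_le_one) simp
  moreover have "1 \<le> min_degree G + min_degree H"
    using two min_degree_pos[OF G] min_degree_pos[OF H] by linarith
  ultimately show ?thesis by simp
qed

lemma gen_connectivity_3_product_le_factor:
  assumes G: "connected_graph G" and Y: "finite Y" "Y \<noteq> {}" and \<Gamma>: "pair_graph \<Gamma>"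
    and bij: "bij_betw (\<lambda>c. (f c, g c)) (pverts \<Gamma>) (pverts G \<times> Y)"
    and proj: "\<And>a b. (a, b) \<in> parcs \<Gamma> \<Longrightarrow> f a = f b \<or> (f a, f b) \<in> parcs G"
    and deg: "gen_connectivity 3 \<Gamma> \<le> (card (pverts G) - 1) + (card Y - 1)"
    and r: "r \<in> {0, 1, 2, 3}" "[r = vertex_connectivity G] (mod 4)"
  shows "int (gen_connectivity 3 \<Gamma>) \<le>
    \<lfloor>4 / 3 * real (gen_connectivity 3 G) + real r - 4 / 3 * real_of_int \<lceil>real r / 2\<rceil>\<rfloor> * int (card Y)"
    (is "_ \<le> ?b * _")
proof -
  have p: "pair_graph G" "finite (pverts G)" "pverts G \<noteq> {}"
    using G connected_pair_iff by (auto simp: connected_graph_def pair_graph_iff)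
  show ?thesis
  proof (cases "2 \<le> card (pverts G)")
    case True
    have "int (gen_connectivity 3 \<Gamma>) \<le> int (vertex_connectivity G * card Y)"
      using gen_connectivity_3_le_cut[OF G True \<Gamma> Y bij proj deg] by (simp only: of_nat_le_iff)
    also have "\<dots> \<le> ?b * int (card Y)"
      using vertex_connectivity_le_floor[OF gen_connectivity_3_lower_bound[OF G True] r]
      by (simp add: mult_right_mono)
    finally show ?thesis .
  next
    case False
    \<comment> \<open>For a one-vertex factor the connectivity is 0 but \<kappa>_3 is 1 by
      convention. The factor in the bound is then floor(4/3) = 1, and \<open>deg\<close> gives even
      card Y - 1.\<close>
    then have c1: "card (pverts G) = 1" using p by (simp add: card_gt_0_iff Suc_leI le_antisym not_less_eq_eq numeral_2_eq_2)
    have "vertex_connectivity G = 0" using vertex_connectivity_less_card[OF p(1,3)] c1 by simp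
    then have "r = 0" using r by (auto simp: cong_def)
    moreover have "gen_connectivity 3 G = 1"
      using G c1 by (simp add: gen_connectivity_def connected_graph_def)
    moreover have "\<lfloor>4 / 3 :: real\<rfloor> = 1" by (simp add: floor_eq_iff)
    ultimately have "?b = 1" by simp
    then show ?thesis using deg c1 by simp
  qed
qed

lemma product_bound_upper:
  assumes G: "connected_graph G" and H: "connected_graph H"
    and two: "2 \<le> card (pverts G) \<or> 2 \<le> card (pverts H)"
    and r1: "r1 \<in> {0, 1, 2, 3}" "[r1 = vertex_connectivity G] (mod 4)"
    and r2: "r2 \<in> {0, 1, 2, 3}" "[r2 = vertex_connectivity H] (mod 4)"
  shows "int (gen_connectivity 3 (G \<box> H)) \<le> product_bound G H r1 r2"
proof -
  have p: "pair_graph G" "pair_graph H" "finite (pverts G)" "finite (pverts H)"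
    "pverts G \<noteq> {}" "pverts H \<noteq> {}"
    using G H connected_pair_iff by (auto simp: connected_graph_def pair_graph_iff)
  note \<Gamma> = pair_graph_product[OF p(1,2)]
  note deg = gen_connectivity_3_product_le_degree[OF G H two]
  \<comment> \<open>The degree bound expressed by the orders of the factors, in the symmetric form
    that the cut argument uses for either factor.\<close>
  have deg': "gen_connectivity 3 (G \<box> H) \<le> (card (pverts G) - 1) + (card (pverts H) - 1)"
    using deg min_degree_less_card[OF p(1,5)] min_degree_less_card[OF p(2,6)] by linarith
  have "int (gen_connectivity 3 (G \<box> H)) \<le>
    \<lfloor>4 / 3 * real (gen_connectivity 3 G) + real r1 - 4 / 3 * real_of_int \<lceil>real r1 / 2\<rceil>\<rfloor> * int (card (pverts H))"
  proof (rule gen_connectivity_3_product_le_factor[OF G p(4,6) \<Gamma> _ _ deg' r1])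
    show "bij_betw (\<lambda>c. (fst c, snd c)) (pverts (G \<box> H)) (pverts G \<times> pverts H)"
      by (rule bij_betwI[where g = "\<lambda>c. c"]) (auto simp: pverts_product)
  qed (auto simp: cartesian_product_def)
  \<comment> \<open>Exchanging the two projections gives the bound for H without transporting
    anything along the isomorphism of the two products.\<close>
  moreover have "bij_betw (\<lambda>c. (snd c, fst c)) (pverts (G \<box> H)) (pverts H \<times> pverts G)"
    by (rule bij_betwI[where g = "\<lambda>c. (snd c, fst c)"]) (auto simp: pverts_product)
  then have "int (gen_connectivity 3 (G \<box> H)) \<le>
    \<lfloor>4 / 3 * real (gen_connectivity 3 H) + real r2 - 4 / 3 * real_of_int \<lceil>real r2 / 2\<rceil>\<rfloor> * int (card (pverts G))"
    by (rule gen_connectivity_3_product_le_factor[OF H p(3,5) \<Gamma> _ _ _ r2])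
      (use deg' in \<open>auto simp: cartesian_product_def\<close>)
  ultimately show ?thesis using deg unfolding product_bound_def by simp
qed

section \<open>Sharpness: an edge times a vertex\<close>

definition single_edge :: "nat pair_pre_digraph" where
  "single_edge = \<lparr> pverts = {0, 1}, parcs = {(0, 1), (1, 0)} \<rparr>"

definition single_vertex :: "nat pair_pre_digraph" where
  "single_vertex = \<lparr> pverts = {0}, parcs = {} \<rparr>"

lemma connected_single_edge: "connected_graph single_edge"
proof -
  have "pair_graph single_edge" by (auto simp: pair_graph_iff single_edge_def sym_def)
  then show ?thesis
    using connected_pair_iff[of single_edge]
    by (auto simp: connected_graph_def single_edge_def)
qed

lemma connected_single_vertex: "connected_graph single_vertex"
proof -
  have "pair_graph single_vertex" by (auto simp: pair_graph_iff single_vertex_def sym_def)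
  then show ?thesis
    using connected_pair_iff[of single_vertex]
    by (auto simp: connected_graph_def single_vertex_def)
qed

lemma connected_edge_product: "connected_graph (single_edge \<box> single_vertex)"
proof -
  let ?G = "single_edge \<box> single_vertex"
  have pg: "pair_graph ?G"
    using connected_single_edge connected_single_vertex
    by (intro pair_graph_product) (auto simp: connected_graph_def)
  have "pverts ?G = {(0, 0), (1, 0)}" "((0, 0), (1, 0)) \<in> parcs ?G" "((1, 0), (0, 0)) \<in> parcs ?G"
    by (auto simp: cartesian_product_def single_edge_def single_vertex_def)
  then show ?thesis using connected_pair_iff[OF pg] pg by (auto simp: connected_graph_def)
qed

text \<open>The product is again an edge, with value 1 by convention. The three entries are
  floor(4/3 + 1 - 4/3) * 1 = 1, floor(4/3) * 2 = 2 and 1 + 0 = 1.\<close>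

lemma product_bound_attained:
  "vertex_connectivity single_edge = 1" "vertex_connectivity single_vertex = 0"
  "int (gen_connectivity 3 (single_edge \<box> single_vertex)) = product_bound single_edge single_vertex 1 0"
proof -
  have p: "pair_graph single_edge" "pair_graph single_vertex"
    using connected_single_edge connected_single_vertex by (auto simp: connected_graph_def)
  have c: "card (pverts single_edge) = 2" "card (pverts single_vertex) = 1"
    by (auto simp: single_edge_def single_vertex_def)
  have "pverts single_edge \<noteq> {}" "pverts single_vertex \<noteq> {}"
    by (auto simp: single_edge_def single_vertex_def)
  note ne = this
  show "vertex_connectivity single_edge = 1"
    using vertex_connectivity_less_card[OF p(1) ne(1)] vertex_connectivity_pos[OF connected_single_edge] c
    by simp
  show "vertex_connectivity single_vertex = 0"
    using vertex_connectivity_less_card[OF p(2) ne(2)] c by simp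
  have g: "gen_connectivity 3 single_edge = 1" "gen_connectivity 3 single_vertex = 1"
    using connected_single_edge connected_single_vertex c
    by (simp_all add: gen_connectivity_def connected_graph_def)
  have "gen_connectivity 3 (single_edge \<box> single_vertex) = 1"
    using connected_edge_product c
    by (simp add: gen_connectivity_def connected_graph_def pverts_product card_cartesian_product)
  moreover have "min_degree single_edge = 1"
    using min_degree_less_card[OF p(1) ne(1)] min_degree_pos[OF connected_single_edge] c by simp
  moreover have "min_degree single_vertex = 0"
    using min_degree_less_card[OF p(2) ne(2)] c by simp
  moreover have "\<lfloor>4 / 3 :: real\<rfloor> = 1" "\<lceil>1 / 2 :: real\<rceil> = 1" by (simp_all add: floor_eq_iff ceiling_eq_iff)
  ultimately show "int (gen_connectivity 3 (single_edge \<box> single_vertex)) =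
      product_bound single_edge single_vertex 1 0"
    using g c by (simp add: product_bound_def)
qed

theorem theorem1p8:
  shows "(\<forall>(G :: 'a pair_pre_digraph) (H :: 'b pair_pre_digraph) (r1 :: nat) (r2 :: nat).
            connected_graph G \<and> connected_graph H \<and>
            (2 \<le> card (pverts G) \<or> 2 \<le> card (pverts H)) \<and>
            r1 \<in> {0, 1, 2, 3} \<and> [r1 = vertex_connectivity G] (mod 4) \<and>
            r2 \<in> {0, 1, 2, 3} \<and> [r2 = vertex_connectivity H] (mod 4) \<longrightarrow>
            int (gen_connectivity 3 (G \<box> H)) \<le> product_bound G H r1 r2) \<and>
         (\<exists>(G :: nat pair_pre_digraph) (H :: nat pair_pre_digraph) (r1 :: nat) (r2 :: nat).
            connected_graph G \<and> connected_graph H \<and>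
            (2 \<le> card (pverts G) \<or> 2 \<le> card (pverts H)) \<and>
            r1 \<in> {0, 1, 2, 3} \<and> [r1 = vertex_connectivity G] (mod 4) \<and>
            r2 \<in> {0, 1, 2, 3} \<and> [r2 = vertex_connectivity H] (mod 4) \<and>
            int (gen_connectivity 3 (G \<box> H)) = product_bound G H r1 r2)"
proof (intro conjI)
  show "\<forall>(G :: 'a pair_pre_digraph) (H :: 'b pair_pre_digraph) (r1 :: nat) (r2 :: nat).
            connected_graph G \<and> connected_graph H \<and>
            (2 \<le> card (pverts G) \<or> 2 \<le> card (pverts H)) \<and>
            r1 \<in> {0, 1, 2, 3} \<and> [r1 = vertex_connectivity G] (mod 4) \<and>
            r2 \<in> {0, 1, 2, 3} \<and> [r2 = vertex_connectivity H] (mod 4) \<longrightarrow>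
            int (gen_connectivity 3 (G \<box> H)) \<le> product_bound G H r1 r2"
    using product_bound_upper by blast
next
  show "\<exists>(G :: nat pair_pre_digraph) (H :: nat pair_pre_digraph) (r1 :: nat) (r2 :: nat).
            connected_graph G \<and> connected_graph H \<and>
            (2 \<le> card (pverts G) \<or> 2 \<le> card (pverts H)) \<and>
            r1 \<in> {0, 1, 2, 3} \<and> [r1 = vertex_connectivity G] (mod 4) \<and>
            r2 \<in> {0, 1, 2, 3} \<and> [r2 = vertex_connectivity H] (mod 4) \<and>
            int (gen_connectivity 3 (G \<box> H)) = product_bound G H r1 r2"
    using product_bound_attained connected_single_edge connected_single_vertex
    by (intro exI[of _ single_edge] exI[of _ single_vertex] exI[of _ 1] exI[of _ 0])
      (simp add: single_edge_def)
qed

end
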